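(* Let $\{\theta^k\}_{k\in\mathbb N}$ be the iterates generated by the EM++ algorithm (defined in the context). If $\bar{\mathcal L}$ satisfies the KL property, and if Assumptions 1, 2 and 3 (stated in the context) hold, then $\{\theta^k\}_{k\in\mathbb N}$ converges to a stationary point, i.e. $$\lim_{k\to\infty}\theta^k=\theta^\star\quad\text{with }\nabla\bar{\mathcal L}(\theta^\star)=0.$$ If, additionally, the KL function $\psi$ of $\bar{\mathcal L}$ is of the form $\psi(s)=c\,s^{1-\alpha}$ with $c>0$, $\alpha\in[0,1)$, then: (a) if $\alpha=0$, then $\{\theta^k\}$ converges to $\theta^\star$ in a finite number of steps; (b) if $\alpha\in(0,1/2]$, then there exist $\omega>0$ and $\tau\in[0,1)$ such that $\|\theta^k-\theta^\star\|\le\omega\tau^k$; (c) if $\alpha\in(1/2,1)$, then there exists $\omega>0$ such that $\|\theta^k-\theta^\star\|\le\omega k^{-\frac{1-\alpha}{2\alpha-1}}$ (for $k\ge1$).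
   Context: **Model.** Let $d,T,n_y,n_z,t_y,n_g\ge 1$ be integers, $\Xi=\{1,\dots,d\}$, and $\mathcal B$ a Euclidean space. The parameter is $\theta=(\Theta,\beta)$ with $\Theta=\{\Theta_i\}_{i=1}^d$, $\Theta_i\in\mathbb R^{n_z\times d}$, and $\beta=\{\beta_i\}_{i=1}^d\in\mathcal B^d$. Throughout, the last column of each $\Theta_i$ is fixed to zero (this removes the translation invariance of softmax), and derivatives in $\Theta$ are taken within this subspace. $\mathbb T$ is the Euclidean space of all such $(\Theta,\beta)$; $\mathcal X_\beta\subseteq\mathcal B$ and $\mathcal X_f\subseteq\mathbb R^{n_g}$ are convex open sets, and $\mathcal X_\theta=\{(\Theta,\beta)\in\mathbb T:\beta\in\mathcal X_\beta^d\}$. Functions are set to $+\infty$ outside their domain. With $\mathrm{lse}(x)=\ln\sum_j e^{x_j}$ and $\sigma_i(x)=e^{x_i}/\sum_j e^{x_j}$, the latent modes $\xi_t\in\Xi$ and observations $y_t\in\mathbb R^{n_y}$ follow $$p(\xi_{t+1}\mid z_t,\xi_t=i;\Theta)=\sigma_{\xi_{t+1}}(\Theta_i^\top z_t),\qquad p(y_{t+1}\mid z_t,\xi_{t+1}=j;\beta)=C\exp[-f(G(y_{t+1},z_t,\beta_j))],$$ with $C>0$ independent of the parameters, $f:\mathcal X_f\to\mathbb R$, $G:\mathbb R^{n_y}\times\mathbb R^{n_z}\times\mathcal X_\beta\to\mathcal X_f$, and $z_t=\Upsilon(y_t,\dots,y_{t-t_y+1})\in\mathbb R^{n_z}$ for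 a known map $\Upsilon$. A trajectory $\mathbf y=\{y_t\}_{t=0}^T$ with initialization $z_0$ is given; $G_t(\cdot)=G(y_{t+1},z_t,\cdot)$. **Loss.** For $\boldsymbol\xi=(\xi_0,\dots,\xi_T)\in\Xi^{T+1}$ let $p(\mathbf y,\boldsymbol\xi,z_0;\theta)=p(\xi_0,z_0)\prod_{t=0}^{T-1}p(y_{t+1}\mid z_t,\xi_{t+1};\beta)\,p(\xi_{t+1}\mid z_t,\xi_t;\Theta)$, where $p(\xi_0,z_0)$ does not depend on $\theta$. Define vectors in $\mathbb R^{d^{T+1}}$ indexed by $\boldsymbol\xi$: $c_{\boldsymbol\xi}=\ln p(\xi_0,z_0)+T\ln C$ (real, so $p(\xi_0,z_0)>0$), $\Psi_{\boldsymbol\xi}(\Theta)=\sum_{t=0}^{T-1}[\mathrm{lse}(\Theta_{\xi_t}^\top z_t)-\Theta_{\xi_t,\xi_{t+1}}^\top z_t]$ (where $\Theta_{i,j}$ is the $j$-th column of $\Theta_i$), $\Phi_{\boldsymbol\xi}(\beta)=\sum_{t=0}^{T-1}f(G_t(\beta_{\xi_{t+1}}))$. The negative log-likelihood is $\mathcal L(\theta)=-\ln\sum_{\boldsymbol\xi}p(\mathbf y,\boldsymbol\xi,z_0;\theta)=-\mathrm{lse}(c-\Psi(\Theta)-\Phi(\beta))$, and $\bar{\mathcal L}=\mathcal L+\mathcal R$ with a regularizer $\mathcal R$. Let $\Pi_{\boldsymbol\xi}(\theta)=p(\boldsymbol\xi\mid\mathbf y,z_0;\theta)=p(\mathbf y,\boldsymbol\xi,z_0;\theta)/\sum_{\boldsymbol\xi'}p(\mathbf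 y,\boldsymbol\xi',z_0;\theta)$. **Assumption 1.** (a) The $i$-th entry of $G$ is $\beta\mapsto g_i(T_i(y,z,\beta))$ with $g_i$ strictly continuous (i.e. locally Lipschitz) and convex, and $T_i$ an affine mapping of $\beta$, for all $y\in\mathbb R^{n_y},z\in\mathbb R^{n_z}$. (b) $f$ is continuously differentiable, concave and strictly increasing with $\nabla f(x)>0$ component-wise, and $\|\nabla f(x)\|_\infty\le\bar u$ for all $x\in\mathcal X_f$, for some $\bar u\in(0,\infty)$. **Assumption 2.** $\mathcal R:\mathcal X_\theta\to\mathbb R$ satisfies $\mathcal R(\theta)=\mathcal R_1(\Theta)+\mathcal R_2(\beta)$ with $\mathcal R_1,\mathcal R_2$ convex, and there are $\kappa_1,\kappa_2>0$, $c_1,c_2\in\mathbb R$ such that for all $\boldsymbol\xi\in\Xi^{T+1}$: $\Psi_{\boldsymbol\xi}(\Theta)+\mathcal R_1(\Theta)\ge\kappa_1\|\Theta\|+c_1$ and $\Phi_{\boldsymbol\xi}(\beta)+\mathcal R_2(\beta)\ge\kappa_2\|\beta\|+c_2$. **Assumption 3.** (Lipschitz smooth means $\mathcal C^1$ with Lipschitz continuous gradient.) (a) $G_t$ is Lipschitz smooth on any compact subset of $\mathcal X_\beta$ for all $t\in\{0,\dots,T-1\}$. (b) $f$ is Lipschitz smooth on any compact subset of $\mathcal X_f$. (c) One of the following holds: (i) $\mathcal R$ is of class $\mathcal C^2$ with $\nabla^2\mathcal R(\theta)\succ0$ for all $\theta\in\mathcal X_\theta$; or (ii) $\mathcal R$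 is Lipschitz smooth on any compact subset of $\mathcal X_\theta$, and there is a nonempty $\mathcal I\subseteq\{1,\dots,n_g\}$ such that for all $i\in\mathcal I$, $g_i$ is of class $\mathcal C^2$ with $\nabla^2g_i(u)\succ0$ for all $u$ in the domain of $g_i$, and $\sum_{t=0}^{T-1}z_tz_t^\top\succ0$, $\sum_{t=0}^{T-1}\sum_{i\in\mathcal I}J_{i,t}^\top J_{i,t}\succ0$, where $J_{i,t}$ is the Jacobian of $\beta\mapsto T_i(y_{t+1},z_t,\beta)$. **EM++ algorithm.** Start from $\theta^0\in\mathcal X_\theta$. For $k=0,1,\dots$, set $\mathcal Q_1^k(\Theta)=\Pi(\theta^k)^\top\Psi(\Theta)$ and $\mathcal Q_2^k(\beta)=\Pi(\theta^k)^\top\hat\Phi^k(\beta)$, where $\hat\Phi^k_{\boldsymbol\xi}(\beta)=\sum_{t=0}^{T-1}\big[f(G_t(\beta^k_{\xi_{t+1}}))+\langle\nabla f(G_t(\beta^k_{\xi_{t+1}})),G_t(\beta_{\xi_{t+1}})-G_t(\beta^k_{\xi_{t+1}})\rangle\big]$; then $\Theta^{k+1}\in\arg\min_\Theta\mathcal Q_1^k(\Theta)+\mathcal R_1(\Theta)$, $\beta^{k+1}\in\arg\min_\beta\mathcal Q_2^k(\beta)+\mathcal R_2(\beta)$, and $\theta^{k+1}=(\Theta^{k+1},\beta^{k+1})$. **KL property.** A proper lower semicontinuous function $\eta$ with values in $\mathbb R\cup\{\infty\}$ satisfies the KL property at $\bar\theta\in\mathcal X_\theta$ if there exist a concave function (the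 KL function) $\psi:[0,b]\to[0,+\infty)$ with $b>0$ and a neighborhood $U_{\bar\theta}$ of $\bar\theta$ such that $\psi(0)=0$; $\psi\in\mathcal C^1$ with $\psi'>0$ on $(0,b)$; and for all $\theta\in U_{\bar\theta}$ with $\eta(\bar\theta)<\eta(\theta)<\eta(\bar\theta)+b$ one has $\psi'(\eta(\theta)-\eta(\bar\theta))\,\mathrm{dist}(0,\partial\eta(\theta))\ge1$. The function satisfies the KL property if it does so at every point of $\mathcal X_\theta$. *)

theory Defs
  imports "HOL-Analysis.Analysis"
begin

section \<open>Calculus relative to a linear subspace\<close>

text \<open>
  The set \<open>S\<close> below is a linear subspace of the ambient Euclidean space, considered as a Euclidean
  space of its own; \<open>S = UNIV\<close> gives the usual notions. The sets \<open>X \<subseteq> S\<close> on which smoothness is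
  asserted are open relative to \<open>S\<close>. As \<open>S\<close> is a subspace, a gradient or Hessian within \<open>S\<close> is
  unique as a vector of \<open>S\<close>, respectively as an operator on \<open>S\<close>.
\<close>

definition has_gradient :: "'a::euclidean_space set \<Rightarrow> ('a \<Rightarrow> real) \<Rightarrow> 'a \<Rightarrow> 'a \<Rightarrow> bool" where
  "has_gradient S f v x \<longleftrightarrow> v \<in> S \<and> (f has_derivative (\<lambda>h. v \<bullet> h)) (at x within S)"

definition gradient :: "'a::euclidean_space set \<Rightarrow> ('a \<Rightarrow> real) \<Rightarrow> 'a \<Rightarrow> 'a" where
  "gradient S f x = (THE v. has_gradient S f v x)"

definition C1_on :: "'a::euclidean_space set \<Rightarrow> 'a set \<Rightarrow> ('a \<Rightarrow> real) \<Rightarrow> bool" where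
  "C1_on S X f \<longleftrightarrow>
     (\<forall>x\<in>X. \<exists>v. has_gradient S f v x) \<and> continuous_on X (gradient S f)"

text \<open>Lipschitz smoothness on every compact subset of \<open>X\<close>.\<close>

definition smooth_on_compacts :: "'a::euclidean_space set \<Rightarrow> 'a set \<Rightarrow> ('a \<Rightarrow> real) \<Rightarrow> bool" where
  "smooth_on_compacts S X f \<longleftrightarrow>
     C1_on S X f \<and>
     (\<forall>K. compact K \<and> K \<subseteq> X \<longrightarrow> (\<exists>L. L-lipschitz_on K (gradient S f)))"

text \<open>\<open>H x\<close> is the Hessian of \<open>f\<close> at \<open>x\<close>, as a linear operator; it depends continuously on \<open>x\<close>.\<close>

definition C2_on ::
  "'a::euclidean_space set \<Rightarrow> 'a set \<Rightarrow> ('a \<Rightarrow> real) \<Rightarrow> ('a \<Rightarrow> 'a \<Rightarrow> 'a) \<Rightarrow> bool" where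
  "C2_on S X f H \<longleftrightarrow>
     C1_on S X f \<and>
     (\<forall>x\<in>X. (gradient S f has_derivative H x) (at x within S)) \<and>
     (\<forall>h\<in>S. continuous_on X (\<lambda>x. H x h))"

text \<open>Symmetry is not part of this predicate: it is applied to Hessians of \<open>C\<^sup>2\<close> functions and to
  Gram operators only, which are symmetric.\<close>

definition pos_def :: "'a::euclidean_space set \<Rightarrow> ('a \<Rightarrow> 'a) \<Rightarrow> bool" where
  "pos_def S A \<longleftrightarrow> (\<forall>h\<in>S. h \<noteq> 0 \<longrightarrow> 0 < h \<bullet> A h)"

text \<open>Strict continuity: Lipschitz near each point, relative to \<open>D\<close>.\<close>

definition locally_lipschitz_on :: "'a::metric_space set \<Rightarrow> ('a \<Rightarrow> real) \<Rightarrow> bool" where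
  "locally_lipschitz_on D g \<longleftrightarrow>
     (\<forall>x\<in>D. \<exists>e>0. \<exists>L. L-lipschitz_on (D \<inter> ball x e) g)"

definition affine_map :: "('a::real_vector \<Rightarrow> 'b::real_vector) \<Rightarrow> bool" where
  "affine_map F \<longleftrightarrow> (\<exists>A c. linear A \<and> (\<forall>x. F x = A x + c))"


section \<open>Limiting subdifferential and the Kurdyka-Lojasiewicz property\<close>

text \<open>Extended-real-valued functions on the Euclidean space \<open>S\<close>, with the regular and the limiting
  (Mordukhovich) subdifferential of Rockafellar and Wets.\<close>

definition proper_on :: "'a set \<Rightarrow> ('a \<Rightarrow> ereal) \<Rightarrow> bool" where
  "proper_on S \<eta> \<longleftrightarrow> (\<forall>x\<in>S. \<eta> x \<noteq> -\<infinity>) \<and> (\<exists>x\<in>S. \<eta> x \<noteq> \<infinity>)"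

definition lsc_on :: "'a::topological_space set \<Rightarrow> ('a \<Rightarrow> ereal) \<Rightarrow> bool" where
  "lsc_on S \<eta> \<longleftrightarrow> (\<forall>x\<in>S. \<eta> x \<le> Liminf (at x within S) \<eta>)"

definition regular_subdiff ::
  "'a::euclidean_space set \<Rightarrow> ('a \<Rightarrow> ereal) \<Rightarrow> 'a \<Rightarrow> 'a set" where
  "regular_subdiff S \<eta> x =
     {v \<in> S. x \<in> S \<and> \<bar>\<eta> x\<bar> \<noteq> \<infinity> \<and>
        (\<forall>e>0. \<forall>\<^sub>F x' in at x within S.
            \<eta> x + ereal (v \<bullet> (x' - x) - e * norm (x' - x)) \<le> \<eta> x')}"

definition limiting_subdiff ::
  "'a::euclidean_space set \<Rightarrow> ('a \<Rightarrow> ereal) \<Rightarrow> 'a \<Rightarrow> 'a set" where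
  "limiting_subdiff S \<eta> x =
     {v. \<bar>\<eta> x\<bar> \<noteq> \<infinity> \<and>
         (\<exists>xs vs. (\<forall>n. vs n \<in> regular_subdiff S \<eta> (xs n)) \<and>
            xs \<longlonglongrightarrow> x \<and> (\<lambda>n. \<eta> (xs n)) \<longlonglongrightarrow> \<eta> x \<and> vs \<longlonglongrightarrow> v)}"

text \<open>The distance from \<open>0\<close> to \<open>V\<close>, in the extended reals because the distance to the empty set
  has to be \<open>\<infinity>\<close> (\<^const>\<open>infdist\<close> would give \<open>0\<close>).\<close>

definition dist_zero :: "'a::real_normed_vector set \<Rightarrow> ereal" where
  "dist_zero V = (INF v\<in>V. ereal (norm v))"

definition KL_function :: "(real \<Rightarrow> real) \<Rightarrow> real \<Rightarrow> bool" where
  "KL_function \<psi> b \<longleftrightarrow>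
     0 < b \<and> concave_on {0..b} \<psi> \<and> (\<forall>s\<in>{0..b}. 0 \<le> \<psi> s) \<and> \<psi> 0 = 0 \<and>
     (\<forall>s\<in>{0<..<b}. \<psi> differentiable (at s) \<and> 0 < deriv \<psi> s) \<and>
     continuous_on {0<..<b} (deriv \<psi>)"

definition KL_at ::
  "'a::euclidean_space set \<Rightarrow> ('a \<Rightarrow> ereal) \<Rightarrow> 'a \<Rightarrow> (real \<Rightarrow> real) \<Rightarrow> real \<Rightarrow> bool" where
  "KL_at S \<eta> x0 \<psi> b \<longleftrightarrow>
     KL_function \<psi> b \<and>
     (\<exists>U. open U \<and> x0 \<in> U \<and>
       (\<forall>x\<in>U \<inter> S. \<eta> x0 < \<eta> x \<and> \<eta> x < \<eta> x0 + ereal b \<longrightarrow>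
          1 \<le> ereal (deriv \<psi> (real_of_ereal (\<eta> x - \<eta> x0))) * dist_zero (limiting_subdiff S \<eta> x)))"

definition KL_property ::
  "'a::euclidean_space set \<Rightarrow> 'a set \<Rightarrow> ('a \<Rightarrow> ereal) \<Rightarrow> bool" where
  "KL_property S X \<eta> \<longleftrightarrow>
     proper_on S \<eta> \<and> lsc_on S \<eta> \<and> (\<forall>x0\<in>X. \<exists>\<psi> b. KL_at S \<eta> x0 \<psi> b)"


section \<open>The switching model\<close>

text \<open>
  Modes are the elements of a finite linearly ordered type \<open>'d\<close>. A parameter is a pair
  \<open>(\<Theta>, \<beta>)\<close>, where \<open>\<Theta> $ i\<close> is an \<open>n\<^sub>z \<times> d\<close> matrix and \<open>\<beta> $ i\<close> a point of \<open>'b\<close>; the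
  component-wise norms on products and on \<open>_ ^ 'd\<close> are the Euclidean (Frobenius) ones.
  Observations are indexed by integers, the negative times being the history needed by \<open>feature\<close>;
  only the values at times \<open>\<le> horizon\<close> matter.
\<close>

type_synonym ('nz, 'd) trans_param = "((real ^ 'd) ^ 'nz) ^ 'd"
type_synonym ('b, 'd) obs_param = "'b ^ 'd"
type_synonym ('nz, 'd, 'b) param = "('nz, 'd) trans_param \<times> ('b, 'd) obs_param"

record ('d, 'ny, 'nz, 'ng, 'b) switching_model =
  horizon :: nat
  obs_const :: real
  obs_fun :: "real ^ 'ng \<Rightarrow> real"
  obs_dom :: "(real ^ 'ng) set"
  obs_map :: "real ^ 'ny \<Rightarrow> real ^ 'nz \<Rightarrow> 'b \<Rightarrow> real ^ 'ng"
  beta_dom :: "'b set"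
  lag :: nat
  feature :: "(real ^ 'ny) list \<Rightarrow> real ^ 'nz"
  obs :: "int \<Rightarrow> real ^ 'ny"
  z_init :: "real ^ 'nz"
  init_prob :: "'d \<Rightarrow> real ^ 'nz \<Rightarrow> real"

definition valid_model ::
  "('d::finite, 'ny::finite, 'nz::finite, 'ng::finite, 'b::euclidean_space) switching_model \<Rightarrow> bool"
  where
  "valid_model M \<longleftrightarrow>
     1 \<le> horizon M \<and> 1 \<le> lag M \<and> 0 < obs_const M \<and>
     convex (beta_dom M) \<and> open (beta_dom M) \<and>
     convex (obs_dom M) \<and> open (obs_dom M) \<and>
     (\<forall>y z. \<forall>b\<in>beta_dom M. obs_map M y z b \<in> obs_dom M) \<and>
     (\<forall>i. 0 < init_prob M i (z_init M))"

definition lse :: "real ^ 'd::finite \<Rightarrow> real" where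
  "lse x = ln (\<Sum>j\<in>UNIV. exp (x $ j))"

definition softmax :: "real ^ 'd::finite \<Rightarrow> 'd \<Rightarrow> real" where
  "softmax x i = exp (x $ i) / (\<Sum>j\<in>UNIV. exp (x $ j))"

text \<open>\<open>z\<^sub>t = \<Upsilon>(y\<^sub>t, \<dots>, y\<^bsub>t-t_y+1\<^esub>)\<close>, except that \<open>z\<^sub>0\<close> is prescribed.\<close>

definition zt ::
  "('d, 'ny::finite, 'nz::finite, 'ng::finite, 'b) switching_model
     \<Rightarrow> nat \<Rightarrow> real ^ 'nz" where
  "zt M t = (if t = 0 then z_init M
             else feature M (map (\<lambda>s. obs M (int t - int s)) [0..<lag M]))"

definition Gt ::
  "('d, 'ny::finite, 'nz::finite, 'ng::finite, 'b) switching_model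
     \<Rightarrow> nat \<Rightarrow> 'b \<Rightarrow> real ^ 'ng" where
  "Gt M t b = obs_map M (obs M (int t + 1)) (zt M t) b"

text \<open>The subspace of all \<open>\<Theta>\<close> for which the last column of each \<open>\<Theta> $ i\<close> vanishes.\<close>

definition Theta_space :: "('nz::finite, 'd::{finite,linorder}) trans_param set" where
  "Theta_space = {\<Theta>. \<forall>i. column (Max UNIV) (\<Theta> $ i) = 0}"

definition param_space ::
  "('nz::finite, 'd::{finite,linorder}, 'b::euclidean_space) param set" where
  "param_space = Theta_space \<times> UNIV"

definition betas ::
  "('d::finite, 'ny::finite, 'nz::finite, 'ng::finite, 'b) switching_model
     \<Rightarrow> ('b, 'd) obs_param set" where
  "betas M = {\<beta>. \<forall>i. \<beta> $ i \<in> beta_dom M}"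

definition params ::
  "('d::{finite,linorder}, 'ny::finite, 'nz::finite, 'ng::finite, 'b::euclidean_space) switching_model
     \<Rightarrow> ('nz, 'd, 'b) param set" where
  "params M = Theta_space \<times> betas M"

definition trans_prob ::
  "('nz::finite, 'd::finite) trans_param \<Rightarrow> real ^ 'nz \<Rightarrow> 'd \<Rightarrow> 'd \<Rightarrow> real" where
  "trans_prob \<Theta> z i j = softmax (transpose (\<Theta> $ i) *v z) j"

definition obs_density ::
  "('d, 'ny::finite, 'nz::finite, 'ng::finite, 'b) switching_model
     \<Rightarrow> real ^ 'ny \<Rightarrow> real ^ 'nz \<Rightarrow> 'b \<Rightarrow> real" where
  "obs_density M y z b = obs_const M * exp (- obs_fun M (obs_map M y z b))"

text \<open>Mode sequences \<open>(\<xi>\<^sub>0, \<dots>, \<xi>\<^sub>T)\<close>.\<close>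

definition paths ::
  "('d, 'ny::finite, 'nz::finite, 'ng::finite, 'b) switching_model
     \<Rightarrow> (nat \<Rightarrow> 'd) set" where
  "paths M = {0..horizon M} \<rightarrow>\<^sub>E UNIV"

definition joint ::
  "('d::finite, 'ny::finite, 'nz::finite, 'ng::finite, 'b) switching_model
     \<Rightarrow> ('nz, 'd, 'b) param \<Rightarrow> (nat \<Rightarrow> 'd) \<Rightarrow> real" where
  "joint M \<theta> \<xi> =
     init_prob M (\<xi> 0) (z_init M) *
     (\<Prod>t<horizon M. obs_density M (obs M (int t + 1)) (zt M t) (snd \<theta> $ \<xi> (t + 1)) *
                     trans_prob (fst \<theta>) (zt M t) (\<xi> t) (\<xi> (t + 1)))"

definition nll ::
  "('d::finite, 'ny::finite, 'nz::finite, 'ng::finite, 'b) switching_model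
     \<Rightarrow> ('nz, 'd, 'b) param \<Rightarrow> real" where
  "nll M \<theta> = - ln (\<Sum>\<xi>\<in>paths M. joint M \<theta> \<xi>)"

definition posterior ::
  "('d::finite, 'ny::finite, 'nz::finite, 'ng::finite, 'b) switching_model
     \<Rightarrow> ('nz, 'd, 'b) param \<Rightarrow> (nat \<Rightarrow> 'd) \<Rightarrow> real" where
  "posterior M \<theta> \<xi> = joint M \<theta> \<xi> / (\<Sum>\<xi>'\<in>paths M. joint M \<theta> \<xi>')"

definition reg_nll ::
  "('d::finite, 'ny::finite, 'nz::finite, 'ng::finite, 'b) switching_model
     \<Rightarrow> (('nz, 'd, 'b) param \<Rightarrow> real) \<Rightarrow> ('nz, 'd, 'b) param \<Rightarrow> real" where
  "reg_nll M R \<theta> = nll M \<theta> + R \<theta>"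

definition reg_nll_ext ::
  "('d::{finite,linorder}, 'ny::finite, 'nz::finite, 'ng::finite, 'b::euclidean_space) switching_model
     \<Rightarrow> (('nz, 'd, 'b) param \<Rightarrow> real) \<Rightarrow> ('nz, 'd, 'b) param \<Rightarrow> ereal" where
  "reg_nll_ext M R \<theta> = (if \<theta> \<in> params M then ereal (reg_nll M R \<theta>) else \<infinity>)"

definition Psi ::
  "('d::finite, 'ny::finite, 'nz::finite, 'ng::finite, 'b) switching_model
     \<Rightarrow> (nat \<Rightarrow> 'd) \<Rightarrow> ('nz, 'd) trans_param \<Rightarrow> real" where
  "Psi M \<xi> \<Theta> =
     (\<Sum>t<horizon M. lse (transpose (\<Theta> $ \<xi> t) *v zt M t) - column (\<xi> (t + 1)) (\<Theta> $ \<xi> t) \<bullet> zt M t)"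

definition Phi ::
  "('d::finite, 'ny::finite, 'nz::finite, 'ng::finite, 'b) switching_model
     \<Rightarrow> (nat \<Rightarrow> 'd) \<Rightarrow> ('b, 'd) obs_param \<Rightarrow> real" where
  "Phi M \<xi> \<beta> = (\<Sum>t<horizon M. obs_fun M (Gt M t (\<beta> $ \<xi> (t + 1))))"


section \<open>Assumptions\<close>

text \<open>
  The affine maps \<open>A i y z\<close> take values in Euclidean spaces whose dimension may depend on \<open>i\<close>.
  These are the subspaces \<open>V i\<close> of the common type \<open>'m\<close>, and \<open>D i \<subseteq> V i\<close> is the domain of \<open>g i\<close>.
\<close>

definition assumption_obs ::
  "('d::finite, 'ny::finite, 'nz::finite, 'ng::finite, 'b::euclidean_space) switching_model
     \<Rightarrow> ('ng \<Rightarrow> 'm::euclidean_space set) \<Rightarrow> ('ng \<Rightarrow> 'm set) \<Rightarrow> ('ng \<Rightarrow> 'm \<Rightarrow> real)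
     \<Rightarrow> ('ng \<Rightarrow> real ^ 'ny \<Rightarrow> real ^ 'nz \<Rightarrow> 'b \<Rightarrow> 'm) \<Rightarrow> bool" where
  "assumption_obs M V D g A \<longleftrightarrow>
     (\<forall>i. subspace (V i) \<and> D i \<subseteq> V i \<and> locally_lipschitz_on (D i) (g i) \<and> convex_on (D i) (g i)) \<and>
     (\<forall>i y z. affine_map (A i y z) \<and> range (A i y z) \<subseteq> V i \<and> A i y z ` beta_dom M \<subseteq> D i) \<and>
     (\<forall>i y z. \<forall>b\<in>beta_dom M. obs_map M y z b $ i = g i (A i y z b)) \<and>
     C1_on UNIV (obs_dom M) (obs_fun M) \<and>
     concave_on (obs_dom M) (obs_fun M) \<and>
     strict_mono_on (obs_dom M) (obs_fun M) \<and>
     (\<forall>x\<in>obs_dom M. \<forall>i. 0 < gradient UNIV (obs_fun M) x $ i) \<and>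
     (\<exists>u>0. \<forall>x\<in>obs_dom M. infnorm (gradient UNIV (obs_fun M) x) \<le> u)"

definition assumption_reg ::
  "('d::{finite,linorder}, 'ny::finite, 'nz::finite, 'ng::finite, 'b::euclidean_space) switching_model
     \<Rightarrow> (('nz, 'd, 'b) param \<Rightarrow> real) \<Rightarrow> (('nz, 'd) trans_param \<Rightarrow> real) \<Rightarrow> (('b, 'd) obs_param \<Rightarrow> real)
     \<Rightarrow> bool" where
  "assumption_reg M R R1 R2 \<longleftrightarrow>
     (\<forall>\<theta>\<in>params M. R \<theta> = R1 (fst \<theta>) + R2 (snd \<theta>)) \<and>
     convex_on Theta_space R1 \<and> convex_on (betas M) R2 \<and>
     (\<exists>\<kappa>1>0. \<exists>\<kappa>2>0. \<exists>c1 c2. \<forall>\<xi>\<in>paths M.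
        (\<forall>\<Theta>\<in>Theta_space. \<kappa>1 * norm \<Theta> + c1 \<le> Psi M \<xi> \<Theta> + R1 \<Theta>) \<and>
        (\<forall>\<beta>\<in>betas M. \<kappa>2 * norm \<beta> + c2 \<le> Phi M \<xi> \<beta> + R2 \<beta>))"

text \<open>Jacobian of \<open>b \<mapsto> A i y\<^bsub>t+1\<^esub> z\<^sub>t b\<close>; this map is affine, so the base point is irrelevant.\<close>

definition Jac ::
  "('d::finite, 'ny::finite, 'nz::finite, 'ng::finite, 'b::euclidean_space) switching_model
     \<Rightarrow> ('ng \<Rightarrow> real ^ 'ny \<Rightarrow> real ^ 'nz \<Rightarrow> 'b \<Rightarrow> 'm::euclidean_space) \<Rightarrow> 'ng \<Rightarrow> nat \<Rightarrow> 'b \<Rightarrow> 'm" where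
  "Jac M A i t = frechet_derivative (A i (obs M (int t + 1)) (zt M t)) (at 0)"

text \<open>The operators \<open>h \<mapsto> (z\<^sub>t \<bullet> h) z\<^sub>t\<close> and \<open>adjoint J \<circ> J\<close> below are the matrices
  \<open>z\<^sub>t z\<^sub>t\<^sup>T\<close> and \<open>J\<^sup>T J\<close>.\<close>

definition assumption_smooth ::
  "('d::{finite,linorder}, 'ny::finite, 'nz::finite, 'ng::finite, 'b::euclidean_space) switching_model
     \<Rightarrow> ('ng \<Rightarrow> 'm::euclidean_space set) \<Rightarrow> ('ng \<Rightarrow> 'm set) \<Rightarrow> ('ng \<Rightarrow> 'm \<Rightarrow> real)
     \<Rightarrow> ('ng \<Rightarrow> real ^ 'ny \<Rightarrow> real ^ 'nz \<Rightarrow> 'b \<Rightarrow> 'm)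
     \<Rightarrow> (('nz, 'd, 'b) param \<Rightarrow> real) \<Rightarrow> bool" where
  "assumption_smooth M V D g A R \<longleftrightarrow>
     (\<forall>t<horizon M. \<forall>i. smooth_on_compacts UNIV (beta_dom M) (\<lambda>b. Gt M t b $ i)) \<and>
     smooth_on_compacts UNIV (obs_dom M) (obs_fun M) \<and>
     ((\<exists>H. C2_on param_space (params M) R H \<and> (\<forall>\<theta>\<in>params M. pos_def param_space (H \<theta>)))
      \<or>
      (smooth_on_compacts param_space (params M) R \<and>
       (\<exists>I. I \<noteq> {} \<and>
          (\<forall>i\<in>I. openin (top_of_set (V i)) (D i) \<and>
             (\<exists>H. C2_on (V i) (D i) (g i) H \<and> (\<forall>u\<in>D i. pos_def (V i) (H u)))) \<and>
          pos_def UNIV (\<lambda>h. \<Sum>t<horizon M. (zt M t \<bullet> h) *\<^sub>R zt M t) \<and>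
          pos_def UNIV (\<lambda>h. \<Sum>t<horizon M. \<Sum>i\<in>I. adjoint (Jac M A i t) (Jac M A i t h)))))"


section \<open>The EM++ algorithm\<close>

definition Phi_hat ::
  "('d::finite, 'ny::finite, 'nz::finite, 'ng::finite, 'b) switching_model
     \<Rightarrow> ('b, 'd) obs_param \<Rightarrow> (nat \<Rightarrow> 'd)
     \<Rightarrow> ('b, 'd) obs_param \<Rightarrow> real" where
  "Phi_hat M \<beta>k \<xi> \<beta> =
     (\<Sum>t<horizon M.
        obs_fun M (Gt M t (\<beta>k $ \<xi> (t + 1))) +
        gradient UNIV (obs_fun M) (Gt M t (\<beta>k $ \<xi> (t + 1))) \<bullet>
          (Gt M t (\<beta> $ \<xi> (t + 1)) - Gt M t (\<beta>k $ \<xi> (t + 1))))"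

definition Q1 ::
  "('d::finite, 'ny::finite, 'nz::finite, 'ng::finite, 'b) switching_model
     \<Rightarrow> ('nz, 'd, 'b) param
     \<Rightarrow> ('nz, 'd) trans_param \<Rightarrow> real" where
  "Q1 M \<theta>k \<Theta> = (\<Sum>\<xi>\<in>paths M. posterior M \<theta>k \<xi> * Psi M \<xi> \<Theta>)"

definition Q2 ::
  "('d::finite, 'ny::finite, 'nz::finite, 'ng::finite, 'b) switching_model
     \<Rightarrow> ('nz, 'd, 'b) param
     \<Rightarrow> ('b, 'd) obs_param \<Rightarrow> real" where
  "Q2 M \<theta>k \<beta> = (\<Sum>\<xi>\<in>paths M. posterior M \<theta>k \<xi> * Phi_hat M (snd \<theta>k) \<xi> \<beta>)"

text \<open>The objectives are \<open>\<infinity>\<close> outside their domains, so the minimisation is over the domains.\<close>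

definition EMpp_iterates ::
  "('d::{finite,linorder}, 'ny::finite, 'nz::finite, 'ng::finite, 'b::euclidean_space) switching_model
     \<Rightarrow> (('nz, 'd) trans_param \<Rightarrow> real) \<Rightarrow> (('b, 'd) obs_param \<Rightarrow> real)
     \<Rightarrow> (nat \<Rightarrow> ('nz, 'd, 'b) param) \<Rightarrow> bool" where
  "EMpp_iterates M R1 R2 \<theta> \<longleftrightarrow>
     \<theta> 0 \<in> params M \<and>
     (\<forall>k. is_arg_min (\<lambda>\<Theta>. Q1 M (\<theta> k) \<Theta> + R1 \<Theta>) (\<lambda>\<Theta>. \<Theta> \<in> Theta_space) (fst (\<theta> (Suc k))) \<and>
          is_arg_min (\<lambda>\<beta>. Q2 M (\<theta> k) \<beta> + R2 \<beta>) (\<lambda>\<beta>. \<beta> \<in> betas M) (snd (\<theta> (Suc k))))"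

end

theory Submission
  imports Defs
begin

text \<open>
  EM++ is a majorization-minimization method. Write \<open>F\<close> for the regularized negative log-likelihood
  on the open convex set \<open>X = params M\<close> of the subspace \<open>S = param_space\<close>, and
  \<open>Sur x y = Q1 M x (fst y) + Q2 M x (snd y) + R y\<close>. Minus log-sum-exp is concave, so it lies below its
  tangent, whose slope is the posterior (\<open>nll_major\<close>), and the concave \<open>f\<close> lies below its tangent
  (\<open>Phi_le_Phi_hat\<close>). Hence \<open>F y \<le> F x + Sur x y - Sur x x\<close> (\<open>major\<close>), with equality at \<open>y = x\<close>, and
  the iteration minimizes \<open>Sur (\<theta> k)\<close>.

  Everything happens in one compact convex set: \<open>F\<close> is coercive and, extended by \<open>\<infinity>\<close>, lower
  semicontinuous, so its sublevel sets are compact subsets of \<open>X\<close> (\<open>compact_sublevel\<close>). On such a set two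
  estimates hold uniformly in the base point \<open>x\<close>.

  \<^item> \<open>Sur x\<close> is strongly midpoint convex (\<open>Sur_strong\<close>). Under a positive definite Hessian of \<open>R\<close> this
    comes from \<open>R\<close>. Otherwise the transition part is strongly convex because log-sum-exp is so on
    bounded sets of vectors with last component \<open>0\<close> (\<open>midgap_lse_strong\<close>), the observation part because
    the \<open>g i\<close> with \<open>i \<in> I\<close> are; the Gram conditions turn both into coercivity in the parameter, and the
    constant mode sequences alone already see every mode at every time.
  \<^item> The derivative of \<open>Sur x\<close> is Lipschitz (\<open>Sur_lip_deriv\<close>).

  Let \<open>d k = norm (\<theta> (Suc k) - \<theta> k)\<close>. Comparing the minimizer with the midpoint of two iterates, the first
  estimate gives \<open>a * (d k)\<^sup>2 \<le> F (\<theta> k) - F (\<theta> (Suc k))\<close>. Since \<open>Sur x - F\<close> is minimal at \<open>x\<close>, the derivatives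
  of \<open>F\<close> and \<open>Sur (\<theta> k)\<close> agree at \<open>\<theta> k\<close>, while the latter vanishes at \<open>\<theta> (Suc k)\<close>; so the second estimate
  bounds the gradient of \<open>F\<close> at \<open>\<theta> k\<close> by \<open>L * d k\<close>. Multiplying by the KL inequality at \<open>\<theta> k\<close> yields
  \<open>d k \<le> L / a * (\<psi> (r k) - \<psi> (r (Suc k)))\<close> for the excess \<open>r k = F (\<theta> k) - F l\<close> over a cluster point \<open>l\<close>
  (\<open>KL_step\<close>). The right-hand side telescopes, which keeps the iterates near \<open>l\<close> and makes them
  converge (\<open>KL_converges\<close>).

  For \<open>\<psi> s = c * s powr (1 - \<alpha>)\<close> the same telescoping bounds the distance to the limit by a multiple of
  \<open>r k powr (1 - \<alpha>)\<close>, and \<open>r (Suc k) \<le> r k - q * r k powr (2 * \<alpha>)\<close>; the three rates are the three regimes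
  of this recursion.
\<close>

section \<open>Calculus relative to a subspace\<close>

lemma has_real_derivative_along_line:
  fixes f :: "'a::real_normed_vector \<Rightarrow> real"
  assumes f: "(f has_derivative f') (at (x + s *\<^sub>R u) within S)"
    and I: "\<And>r. r \<in> I \<Longrightarrow> x + r *\<^sub>R u \<in> S"
  shows "((\<lambda>r. f (x + r *\<^sub>R u)) has_real_derivative f' u) (at s within I)"
proof -
  interpret bounded_linear f' by (rule has_derivative_bounded_linear[OF f])
  have "((\<lambda>r. x + r *\<^sub>R u) has_derivative (\<lambda>r. r *\<^sub>R u)) (at s within I)"
    by (auto intro!: derivative_eq_intros)
  moreover have "(f has_derivative f') (at (x + s *\<^sub>R u) within (\<lambda>r. x + r *\<^sub>R u) ` I)"
    by (rule has_derivative_subset[OF f]) (use I in auto)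
  ultimately have "((\<lambda>r. f (x + r *\<^sub>R u)) has_derivative (\<lambda>r. f' (r *\<^sub>R u))) (at s within I)"
    by (rule has_derivative_in_compose)
  moreover have "(\<lambda>r. f' (r *\<^sub>R u)) = (*) (f' u)" by (auto simp: fun_eq_iff scaleR)
  ultimately show ?thesis by (simp add: has_field_derivative_def)
qed

lemma subspace_line: "subspace S \<Longrightarrow> x \<in> S \<Longrightarrow> u \<in> S \<Longrightarrow> x + r *\<^sub>R u \<in> S"
  by (simp add: subspace_add subspace_scale)

lemma derivative_zero_at_local_min_within:
  fixes f :: "'a::real_normed_vector \<Rightarrow> real"
  assumes S: "subspace S" "x \<in> S" "h \<in> S"
    and f: "(f has_derivative f') (at x within S)"
    and e: "0 < e" "\<And>y. y \<in> S \<Longrightarrow> dist x y < e \<Longrightarrow> f x \<le> f y"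
  shows "f' h = 0"
proof -
  have d: "DERIV (\<lambda>r. f (x + r *\<^sub>R h)) 0 :> f' h"
    by (rule has_real_derivative_along_line[where S = S]) (use f subspace_line[OF S] in auto)
  \<comment> \<open>the \<open>+ 1\<close> covers \<open>h = 0\<close>\<close>
  define d where "d = e / (norm h + 1)"
  have hp: "0 < norm h + 1" by (smt (verit) norm_ge_zero)
  have "f x \<le> f (x + r *\<^sub>R h)" if "\<bar>r\<bar> < d" for r
  proof (rule e(2))
    have "\<bar>r\<bar> * norm h \<le> \<bar>r\<bar> * (norm h + 1)" by (simp add: mult_left_mono)
    also have "\<dots> < e" using that hp by (simp add: d_def pos_less_divide_eq)
    finally show "dist x (x + r *\<^sub>R h) < e" by (simp add: dist_norm)
  qed (rule subspace_line[OF S])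
  then show ?thesis
    by (intro DERIV_local_min[OF d, of d]) (use e(1) hp in \<open>auto simp: d_def\<close>)
qed

text \<open>
  Difference quotients within a subspace see only directions of that subspace.
\<close>

lemma has_derivative_within_cong_on_subspace:
  fixes f :: "'a::real_normed_vector \<Rightarrow> real"
  assumes "subspace S" "x \<in> S" "(f has_derivative f') (at x within S)"
    and "bounded_linear g'" "\<And>h. h \<in> S \<Longrightarrow> g' h = f' h"
  shows "(f has_derivative g') (at x within S)"
proof -
  have *: "\<forall>\<^sub>F y in at x within S. (f y - f x - f' (y - x)) /\<^sub>R norm (y - x) = (f y - f x - g' (y - x)) /\<^sub>R norm (y - x)"
    unfolding eventually_at_filter
    by (rule always_eventually) (use assms subspace_diff[OF assms(1)] in auto)
  show ?thesis
    using assms(3,4) unfolding has_derivative_at_within using Lim_transform_eventually[OF _ *] by blast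
qed

text \<open>
  The Riesz vector of the derivative in the ambient space need not lie in the subspace; its
  orthogonal projection does, and it represents the same functional there.
\<close>

lemma has_gradient_if_has_derivative:
  fixes f :: "'a::euclidean_space \<Rightarrow> real"
  assumes S: "subspace S" "x \<in> S" and f: "(f has_derivative f') (at x within S)"
  obtains v where "has_gradient S f v x" "\<And>h. h \<in> S \<Longrightarrow> v \<bullet> h = f' h"
proof -
  interpret bounded_linear f' by (rule has_derivative_bounded_linear[OF f])
  define w where "w = (\<Sum>b\<in>Basis. f' b *\<^sub>R b)"
  have w: "w \<bullet> h = f' h" for h
  proof -
    have "f' h = f' (\<Sum>b\<in>Basis. (h \<bullet> b) *\<^sub>R b)" by (simp add: euclidean_representation)
    also have "\<dots> = (\<Sum>b\<in>Basis. (h \<bullet> b) * f' b)" by (simp add: sum scaleR)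
    finally show ?thesis
      unfolding w_def inner_sum_left inner_scaleR_left by (simp add: inner_commute mult.commute)
  qed
  obtain v z where v: "v \<in> span S" "\<And>u. u \<in> span S \<Longrightarrow> orthogonal z u" "w = v + z"
    using orthogonal_subspace_decomp_exists by blast
  have vS: "v \<in> S" using v(1) S(1) by (metis span_eq_iff)
  have vh: "v \<bullet> h = f' h" if "h \<in> S" for h
    using v(2)[of h] that w[of h] v(3) by (simp add: span_base orthogonal_def inner_add_left)
  have "has_gradient S f v x"
    unfolding has_gradient_def
    using vS vh has_derivative_within_cong_on_subspace[OF S f, of "\<lambda>h. v \<bullet> h"]
    by (simp add: bounded_linear_inner_right)
  then show ?thesis using vh that by blast
qed

text \<open>
  Two gradients differ by a vector \<open>u\<close> of the subspace; the derivative along \<open>u\<close> is unique, so \<open>u \<bullet> u = 0\<close>.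
\<close>

lemma gradient_eqI:
  fixes f :: "'a::euclidean_space \<Rightarrow> real"
  assumes S: "subspace S" "x \<in> S" and v: "has_gradient S f v x"
  shows "gradient S f x = v"
  unfolding gradient_def
proof (rule the_equality)
  fix w assume w: "has_gradient S f w x"
  define u where "u = w - v"
  have u: "u \<in> S" using v w S(1) by (auto simp: u_def has_gradient_def subspace_diff)
  have "((\<lambda>r. f (x + r *\<^sub>R u)) has_real_derivative v \<bullet> u) (at 0)"
    by (rule has_real_derivative_along_line[where S = S])
       (use v subspace_line[OF S u] in \<open>auto simp: has_gradient_def\<close>)
  moreover have "((\<lambda>r. f (x + r *\<^sub>R u)) has_real_derivative w \<bullet> u) (at 0)"
    by (rule has_real_derivative_along_line[where S = S])
       (use w subspace_line[OF S u] in \<open>auto simp: has_gradient_def\<close>)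
  ultimately have "v \<bullet> u = w \<bullet> u" by (rule DERIV_unique)
  then have "u \<bullet> u = 0" by (simp add: u_def inner_diff_left)
  then show "w = v" by (simp add: u_def)
qed (rule v)

lemma C1_on_has_gradient:
  assumes "C1_on S X f" "subspace S" "X \<subseteq> S" "x \<in> X"
  shows "gradient S f x \<in> S" and "(f has_derivative (\<lambda>h. gradient S f x \<bullet> h)) (at x within S)"
proof -
  obtain v where v: "has_gradient S f v x" using assms unfolding C1_on_def by blast
  moreover have "gradient S f x = v" using gradient_eqI[OF _ _ v] assms by blast
  ultimately show "gradient S f x \<in> S" "(f has_derivative (\<lambda>h. gradient S f x \<bullet> h)) (at x within S)"
    by (auto simp: has_gradient_def)
qed

section \<open>Derivatives that are Lipschitz on a set\<close>

text \<open>
  The derivative is kept as a functional and compared only on the directions \<open>h \<in> S\<close>. In this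
  form the property passes through sums, bounded multiples and linear substitutions with explicit
  constants, which is how constants uniform in the base point of the surrogate are obtained.
\<close>

definition lip_deriv ::
  "'a::real_normed_vector set \<Rightarrow> 'a set \<Rightarrow> real \<Rightarrow> ('a \<Rightarrow> real) \<Rightarrow> ('a \<Rightarrow> 'a \<Rightarrow> real) \<Rightarrow> bool" where
  "lip_deriv S K L f f' \<longleftrightarrow>
     (\<forall>x\<in>K. (f has_derivative f' x) (at x within S)) \<and>
     (\<forall>x\<in>K. \<forall>y\<in>K. \<forall>h\<in>S. \<bar>f' x h - f' y h\<bar> \<le> L * norm (x - y) * norm h)"

lemma lip_deriv_add:
  assumes "lip_deriv S K L1 f f'" "lip_deriv S K L2 g g'"
  shows "lip_deriv S K (L1 + L2) (\<lambda>x. f x + g x) (\<lambda>x h. f' x h + g' x h)"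
  unfolding lip_deriv_def
proof (intro conjI ballI)
  fix x y h assume xy: "x \<in> K" "y \<in> K" "h \<in> S"
  have "\<bar>f' x h - f' y h\<bar> \<le> L1 * norm (x - y) * norm h" "\<bar>g' x h - g' y h\<bar> \<le> L2 * norm (x - y) * norm h"
    using assms xy unfolding lip_deriv_def by blast+
  then show "\<bar>f' x h + g' x h - (f' y h + g' y h)\<bar> \<le> (L1 + L2) * norm (x - y) * norm h"
    by (simp add: algebra_simps)
qed (use assms in \<open>auto simp: lip_deriv_def intro!: derivative_eq_intros\<close>)

lemma lip_deriv_const: "lip_deriv S K 0 (\<lambda>x. c) (\<lambda>x h. 0)"
  by (simp add: lip_deriv_def)

lemma lip_deriv_sum:
  assumes "finite A" "\<And>a. a \<in> A \<Longrightarrow> lip_deriv S K (L a) (f a) (f' a)"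
  shows "lip_deriv S K (\<Sum>a\<in>A. L a) (\<lambda>x. \<Sum>a\<in>A. f a x) (\<lambda>x h. \<Sum>a\<in>A. f' a x h)"
  using assms
proof (induction A rule: finite_induct)
  case empty
  show ?case by (simp add: lip_deriv_const)
next
  case (insert a A)
  then show ?case by (simp add: lip_deriv_add)
qed

lemma lip_deriv_scale:
  assumes "lip_deriv S K L f f'" "\<bar>c\<bar> \<le> C" "0 \<le> L"
  shows "lip_deriv S K (C * L) (\<lambda>x. c * f x) (\<lambda>x h. c * f' x h)"
  unfolding lip_deriv_def
proof (intro conjI ballI)
  fix x y h assume xy: "x \<in> K" "y \<in> K" "h \<in> S"
  have "\<bar>f' x h - f' y h\<bar> \<le> L * norm (x - y) * norm h"
    using assms xy unfolding lip_deriv_def by blast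
  then have "\<bar>c\<bar> * \<bar>f' x h - f' y h\<bar> \<le> C * (L * norm (x - y) * norm h)"
    using assms by (intro mult_mono) auto
  then show "\<bar>c * f' x h - c * f' y h\<bar> \<le> C * L * norm (x - y) * norm h"
    by (simp flip: right_diff_distrib add: abs_mult mult.assoc)
qed (use assms in \<open>auto simp: lip_deriv_def intro!: derivative_eq_intros\<close>)

lemma lip_deriv_compose_linear:
  fixes P :: "'a::real_normed_vector \<Rightarrow> 'b::real_normed_vector"
  assumes f: "lip_deriv S K L f f'" and P: "bounded_linear P" "P ` S' \<subseteq> S" "P ` K' \<subseteq> K"
    and B: "\<And>h. norm (P h) \<le> B * norm h" "0 \<le> B" and L: "0 \<le> L"
  shows "lip_deriv S' K' (L * B * B) (\<lambda>x. f (P x)) (\<lambda>x h. f' (P x) (P h))"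
  unfolding lip_deriv_def
proof (intro conjI ballI)
  interpret bounded_linear P by fact
  fix x assume x: "x \<in> K'"
  then have "(f has_derivative f' (P x)) (at (P x) within S)"
    using f P(3) unfolding lip_deriv_def by blast
  then have "(f has_derivative f' (P x)) (at (P x) within P ` S')"
    by (rule has_derivative_subset) (rule P(2))
  then show "((\<lambda>x. f (P x)) has_derivative (\<lambda>h. f' (P x) (P h))) (at x within S')"
    by (rule has_derivative_in_compose[OF bounded_linear_imp_has_derivative[OF P(1)]])
next
  interpret bounded_linear P by fact
  fix x y h assume xy: "x \<in> K'" "y \<in> K'" "h \<in> S'"
  then have "\<bar>f' (P x) (P h) - f' (P y) (P h)\<bar> \<le> L * norm (P x - P y) * norm (P h)"
    using f P unfolding lip_deriv_def by blast
  also have "\<dots> = L * norm (P (x - y)) * norm (P h)" by (simp add: diff)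
  also have "\<dots> \<le> L * (B * norm (x - y)) * (B * norm h)"
    using L B(2) by (intro mult_mono B mult_left_mono mult_nonneg_nonneg) auto
  finally show "\<bar>f' (P x) (P h) - f' (P y) (P h)\<bar> \<le> L * B * B * norm (x - y) * norm h"
    by (simp add: ac_simps)
qed

lemma smooth_on_compacts_lip_deriv:
  assumes f: "smooth_on_compacts S X f" and S: "subspace S" "X \<subseteq> S" and K: "compact K" "K \<subseteq> X"
  obtains L where "0 \<le> L" "lip_deriv S K L f (\<lambda>x h. gradient S f x \<bullet> h)"
proof -
  have C1: "C1_on S X f" using f by (simp add: smooth_on_compacts_def)
  obtain L where L: "L-lipschitz_on K (gradient S f)"
    using f K unfolding smooth_on_compacts_def by blast
  have "lip_deriv S K L f (\<lambda>x h. gradient S f x \<bullet> h)"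
    unfolding lip_deriv_def
  proof (intro conjI ballI)
    fix x assume "x \<in> K"
    then show "(f has_derivative (\<lambda>h. gradient S f x \<bullet> h)) (at x within S)"
      using C1_on_has_gradient[OF C1 S] K by blast
  next
    fix x y h assume xy: "x \<in> K" "y \<in> K"
    have "\<bar>(gradient S f x - gradient S f y) \<bullet> h\<bar> \<le> norm (gradient S f x - gradient S f y) * norm h"
      by (rule Cauchy_Schwarz_ineq2)
    also have "\<dots> \<le> (L * norm (x - y)) * norm h"
      using lipschitz_onD[OF L xy] by (intro mult_right_mono) (auto simp: dist_norm)
    finally show "\<bar>gradient S f x \<bullet> h - gradient S f y \<bullet> h\<bar> \<le> L * norm (x - y) * norm h"
      by (simp add: inner_diff_left)
  qed
  then show ?thesis using that lipschitz_on_nonneg[OF L] by blast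
qed

section \<open>Midpoint convexity\<close>

text \<open>
  A lower bound of the midpoint gap by \<open>a * (norm (x - y))\<^sup>2\<close> is all of strong convexity that
  minimization needs. The gap is linear in \<open>f\<close>, so it can be estimated summand by summand.
\<close>

definition midgap :: "('a::real_vector \<Rightarrow> real) \<Rightarrow> 'a \<Rightarrow> 'a \<Rightarrow> real" where
  "midgap f x y = (f x + f y) / 2 - f (midpoint x y)"

lemma midgap_add: "midgap (\<lambda>x. f x + g x) x y = midgap f x y + midgap g x y"
  by (simp add: midgap_def field_simps)

lemma midgap_scale: "midgap (\<lambda>x. c * f x) x y = c * midgap f x y"
  by (simp add: midgap_def field_simps)

lemma midgap_const: "midgap (\<lambda>x. c) x y = 0"
  by (simp add: midgap_def)

lemma midgap_sum: "midgap (\<lambda>x. \<Sum>a\<in>A. f a x) x y = (\<Sum>a\<in>A. midgap (f a) x y)"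
  by (simp add: midgap_def sum.distrib sum_subtractf flip: sum_divide_distrib)

lemma midpoint_affine:
  assumes "linear P"
  shows "P (midpoint x y) + c = midpoint (P x + c) (P y + c)"
proof -
  interpret linear P by fact
  have "inverse 2 *\<^sub>R c + inverse 2 *\<^sub>R c = c"
    by (simp flip: scaleR_add_left)
  then show ?thesis
    by (simp add: midpoint_def add scale scaleR_add_right)
qed

lemma midgap_affine:
  assumes "linear P"
  shows "midgap (\<lambda>x. f (P x + c)) x y = midgap f (P x + c) (P y + c)"
  by (simp add: midgap_def midpoint_affine[OF assms])

lemma midgap_linear: "linear P \<Longrightarrow> midgap (\<lambda>x. f (P x)) x y = midgap f (P x) (P y)"
  using midgap_affine[of P f 0] by simp

lemma midgap_nonneg:
  assumes "convex_on X f" "x \<in> X" "y \<in> X"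
  shows "0 \<le> midgap f x y"
  using convex_onD[OF assms(1), of "1/2" x y] assms(2,3)
  by (simp add: midgap_def midpoint_def scaleR_add_right field_simps)

text \<open>
  Subtracting the parabola with second derivative \<open>c\<close>, whose gap is \<open>c / 8\<close>, leaves a function
  with nondecreasing derivative; its increments over the two halves are compared.
\<close>

lemma midgap_ge_if_second_deriv_ge:
  fixes \<phi> :: "real \<Rightarrow> real"
  assumes d1: "\<And>s. s \<in> {0..1} \<Longrightarrow> (\<phi> has_real_derivative \<phi>' s) (at s within {0..1})"
    and d2: "\<And>s. s \<in> {0..1} \<Longrightarrow> (\<phi>' has_real_derivative \<phi>'' s) (at s within {0..1})"
    and c: "\<And>s. s \<in> {0..1} \<Longrightarrow> c \<le> \<phi>'' s"
  shows "c / 8 \<le> midgap \<phi> 0 1"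
proof -
  have mvt: "\<exists>s\<in>{a<..<b}. f b - f a = f' s * (b - a)"
    if "0 \<le> a" "a < b" "b \<le> 1" "\<And>s. s \<in> {0..1} \<Longrightarrow> (f has_real_derivative f' s) (at s within {0..1})"
    for a b and f f' :: "real \<Rightarrow> real"
  proof (rule mvt_simple[OF that(2)])
    fix s assume "a \<le> s" "s \<le> b"
    then show "(f has_derivative (*) (f' s)) (at s within {a..b})"
      using has_field_derivative_subset[OF that(4)[of s], of "{a..b}"] that
      by (auto simp: has_field_derivative_def)
  qed
  define \<psi> where "\<psi> s = \<phi> s - c / 2 * s^2" for s
  define \<psi>' where "\<psi>' s = \<phi>' s - c * s" for s
  have e1: "(\<psi> has_real_derivative \<psi>' s) (at s within {0..1})" if "s \<in> {0..1}" for s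
    unfolding \<psi>_def \<psi>'_def by (rule derivative_eq_intros d1[OF that] refl)+ simp
  have e2: "(\<psi>' has_real_derivative (\<phi>'' s - c)) (at s within {0..1})" if "s \<in> {0..1}" for s
    unfolding \<psi>_def \<psi>'_def by (rule derivative_eq_intros d2[OF that] refl)+ simp
  obtain s0 where s0: "0 < s0" "s0 < 1/2" "\<psi> (1/2) - \<psi> 0 = \<psi>' s0 * (1/2 - 0)"
    using mvt[of 0 "1/2" \<psi> \<psi>'] e1 by auto
  obtain s1 where s1: "1/2 < s1" "s1 < 1" "\<psi> 1 - \<psi> (1/2) = \<psi>' s1 * (1 - 1/2)"
    using mvt[of "1/2" 1 \<psi> \<psi>'] e1 by auto
  obtain s where s: "s0 < s" "s < s1" "\<psi>' s1 - \<psi>' s0 = (\<phi>'' s - c) * (s1 - s0)"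
    using mvt[of s0 s1 \<psi>' "\<lambda>s. \<phi>'' s - c"] e2 s0 s1 by auto
  have "0 \<le> (\<phi>'' s - c) * (s1 - s0)" using c[of s] s s0 s1 by auto
  then have "\<psi> (1/2) - \<psi> 0 \<le> \<psi> 1 - \<psi> (1/2)" using s s0 s1 by simp
  then have "\<phi> (1/2) - c/8 - \<phi> 0 \<le> \<phi> 1 - c/2 - (\<phi> (1/2) - c/8)"
    by (simp add: \<psi>_def power2_eq_square)
  then show ?thesis unfolding midgap_def midpoint_def by (simp add: field_simps)
qed

lemma C2_on_Hessian:
  assumes "C2_on S X f H"
  shows "x \<in> X \<Longrightarrow> (gradient S f has_derivative H x) (at x within S)"
    and "h \<in> S \<Longrightarrow> continuous_on X (\<lambda>x. H x h)"
  using assms unfolding C2_on_def by blast+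

lemma C2_on_line_deriv:
  assumes f: "C2_on S X f H" and S: "subspace S" "X \<subseteq> S" and u: "u \<in> S"
    and I: "\<And>r. r \<in> I \<Longrightarrow> x + r *\<^sub>R u \<in> X" and s: "s \<in> I"
  shows "((\<lambda>r. gradient S f (x + r *\<^sub>R u) \<bullet> h) has_real_derivative H (x + s *\<^sub>R u) u \<bullet> h) (at s within I)"
proof -
  have "(gradient S f has_derivative H (x + s *\<^sub>R u)) (at (x + s *\<^sub>R u) within S)"
    using f I[OF s] by (auto simp: C2_on_def)
  then have "((\<lambda>y. gradient S f y \<bullet> h) has_derivative (\<lambda>k. H (x + s *\<^sub>R u) k \<bullet> h)) (at (x + s *\<^sub>R u) within S)"
    by (auto intro!: derivative_eq_intros)
  then show ?thesis
    by (rule has_real_derivative_along_line) (use I S in auto)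
qed

text \<open>
  The Hessian is continuous along each fixed direction; the expansion in an orthonormal basis of
  the subspace turns this into bounds and continuity jointly in the point and the direction.
\<close>

lemma Hessian_expand:
  assumes f: "C2_on S X f H" and S: "subspace S"
  shows "\<exists>B. finite B \<and> B \<subseteq> S \<and> (\<forall>b\<in>B. norm b = 1) \<and>
    (\<forall>x\<in>X. \<forall>h\<in>S. H x h = (\<Sum>b\<in>B. (h \<bullet> b) *\<^sub>R H x b))"
proof -
  obtain B where B: "B \<subseteq> S" "pairwise orthogonal B" "\<And>x. x \<in> B \<Longrightarrow> norm x = 1"
      "independent B" "span B = S"
    using orthonormal_basis_subspace[OF S] by metis
  have fin: "finite B" by (rule independent_imp_finite[OF B(4)])
  have eq: "H x h = (\<Sum>b\<in>B. (h \<bullet> b) *\<^sub>R H x b)" if x: "x \<in> X" and h: "h \<in> S" for x h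
  proof -
    have bl: "bounded_linear (H x)"
      by (rule has_derivative_bounded_linear[OF C2_on_Hessian(1)[OF f x]])
    have e: "(\<Sum>b\<in>B. (h \<bullet> b) *\<^sub>R b) = h"
      by (rule orthonormal_basis_expand[OF B(2,3) _ fin]) (use B(5) h in auto)
    have "H x (\<Sum>b\<in>B. (h \<bullet> b) *\<^sub>R b) = (\<Sum>b\<in>B. (h \<bullet> b) *\<^sub>R H x b)"
      by (simp only: linear_sum[OF bounded_linear.linear[OF bl]] linear_scale[OF bounded_linear.linear[OF bl]])
    then show ?thesis unfolding e .
  qed
  show ?thesis
  proof (intro exI conjI)
    show "finite B" by (rule fin)
    show "B \<subseteq> S" by (rule B(1))
    show "\<forall>b\<in>B. norm b = 1" using B(3) by (rule ballI)
    show "\<forall>x\<in>X. \<forall>h\<in>S. H x h = (\<Sum>b\<in>B. (h \<bullet> b) *\<^sub>R H x b)"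
      by (rule ballI, rule ballI, rule eq)
  qed
qed

lemma C2_on_lip_deriv:
  assumes f: "C2_on S X f H" and S: "subspace S" "X \<subseteq> S" and K: "compact K" "convex K" "K \<subseteq> X"
  obtains L where "0 \<le> L" "lip_deriv S K L f (\<lambda>x h. gradient S f x \<bullet> h)"
proof -
  have C1: "C1_on S X f" using f by (simp add: C2_on_def)
  from Hessian_expand[OF f S(1)] obtain B where B: "finite B \<and> B \<subseteq> S \<and> (\<forall>b\<in>B. norm b = 1) \<and>
    (\<forall>x\<in>X. \<forall>h\<in>S. H x h = (\<Sum>b\<in>B. (h \<bullet> b) *\<^sub>R H x b))" ..
  note B = B[THEN conjunct1] B[THEN conjunct2, THEN conjunct1] B[THEN conjunct2, THEN conjunct2, THEN conjunct1]
    B[THEN conjunct2, THEN conjunct2, THEN conjunct2]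
  have "\<exists>C. \<forall>x\<in>K. norm (H x b) \<le> C" if "b \<in> B" for b
  proof -
    have "continuous_on K (\<lambda>x. H x b)"
      by (rule continuous_on_subset[OF C2_on_Hessian(2)[OF f subsetD[OF B(2) that]] K(3)])
    then have "bounded ((\<lambda>x. H x b) ` K)"
      by (intro compact_imp_bounded compact_continuous_image K(1))
    then show ?thesis by (auto simp: bounded_iff)
  qed
  then obtain C where C: "\<And>b x. b \<in> B \<Longrightarrow> x \<in> K \<Longrightarrow> norm (H x b) \<le> C b" by metis
  define L where "L = (\<Sum>b\<in>B. \<bar>C b\<bar>)"
  have H: "norm (H x h) \<le> L * norm h" if "x \<in> K" "h \<in> S" for x h
  proof -
    have "norm (H x h) \<le> (\<Sum>b\<in>B. norm ((h \<bullet> b) *\<^sub>R H x b))"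
      unfolding B(4)[rule_format, OF subsetD[OF K(3) that(1)] that(2)] by (rule norm_sum)
    also have "\<dots> \<le> (\<Sum>b\<in>B. norm h * \<bar>C b\<bar>)"
    proof (rule sum_mono)
      fix b assume b: "b \<in> B"
      have "\<bar>h \<bullet> b\<bar> \<le> norm h" using Cauchy_Schwarz_ineq2[of h b] B(3)[rule_format, OF b] by simp
      moreover have "norm (H x b) \<le> \<bar>C b\<bar>" using C[OF b that(1)] by simp
      ultimately show "norm ((h \<bullet> b) *\<^sub>R H x b) \<le> norm h * \<bar>C b\<bar>"
        by (simp add: mult_mono)
    qed
    finally show ?thesis by (simp add: L_def sum_distrib_left mult.commute)
  qed
  have "lip_deriv S K L f (\<lambda>x h. gradient S f x \<bullet> h)"
    unfolding lip_deriv_def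
  proof (intro conjI ballI)
    fix x assume "x \<in> K"
    then show "(f has_derivative (\<lambda>h. gradient S f x \<bullet> h)) (at x within S)"
      using C1_on_has_gradient[OF C1 S] K by blast
  next
    fix x y h assume xy: "x \<in> K" "y \<in> K" and h: "h \<in> S"
    define u where "u = y - x"
    have u: "u \<in> S" using xy K S by (auto simp: u_def intro: subspace_diff)
    have seg: "x + r *\<^sub>R u \<in> K" if "r \<in> {0..1}" for r
      using convexD_alt[OF K(2) xy, of r] that by (simp add: u_def algebra_simps)
    define \<phi> where "\<phi> r = gradient S f (x + r *\<^sub>R u) \<bullet> h" for r
    have "(\<phi> has_real_derivative H (x + s *\<^sub>R u) u \<bullet> h) (at s within {0..1})" if "s \<in> {0..1}" for s
      unfolding \<phi>_def by (rule C2_on_line_deriv[OF f S u _ that]) (use seg K(3) in auto)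
    then have "\<exists>s\<in>{0<..<1}. \<phi> 1 - \<phi> 0 = (H (x + s *\<^sub>R u) u \<bullet> h) * (1 - 0)"
      by (intro mvt_simple) (auto simp: has_field_derivative_def)
    then obtain s where s': "s \<in> {0<..<1}" "\<phi> 1 - \<phi> 0 = (H (x + s *\<^sub>R u) u \<bullet> h) * (1 - 0)"
      by (elim bexE)
    then have s: "s \<in> {0..1}" "\<phi> 1 - \<phi> 0 = H (x + s *\<^sub>R u) u \<bullet> h" by simp_all
    have "\<bar>\<phi> 1 - \<phi> 0\<bar> \<le> norm (H (x + s *\<^sub>R u) u) * norm h"
      unfolding s(2) by (rule Cauchy_Schwarz_ineq2)
    also have "\<dots> \<le> L * norm u * norm h"
      by (intro mult_right_mono H seg s u) auto
    finally show "\<bar>gradient S f x \<bullet> h - gradient S f y \<bullet> h\<bar> \<le> L * norm (x - y) * norm h"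
      by (simp add: \<phi>_def u_def norm_minus_commute abs_minus_commute)
  qed
  moreover have "0 \<le> L" by (simp add: L_def sum_nonneg)
  ultimately show ?thesis using that by blast
qed

text \<open>
  The quadratic form of the Hessian is continuous on the compact product of \<open>K\<close> with the unit sphere
  of the subspace, hence has a positive minimum there; along segments in \<open>K\<close> this is a lower bound for
  the second derivative.
\<close>

lemma C2_on_pos_def_midgap:
  assumes f: "C2_on S X f H" and S: "subspace S" "X \<subseteq> S" and K: "compact K" "convex K" "K \<subseteq> X"
    and pos: "\<And>x. x \<in> X \<Longrightarrow> pos_def S (H x)"
  obtains a where "0 < a" "\<And>x y. x \<in> K \<Longrightarrow> y \<in> K \<Longrightarrow> a * (norm (x - y))^2 \<le> midgap f x y"
proof -
  have C1: "C1_on S X f" using f by (simp add: C2_on_def)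
  from Hessian_expand[OF f S(1)] obtain B where B: "finite B \<and> B \<subseteq> S \<and> (\<forall>b\<in>B. norm b = 1) \<and>
    (\<forall>x\<in>X. \<forall>h\<in>S. H x h = (\<Sum>b\<in>B. (h \<bullet> b) *\<^sub>R H x b))" ..
  note B = B[THEN conjunct1] B[THEN conjunct2, THEN conjunct1] B[THEN conjunct2, THEN conjunct2, THEN conjunct1]
    B[THEN conjunct2, THEN conjunct2, THEN conjunct2]
  define P where "P = K \<times> (sphere 0 1 \<inter> S)"
  have P: "compact P" unfolding P_def
    by (intro compact_Times K(1) compact_Int_closed compact_sphere closed_subspace S(1))
  have cont: "continuous_on P (\<lambda>p. snd p \<bullet> H (fst p) (snd p))"
  proof -
    have "continuous_on P (\<lambda>p. \<Sum>b\<in>B. (snd p \<bullet> b) * (snd p \<bullet> H (fst p) b))"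
    proof (intro continuous_intros)
      fix b assume "b \<in> B"
      then have "continuous_on K (\<lambda>x. H x b)"
        by (intro continuous_on_subset[OF C2_on_Hessian(2)[OF f subsetD[OF B(2)]] K(3)])
      then show "continuous_on P (\<lambda>p. H (fst p) b)"
        by (rule continuous_on_compose2[where g = "\<lambda>x. H x b"]) (auto simp: P_def intro!: continuous_intros)
    qed
    moreover have "(\<Sum>b\<in>B. (snd p \<bullet> b) * (snd p \<bullet> H (fst p) b)) = snd p \<bullet> H (fst p) (snd p)" if "p \<in> P" for p
    proof -
      have "fst p \<in> X" "snd p \<in> S" using that K(3) by (auto simp: P_def)
      from arg_cong[OF B(4)[rule_format, OF this], of "\<lambda>v. snd p \<bullet> v"]
      show ?thesis by (simp only: inner_sum_right inner_scaleR_right)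
    qed
    ultimately show ?thesis by (rule continuous_on_eq)
  qed
  obtain m where m: "0 < m" "\<And>x h. x \<in> K \<Longrightarrow> h \<in> sphere 0 1 \<inter> S \<Longrightarrow> m \<le> h \<bullet> H x h"
  proof (cases "P = {}")
    case True
    then have "K = {} \<or> sphere 0 1 \<inter> S = {}" by (auto simp: P_def)
    then show ?thesis by (intro that[of 1]) auto
  next
    case False
    obtain p where p: "p \<in> P" "\<And>q. q \<in> P \<Longrightarrow> snd p \<bullet> H (fst p) (snd p) \<le> snd q \<bullet> H (fst q) (snd q)"
      using continuous_attains_inf[OF P False cont] by blast
    have p': "fst p \<in> X" "snd p \<in> S" "snd p \<noteq> 0"
      using p(1) K(3) by (auto simp: P_def)
    show ?thesis
    proof (rule that)
      show "0 < snd p \<bullet> H (fst p) (snd p)"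
        using pos[OF p'(1)] p'(2,3) unfolding pos_def_def by blast
      show "snd p \<bullet> H (fst p) (snd p) \<le> h \<bullet> H x h" if "x \<in> K" "h \<in> sphere 0 1 \<inter> S" for x h
        using p(2)[of "(x, h)"] that by (simp add: P_def)
    qed
  qed
  have quad: "m * (norm h)^2 \<le> h \<bullet> H x h" if "x \<in> K" "h \<in> S" for x h
  proof (cases "h = 0")
    case False
    interpret bounded_linear "H x"
      by (rule has_derivative_bounded_linear[OF C2_on_Hessian(1)[OF f subsetD[OF K(3) that(1)]]])
    let ?e = "h /\<^sub>R norm h"
    have "m \<le> ?e \<bullet> H x ?e" using m(2)[OF that(1), of ?e] that False S(1) by (simp add: subspace_scale)
    also have "\<dots> = (h \<bullet> H x h) / (norm h)^2" by (simp add: scaleR power2_eq_square field_simps)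
    finally show ?thesis using False by (simp add: field_simps)
  qed simp
  show ?thesis
  proof (rule that[of "m / 8"])
    show "0 < m / 8" using m by simp
    fix x y assume xy: "x \<in> K" "y \<in> K"
    define u where "u = y - x"
    have u: "u \<in> S" using xy K S by (auto simp: u_def intro: subspace_diff)
    have seg: "x + r *\<^sub>R u \<in> K" if "r \<in> {0..1}" for r
      using convexD_alt[OF K(2) xy, of r] that by (simp add: u_def algebra_simps)
    define \<phi> where "\<phi> r = f (x + r *\<^sub>R u)" for r
    have "m * (norm u)^2 / 8 \<le> midgap \<phi> 0 1"
    proof (rule midgap_ge_if_second_deriv_ge[where \<phi> = \<phi>])
      fix s :: real assume s: "s \<in> {0..1}"
      show "(\<phi> has_real_derivative gradient S f (x + s *\<^sub>R u) \<bullet> u) (at s within {0..1})"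
        unfolding \<phi>_def
        by (rule has_real_derivative_along_line[OF C1_on_has_gradient(2)[OF C1 S]]) (use seg s K S in auto)
      show "((\<lambda>s. gradient S f (x + s *\<^sub>R u) \<bullet> u) has_real_derivative H (x + s *\<^sub>R u) u \<bullet> u) (at s within {0..1})"
        by (rule C2_on_line_deriv[OF f S u _ s]) (use seg K(3) in auto)
      show "m * (norm u)^2 \<le> H (x + s *\<^sub>R u) u \<bullet> u"
        using quad[OF seg[OF s] u] by (simp add: inner_commute)
    qed
    moreover have "midgap \<phi> 0 1 = midgap f x y"
    proof -
      have "2 *\<^sub>R (x + (1/2) *\<^sub>R u) = 2 *\<^sub>R midpoint x y"
        by (simp add: u_def midpoint_def scaleR_2 scaleR_add_right)
      then have "x + (1/2) *\<^sub>R u = midpoint x y" by simp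
      moreover have "midpoint 0 1 = (1/2::real)" by (simp add: midpoint_def)
      ultimately have "\<phi> (midpoint 0 1) = f (midpoint x y)" unfolding \<phi>_def by metis
      then show ?thesis unfolding midgap_def by (simp add: \<phi>_def u_def)
    qed
    ultimately show "m / 8 * (norm (x - y))^2 \<le> midgap f x y"
      by (simp add: u_def norm_minus_commute)
  qed
qed

text \<open>
  If the tangent inequality failed, the difference of \<open>f\<close> and its chord from \<open>x\<close> to \<open>y\<close> would
  decrease initially, whereas concavity makes it at least its value at \<open>x\<close>.
\<close>

lemma concave_tangent:
  fixes f :: "'a::real_normed_vector \<Rightarrow> real"
  assumes f: "concave_on X f" and d: "(f has_derivative f') (at x)" and xy: "x \<in> X" "y \<in> X"
  shows "f y \<le> f x + f' (y - x)"
proof (rule ccontr)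
  assume neg: "\<not> ?thesis"
  define D where "D r = f (x + r *\<^sub>R (y - x)) - r * (f y - f x)" for r
  have "((\<lambda>r. f (x + r *\<^sub>R (y - x))) has_real_derivative f' (y - x)) (at 0)"
    by (rule has_real_derivative_along_line[where S = UNIV]) (use d in auto)
  then have D: "(D has_real_derivative f' (y - x) - (f y - f x)) (at 0)"
    unfolding D_def by (auto intro!: derivative_eq_intros)
  have "f' (y - x) - (f y - f x) < 0" using neg by simp
  from has_real_derivative_neg_dec_right[OF D this]
  obtain e where e: "e > 0" "\<And>h. 0 < h \<Longrightarrow> h < e \<Longrightarrow> D h < D 0"
    by auto
  define h where "h = min (e/2) 1"
  have h: "0 < h" "h < e" "h \<le> 1" using e by (auto simp: h_def)
  have "(1 - h) * f x + h * f y \<le> f ((1 - h) *\<^sub>R x + h *\<^sub>R y)"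
    using concave_onD[OF f, of h x y] xy h by simp
  moreover have "(1 - h) *\<^sub>R x + h *\<^sub>R y = x + h *\<^sub>R (y - x)" by (simp add: algebra_simps)
  ultimately have "D 0 \<le> D h" by (simp add: D_def algebra_simps)
  then show False using e(2)[OF h(1,2)] by simp
qed

lemma pos_def_coercive:
  assumes A: "linear A" and pos: "pos_def UNIV A"
  obtains l where "0 < l" "\<And>h::'a::euclidean_space. l * (norm h)^2 \<le> h \<bullet> A h"
proof -
  interpret linear A by fact
  have bl: "bounded_linear A" using A linear_conv_bounded_linear by blast
  have "continuous_on (sphere 0 1) (\<lambda>h. h \<bullet> A h)"
    by (intro continuous_intros bounded_linear.continuous_on[OF bl])
  moreover have "sphere (0::'a) 1 \<noteq> {}" by simp
  ultimately obtain e where e: "e \<in> sphere 0 1" "\<And>h. h \<in> sphere 0 1 \<Longrightarrow> e \<bullet> A e \<le> h \<bullet> A h"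
    using continuous_attains_inf[OF compact_sphere] by blast
  show ?thesis
  proof (rule that)
    have "e \<noteq> 0" using e(1) by auto
    then show "0 < e \<bullet> A e" using pos by (auto simp: pos_def_def)
    fix h :: 'a
    show "(e \<bullet> A e) * (norm h)^2 \<le> h \<bullet> A h"
    proof (cases "h = 0")
      case False
      have "e \<bullet> A e \<le> (h /\<^sub>R norm h) \<bullet> A (h /\<^sub>R norm h)" using e(2)[of "h /\<^sub>R norm h"] False by simp
      also have "\<dots> = (h \<bullet> A h) / (norm h)^2" by (simp add: scale power2_eq_square field_simps)
      finally show ?thesis using False by (simp add: field_simps)
    qed (simp add: zero)
  qed
qed

section \<open>Descent sequences under the Kurdyka-Lojasiewicz inequality\<close>

lemma KL_function_tangent:
  assumes \<psi>: "KL_function \<psi> b" and s: "0 < s" "s < b" and t: "0 < t" "t < b"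
  shows "\<psi> t \<le> \<psi> s + deriv \<psi> s * (t - s)"
proof -
  have "\<psi> differentiable (at s)" using \<psi> s by (auto simp: KL_function_def)
  then have "(\<psi> has_real_derivative deriv \<psi> s) (at s)"
    by (metis DERIV_imp_deriv real_differentiable_def)
  then have "(\<psi> has_derivative (\<lambda>h. deriv \<psi> s * h)) (at s)"
    by (simp add: has_field_derivative_def)
  moreover have "concave_on {0..b} \<psi>" using \<psi> by (simp add: KL_function_def)
  ultimately show ?thesis
    using concave_tangent[of "{0..b}" \<psi> "\<lambda>h. deriv \<psi> s * h" s t] s t by auto
qed

lemma KL_function_deriv_pos: "KL_function \<psi> b \<Longrightarrow> 0 < s \<Longrightarrow> s < b \<Longrightarrow> 0 < deriv \<psi> s"
  by (auto simp: KL_function_def)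

text \<open>
  \<open>r\<close> is the excess of the objective over its limit, \<open>a\<close> the sufficient-decrease constant, and
  \<open>L\<close> the constant that bounds the gradient at \<open>x k\<close> by the length of the next step.
\<close>

locale descent_sequence =
  fixes x :: "nat \<Rightarrow> 'a::euclidean_space" and r :: "nat \<Rightarrow> real" and a L :: real
  assumes a_pos: "0 < a" and L_nonneg: "0 \<le> L"
    and descent: "a * (norm (x (Suc k) - x k))^2 \<le> r k - r (Suc k)"
    and r_pos: "0 < r k"
    and r_lim: "r \<longlonglongrightarrow> 0"
begin

abbreviation step :: "nat \<Rightarrow> real" where "step k \<equiv> norm (x (Suc k) - x k)"

lemma r_Suc_le: "r (Suc k) \<le> r k"
  using descent[of k] a_pos by (smt (verit) mult_nonneg_nonneg zero_le_power2)

text \<open>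
  Concavity gives \<open>\<psi> (r k) - \<psi> (r (Suc k)) \<ge> deriv \<psi> (r k) * a * (step k)\<^sup>2\<close>, and one of the two factors
  \<open>step k\<close> is cancelled by the KL inequality. That the gradient is controlled by the step to come, and
  not by the previous one, is what makes this work without an arithmetic-geometric mean argument.
\<close>

lemma KL_step:
  assumes \<psi>: "KL_function \<psi> b" and b: "r k < b" and kl: "1 \<le> deriv \<psi> (r k) * (L * step k)"
  shows "step k \<le> L / a * (\<psi> (r k) - \<psi> (r (Suc k)))"
proof -
  have "\<psi> (r (Suc k)) \<le> \<psi> (r k) + deriv \<psi> (r k) * (r (Suc k) - r k)"
    by (rule KL_function_tangent[OF \<psi>]) (use r_pos b r_Suc_le[of k] in \<open>auto intro: le_less_trans\<close>)
  then have "deriv \<psi> (r k) * (r k - r (Suc k)) \<le> \<psi> (r k) - \<psi> (r (Suc k))"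
    by (simp add: algebra_simps)
  moreover have "deriv \<psi> (r k) * (a * (step k)^2) \<le> deriv \<psi> (r k) * (r k - r (Suc k))"
    by (rule mult_left_mono[OF descent]) (use KL_function_deriv_pos[OF \<psi> r_pos b] in auto)
  ultimately have 1: "deriv \<psi> (r k) * (a * (step k)^2) \<le> \<psi> (r k) - \<psi> (r (Suc k))" by simp
  have "a * step k * 1 \<le> a * step k * (deriv \<psi> (r k) * (L * step k))"
    by (rule mult_left_mono[OF kl]) (use a_pos in auto)
  also have "\<dots> = L * (deriv \<psi> (r k) * (a * (step k)^2))" by (simp add: power2_eq_square)
  also have "\<dots> \<le> L * (\<psi> (r k) - \<psi> (r (Suc k)))" by (rule mult_left_mono[OF 1 L_nonneg])
  finally show ?thesis using a_pos by (simp add: field_simps)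
qed

lemma KL_tail:
  assumes \<psi>: "KL_function \<psi> b" and "m \<le> n"
    and "\<And>j. m \<le> j \<Longrightarrow> j < n \<Longrightarrow> r j < b \<and> 1 \<le> deriv \<psi> (r j) * (L * step j)"
  shows "norm (x n - x m) \<le> L / a * (\<psi> (r m) - \<psi> (r n))"
  using assms(2,3)
proof (induction n rule: dec_induct)
  case (step n)
  have "norm (x (Suc n) - x m) \<le> norm (x (Suc n) - x n) + norm (x n - x m)"
    using norm_triangle_ineq[of "x (Suc n) - x n" "x n - x m"] by simp
  moreover have "norm (x (Suc n) - x n) \<le> L / a * (\<psi> (r n) - \<psi> (r (Suc n)))"
    by (rule KL_step[OF \<psi>]) (use step in auto)
  moreover have "norm (x n - x m) \<le> L / a * (\<psi> (r m) - \<psi> (r n))"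
    using step by auto
  ultimately show ?case by (simp add: algebra_simps)
qed simp

text \<open>
  A KL function may jump at \<open>0\<close>, so \<open>\<psi> (r k)\<close> need not tend to \<open>0\<close>. But it is decreasing and bounded
  below, and only its differences enter: once they are small and an iterate is close to the cluster
  point, the telescoped step lengths keep all later iterates inside the neighbourhood \<open>U\<close>.
\<close>

lemma KL_converges:
  assumes \<psi>: "KL_function \<psi> b" and U: "open U" "xs \<in> U"
    and kl: "\<And>k. x k \<in> U \<Longrightarrow> r k < b \<Longrightarrow> 1 \<le> deriv \<psi> (r k) * (L * step k)"
    and s: "strict_mono s" "(x \<circ> s) \<longlonglongrightarrow> xs"
  shows "x \<longlonglongrightarrow> xs"
proof (rule LIMSEQ_I)
  fix \<epsilon> :: real assume "0 < \<epsilon>"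
  obtain e0 where e0: "0 < e0" "ball xs e0 \<subseteq> U" using U open_contains_ball by blast
  define e where "e = min e0 \<epsilon>"
  have e: "0 < e" using \<open>0 < \<epsilon>\<close> e0 by (simp add: e_def)
  have b: "0 < b" using \<psi> by (simp add: KL_function_def)
  have "\<forall>\<^sub>F k in sequentially. r k < b" by (rule order_tendstoD(2)[OF r_lim b])
  then obtain N where N: "\<And>k. N \<le> k \<Longrightarrow> r k < b" by (auto simp: eventually_sequentially)
  define p where "p k = L / a * \<psi> (r (k + N))" for k
  have La: "0 \<le> L / a" using L_nonneg a_pos by simp
  have dec: "\<psi> (r (Suc k)) \<le> \<psi> (r k)" if "N \<le> k" for k
  proof -
    have "\<psi> (r (Suc k)) \<le> \<psi> (r k) + deriv \<psi> (r k) * (r (Suc k) - r k)"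
      using N[OF that] N[of "Suc k"] that by (intro KL_function_tangent[OF \<psi>] r_pos) auto
    moreover have "deriv \<psi> (r k) * (r (Suc k) - r k) \<le> 0"
      using KL_function_deriv_pos[OF \<psi> r_pos N[OF that]] r_Suc_le[of k] by (simp add: mult_nonneg_nonpos)
    ultimately show ?thesis by simp
  qed
  have "p (Suc k) \<le> p k" for k
    unfolding p_def using dec[of "k + N"] by (intro mult_left_mono La) simp
  then have "decseq p" unfolding decseq_Suc_iff by blast
  moreover have "0 \<le> p k" for k
  proof -
    have "0 \<le> \<psi> (r (k + N))"
      using \<psi> r_pos[of "k + N"] N[of "k + N"] by (simp add: KL_function_def less_imp_le)
    then show ?thesis unfolding p_def by (rule mult_nonneg_nonneg[OF La])
  qed
  ultimately obtain l where l: "p \<longlonglongrightarrow> l" "\<And>i. l \<le> p i"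
    using decseq_convergent[of p 0] by blast
  have "\<forall>\<^sub>F k in sequentially. p k < l + e / 2" by (rule order_tendstoD(2)[OF l(1)]) (use e in simp)
  moreover have "\<forall>\<^sub>F k in sequentially. dist ((x \<circ> s) k) xs < e / 2" by (rule tendstoD[OF s(2)]) (use e in simp)
  ultimately have "\<forall>\<^sub>F k in sequentially. p k < l + e / 2 \<and> dist ((x \<circ> s) k) xs < e / 2"
    by (rule eventually_conj)
  then obtain M where M: "\<And>k. M \<le> k \<Longrightarrow> p k < l + e / 2 \<and> dist ((x \<circ> s) k) xs < e / 2"
    by (auto simp: eventually_sequentially)
  define m where "m = s (M + N)"
  have m: "M + N \<le> m" using seq_suble[OF s(1)] by (simp add: m_def)
  have dm: "dist (x m) xs < e / 2" using M[of "M + N"] by (simp add: m_def)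
  have near: "dist (x n) xs < e" if "m \<le> n" for n
    using that
  proof (induction n rule: less_induct)
    case (less n)
    have "r j < b \<and> 1 \<le> deriv \<psi> (r j) * (L * step j)" if "m \<le> j" "j < n" for j
    proof -
      have "dist (x j) xs < e" using less that by auto
      then have "x j \<in> U" using e0 by (auto simp: e_def dist_commute)
      moreover have "r j < b" using N that m by auto
      ultimately show ?thesis using kl by auto
    qed
    then have "norm (x n - x m) \<le> L / a * (\<psi> (r m) - \<psi> (r n))" by (intro KL_tail[OF \<psi> less.prems])
    also have "\<dots> = p (m - N) - p (n - N)" using m less.prems by (simp add: p_def right_diff_distrib)
    also have "\<dots> < e / 2"
    proof -
      have "M \<le> m - N" using m by simp
      then have "p (m - N) < l + e / 2" using M by blast
      then show ?thesis using l(2)[of "n - N"] by linarith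
    qed
    finally show ?case using dm dist_triangle[of "x n" xs "x m"] by (simp add: dist_norm)
  qed
  show "\<exists>no. \<forall>n\<ge>no. norm (x n - xs) < \<epsilon>"
    using near by (auto simp: dist_norm e_def intro!: exI[of _ m])
qed

context
  fixes c \<alpha> b :: real and xs
  assumes c: "0 < c" and \<alpha>: "0 \<le> \<alpha>" "\<alpha> < 1"
    and \<psi>: "KL_function (\<lambda>s. c * s powr (1 - \<alpha>)) b"
    and xlim: "x \<longlonglongrightarrow> xs"
    and kl: "\<forall>\<^sub>F k in sequentially. 1 \<le> deriv (\<lambda>s. c * s powr (1 - \<alpha>)) (r k) * (L * step k)"
begin

lemma power_KL: "\<forall>\<^sub>F k in sequentially. r k powr \<alpha> \<le> c * (1 - \<alpha>) * L * step k"
  using kl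
proof eventually_elim
  case (elim k)
  have "((\<lambda>s. c * s powr (1 - \<alpha>)) has_real_derivative c * ((1 - \<alpha>) * r k powr (1 - \<alpha> - 1))) (at (r k))"
    by (rule DERIV_cmult[OF has_real_derivative_powr[OF r_pos]])
  then have "deriv (\<lambda>s. c * s powr (1 - \<alpha>)) (r k) = c * (1 - \<alpha>) * r k powr (- \<alpha>)"
    by (simp add: DERIV_imp_deriv)
  then have "1 \<le> c * (1 - \<alpha>) * r k powr (- \<alpha>) * (L * step k)" using elim by simp
  then have "r k powr \<alpha> * 1 \<le> r k powr \<alpha> * (c * (1 - \<alpha>) * r k powr (- \<alpha>) * (L * step k))"
    by (rule mult_left_mono) simp
  also have "\<dots> = (r k powr \<alpha> * r k powr (- \<alpha>)) * (c * (1 - \<alpha>) * (L * step k))"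
    by (simp only: ac_simps)
  also have "r k powr \<alpha> * r k powr (- \<alpha>) = 1" using r_pos[of k] by (simp flip: powr_add)
  finally show ?case by (simp add: ac_simps)
qed

lemma step_lim: "step \<longlonglongrightarrow> 0"
proof -
  have "(\<lambda>k. x (Suc k) - x k) \<longlonglongrightarrow> xs - xs" by (intro tendsto_diff LIMSEQ_Suc xlim)
  then show ?thesis using tendsto_norm_zero by fastforce
qed

text \<open>
  For \<open>\<alpha> = 0\<close> the KL inequality bounds the steps away from \<open>0\<close>, against convergence. A sequence whose
  excess stays positive is thus impossible, which is finite termination.
\<close>

lemma power_KL_0: "\<alpha> \<noteq> 0"
proof
  assume 0: "\<alpha> = 0"
  have "(\<lambda>k. c * (1 - \<alpha>) * L * step k) \<longlonglongrightarrow> 0" using tendsto_mult_left[OF step_lim, of "c * (1 - \<alpha>) * L"] by simp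
  then have "\<forall>\<^sub>F k in sequentially. c * (1 - \<alpha>) * L * step k < 1" by (rule order_tendstoD(2)) simp
  then have "\<forall>\<^sub>F k in sequentially. False"
    using power_KL
  proof eventually_elim
    case (elim k)
    have "r k powr \<alpha> = 1" using r_pos[of k] 0 by simp
    then show False using elim by linarith
  qed
  then show False by simp
qed

lemma power_KL_tail:
  obtains C N where "0 < C" "\<And>k. N \<le> k \<Longrightarrow> norm (x k - xs) \<le> C * r k powr (1 - \<alpha>)"
proof -
  have b: "0 < b" using \<psi> by (simp add: KL_function_def)
  have "\<forall>\<^sub>F k in sequentially. r k < b \<and> 1 \<le> deriv (\<lambda>s. c * s powr (1 - \<alpha>)) (r k) * (L * step k)"
    by (intro eventually_conj order_tendstoD(2)[OF r_lim b] kl)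
  then obtain N where N: "\<And>k. N \<le> k \<Longrightarrow> r k < b \<and> 1 \<le> deriv (\<lambda>s. c * s powr (1 - \<alpha>)) (r k) * (L * step k)"
    by (auto simp: eventually_sequentially)
  \<comment> \<open>the \<open>+ 1\<close> makes the constant positive also for \<open>L = 0\<close>\<close>
  define C where "C = L / a * c + 1"
  have La: "0 \<le> L / a" using L_nonneg a_pos by simp
  have C: "0 < C" using mult_nonneg_nonneg[OF La less_imp_le[OF c]] by (simp only: C_def)
  have "norm (x k - xs) \<le> C * r k powr (1 - \<alpha>)" if k: "N \<le> k" for k
  proof -
    have "norm (x n - x k) \<le> C * r k powr (1 - \<alpha>)" if n: "k \<le> n" for n
    proof -
      have "norm (x n - x k) \<le> L / a * (c * r k powr (1 - \<alpha>) - c * r n powr (1 - \<alpha>))"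
        by (rule KL_tail[OF \<psi> n]) (use N k in auto)
      also have "\<dots> \<le> L / a * (c * r k powr (1 - \<alpha>))" using c by (intro mult_left_mono La) auto
      also have "\<dots> \<le> C * r k powr (1 - \<alpha>)" by (simp add: C_def algebra_simps)
      finally show ?thesis .
    qed
    moreover have "(\<lambda>n. norm (x n - x k)) \<longlonglongrightarrow> norm (xs - x k)" by (intro tendsto_intros xlim)
    ultimately have "norm (xs - x k) \<le> C * r k powr (1 - \<alpha>)"
      by (intro LIMSEQ_le_const2[where X = "\<lambda>n. norm (x n - x k)"]) auto
    then show ?thesis by (simp add: norm_minus_commute)
  qed
  then show ?thesis using that C by blast
qed

lemma power_KL_decay:
  obtains q N where "0 < q" "\<And>k. N \<le> k \<Longrightarrow> r (Suc k) \<le> r k - q * r k powr (2 * \<alpha>)"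
proof -
  \<comment> \<open>positive also for \<open>L = 0\<close>\<close>
  define B where "B = c * (1 - \<alpha>) * L + 1"
  have B: "0 < B" using c \<alpha> L_nonneg by (simp add: B_def add_nonneg_pos)
  obtain N where N: "\<And>k. N \<le> k \<Longrightarrow> r k powr \<alpha> \<le> c * (1 - \<alpha>) * L * step k"
    using power_KL by (auto simp: eventually_sequentially)
  show ?thesis
  proof (rule that[of "a / B^2"])
    show "0 < a / B^2" using a_pos B by simp
    fix k assume "N \<le> k"
    have "c * (1 - \<alpha>) * L * step k \<le> B * step k" by (rule mult_right_mono) (auto simp: B_def)
    then have "r k powr \<alpha> \<le> B * step k" using N[OF \<open>N \<le> k\<close>] by (rule order_trans[rotated])
    then have "(r k powr \<alpha>)^2 \<le> (B * step k)^2" by (rule power_mono) simp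
    moreover have "(r k powr \<alpha>)^2 = r k powr (2 * \<alpha>)"
      by (simp add: power2_eq_square flip: powr_add)
    ultimately have "a / B^2 * r k powr (2 * \<alpha>) \<le> a / B^2 * (B * step k)^2"
      using a_pos by (intro mult_left_mono) auto
    also have "\<dots> = a * (step k)^2" using B by (simp add: power_mult_distrib)
    also have "\<dots> \<le> r k - r (Suc k)" by (rule descent)
    finally show "r (Suc k) \<le> r k - a / B^2 * r k powr (2 * \<alpha>)" by simp
  qed
qed

text \<open>
  For \<open>2 * \<alpha> \<le> 1\<close> and \<open>r k < 1\<close> the decrease \<open>q * r k powr (2 * \<alpha>)\<close> is at least \<open>q * r k\<close>, so \<open>r\<close> decays
  geometrically, and the distance to the limit is at most a multiple of \<open>sqrt (r k)\<close>.
\<close>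

lemma linear_rate:
  assumes "\<alpha> \<le> 1/2"
  obtains \<omega> \<tau> N where "0 < \<omega>" "0 < \<tau>" "\<tau> < 1" "\<And>k. N \<le> k \<Longrightarrow> norm (x k - xs) \<le> \<omega> * \<tau> ^ k"
proof -
  obtain C N1 where C: "0 < C" "\<And>k. N1 \<le> k \<Longrightarrow> norm (x k - xs) \<le> C * r k powr (1 - \<alpha>)"
    using power_KL_tail by blast
  obtain q0 N2 where q0: "0 < q0" "\<And>k. N2 \<le> k \<Longrightarrow> r (Suc k) \<le> r k - q0 * r k powr (2 * \<alpha>)"
    using power_KL_decay by blast
  have "\<forall>\<^sub>F k in sequentially. r k < 1" by (rule order_tendstoD(2)[OF r_lim]) simp
  then obtain N3 where N3: "\<And>k. N3 \<le> k \<Longrightarrow> r k < 1" by (auto simp: eventually_sequentially)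
  \<comment> \<open>capped so that the contraction factor \<open>1 - q\<close> is positive\<close>
  define q where "q = min q0 (1/2)"
  define N where "N = max N1 (max N2 N3)"
  have q: "0 < q" "q < 1" using q0 by (auto simp: q_def)
  have small: "r k \<le> r k powr s" if "N \<le> k" "0 \<le> s" "s \<le> 1" for k s
  proof -
    have "r k powr 1 \<le> r k powr s"
      using N3[of k] that r_pos[of k] by (intro powr_mono') (auto simp: N_def)
    then show ?thesis using r_pos[of k] by simp
  qed
  have dec: "r (Suc k) \<le> (1 - q) * r k" if "N \<le> k" for k
  proof -
    have "q * r k \<le> q0 * r k powr (2 * \<alpha>)"
      using small[OF that, of "2 * \<alpha>"] \<alpha> assms q r_pos[of k] q0(1)
      by (intro mult_mono) (auto simp: q_def)
    then show ?thesis using q0(2)[of k] that by (simp add: N_def algebra_simps)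
  qed
  have geo: "r (N + n) \<le> (1 - q) ^ n * r N" for n
  proof (induction n)
    case (Suc n)
    have "r (Suc (N + n)) \<le> (1 - q) * r (N + n)" by (rule dec) simp
    also have "\<dots> \<le> (1 - q) * ((1 - q) ^ n * r N)" using q Suc by (intro mult_left_mono) auto
    finally show ?case by simp
  qed simp
  define \<tau> where "\<tau> = sqrt (1 - q)"
  have \<tau>: "0 < \<tau>" "\<tau> < 1" using q by (auto simp: \<tau>_def)
  have "norm (x k - xs) \<le> C * sqrt (r N) / \<tau> ^ N * \<tau> ^ k" if k: "N \<le> k" for k
  proof -
    have "norm (x k - xs) \<le> C * r k powr (1 - \<alpha>)" using C(2) k by (simp add: N_def)
    also have "r k powr (1 - \<alpha>) \<le> r k powr (1/2)"
      using N3[of k] r_pos[of k] k assms by (intro powr_mono') (auto simp: N_def)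
    also have "r k powr (1/2) = sqrt (r k)" using r_pos[of k] by (simp add: powr_half_sqrt)
    also have "\<dots> \<le> sqrt ((1 - q) ^ (k - N) * r N)"
      using geo[of "k - N"] k by simp
    also have "\<dots> = \<tau> ^ (k - N) * sqrt (r N)" by (simp add: \<tau>_def real_sqrt_mult real_sqrt_power)
    also have "\<tau> ^ (k - N) = \<tau> ^ k / \<tau> ^ N" using k \<tau> by (simp add: power_diff)
    finally show ?thesis using C(1) by (simp add: ac_simps)
  qed
  moreover have "0 < C * sqrt (r N) / \<tau> ^ N" using C r_pos[of N] \<tau> by simp
  ultimately show ?thesis using that \<tau> by blast
qed

text \<open>
  With \<open>p = 2 * \<alpha> - 1\<close>, the mean value theorem for \<open>s powr (- p)\<close> turns the recursion into an increase of
  \<open>r k powr (- p)\<close> by at least \<open>p * q\<close> in each step, hence into linear growth.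
\<close>

lemma sublinear_rate:
  assumes h\<alpha>: "1/2 < \<alpha>"
  obtains \<omega> N where "0 < \<omega>"
    "\<And>k. N \<le> k \<Longrightarrow> norm (x k - xs) \<le> \<omega> * real k powr (- ((1 - \<alpha>) / (2 * \<alpha> - 1)))"
proof -
  obtain C N1 where C: "0 < C" "\<And>k. N1 \<le> k \<Longrightarrow> norm (x k - xs) \<le> C * r k powr (1 - \<alpha>)"
    using power_KL_tail by blast
  obtain q N2 where q: "0 < q" "\<And>k. N2 \<le> k \<Longrightarrow> r (Suc k) \<le> r k - q * r k powr (2 * \<alpha>)"
    using power_KL_decay by blast
  define p where "p = 2 * \<alpha> - 1"
  have p: "0 < p" using h\<alpha> by (simp add: p_def)
  have inc: "p * q \<le> r (Suc k) powr (- p) - r k powr (- p)" if k: "N2 \<le> k" for k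
  proof (cases "r (Suc k) = r k")
    case True
    then have False using q(2)[OF k] q(1) r_pos[of k] by (simp add: mult_le_0_iff)
    then show ?thesis ..
  next
    case False
    then have lt: "r (Suc k) < r k" using r_Suc_le[of k] by simp
    have "\<exists>s. r (Suc k) < s \<and> s < r k \<and>
        r k powr (- p) - r (Suc k) powr (- p) = (r k - r (Suc k)) * (- p * s powr (- p - 1))"
    proof (rule MVT2[OF lt])
      fix s assume "r (Suc k) \<le> s"
      then show "((\<lambda>s. s powr (- p)) has_real_derivative - p * s powr (- p - 1)) (at s)"
        using has_real_derivative_powr[of s "- p"] r_pos[of "Suc k"] by simp
    qed
    then obtain s where s: "r (Suc k) < s" "s < r k"
      "r k powr (- p) - r (Suc k) powr (- p) = (r k - r (Suc k)) * (- p * s powr (- p - 1))" by blast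
    have "r k powr (- p - 1) \<le> s powr (- p - 1)"
      using s r_pos[of "Suc k"] p by (intro powr_mono2') auto
    moreover have "q * r k powr (2 * \<alpha>) \<le> r k - r (Suc k)" using q(2)[OF k] by simp
    ultimately have "(q * r k powr (2 * \<alpha>)) * r k powr (- p - 1) \<le> (r k - r (Suc k)) * s powr (- p - 1)"
      using lt by (intro mult_mono) auto
    moreover have "r k powr (2 * \<alpha>) * r k powr (- p - 1) = 1"
      using r_pos[of k] by (simp add: p_def flip: powr_add)
    ultimately have "q \<le> (r k - r (Suc k)) * s powr (- p - 1)" by (simp add: mult.assoc)
    then have "p * q \<le> p * ((r k - r (Suc k)) * s powr (- p - 1))" using p by simp
    then show ?thesis using s(3) by (simp add: algebra_simps)
  qed
  have lin: "real n * (p * q) \<le> r (N2 + n) powr (- p)" for n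
  proof (induction n)
    case (Suc n)
    then show ?case using inc[of "N2 + n"] by (simp add: algebra_simps)
  qed simp
  define e where "e = (1 - \<alpha>) / p"
  have e: "0 \<le> e" using \<alpha> p by (simp add: e_def)
  \<comment> \<open>from \<open>2 * N2\<close> on, \<open>k - N2 \<ge> k / 2\<close>; the \<open>+ 1\<close> keeps \<open>k\<close> positive\<close>
  define N where "N = max N1 (2 * N2 + 1)"
  have "norm (x k - xs) \<le> C * (p * q / 2) powr (- e) * real k powr (- e)" if k: "N \<le> k" for k
  proof -
    have "norm (x k - xs) \<le> C * r k powr (1 - \<alpha>)" using C(2) k by (simp add: N_def)
    also have "r k powr (1 - \<alpha>) = (r k powr (- p)) powr (- e)"
      using p by (simp add: powr_powr e_def)
    also have "\<dots> \<le> (p * q / 2 * real k) powr (- e)"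
    proof (rule powr_mono2')
      have "real k / 2 \<le> real (k - N2)" using k by (simp add: N_def)
      then have "real k / 2 * (p * q) \<le> real (k - N2) * (p * q)" using p q(1) by (intro mult_right_mono) auto
      also have "\<dots> \<le> r k powr (- p)" using lin[of "k - N2"] k by (simp add: N_def)
      finally show "p * q / 2 * real k \<le> r k powr (- p)" by (simp add: mult.commute)
    qed (use p q e k in \<open>auto simp: N_def\<close>)
    also have "\<dots> = (p * q / 2) powr (- e) * real k powr (- e)" by (rule powr_mult)
    finally show ?thesis using C(1) by (simp add: ac_simps)
  qed
  moreover have "0 < C * (p * q / 2) powr (- e)" using C p q by simp
  ultimately show ?thesis using that unfolding e_def p_def by blast
qed

end

end

text \<open>
  Where the function is differentiable, its gradient within the subspace is a limiting subgradient
  (take constant sequences), so the distance of \<open>0\<close> to the subdifferential is at most its norm.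
\<close>

lemma KL_at_gradient_bound:
  fixes F :: "'a::euclidean_space \<Rightarrow> real"
  assumes S: "subspace S" "X \<subseteq> S" and x0: "x0 \<in> X"
    and KL: "KL_at S (\<lambda>x. if x \<in> X then ereal (F x) else \<infinity>) x0 \<psi> b"
  obtains U where "open U" "x0 \<in> U"
    "\<And>x F' C. x \<in> U \<Longrightarrow> x \<in> X \<Longrightarrow> (F has_derivative F') (at x within S) \<Longrightarrow>
       (\<And>h. h \<in> S \<Longrightarrow> \<bar>F' h\<bar> \<le> C * norm h) \<Longrightarrow> 0 \<le> C \<Longrightarrow> F x0 < F x \<Longrightarrow> F x - F x0 < b \<Longrightarrow>
       1 \<le> deriv \<psi> (F x - F x0) * C"
proof -
  define \<eta> where "\<eta> = (\<lambda>x. if x \<in> X then ereal (F x) else \<infinity>)"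
  have \<psi>: "KL_function \<psi> b" using KL by (simp add: KL_at_def)
  obtain U where U: "open U" "x0 \<in> U"
    and kl: "\<And>x. x \<in> U \<inter> S \<Longrightarrow> \<eta> x0 < \<eta> x \<Longrightarrow> \<eta> x < \<eta> x0 + ereal b \<Longrightarrow>
      1 \<le> ereal (deriv \<psi> (real_of_ereal (\<eta> x - \<eta> x0))) * dist_zero (limiting_subdiff S \<eta> x)"
    using KL unfolding KL_at_def \<eta>_def by blast
  show ?thesis
  proof (rule that[OF U])
    fix x F' C
    assume x: "x \<in> U" "x \<in> X" and F': "(F has_derivative F') (at x within S)"
      and C: "\<And>h. h \<in> S \<Longrightarrow> \<bar>F' h\<bar> \<le> C * norm h" "0 \<le> C" and lt: "F x0 < F x" "F x - F x0 < b"
    have xS: "x \<in> S" using x S by blast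
    obtain v where v: "has_gradient S F v x" "\<And>h. h \<in> S \<Longrightarrow> v \<bullet> h = F' h"
      using has_gradient_if_has_derivative[OF S(1) xS F'] by blast
    have vS: "v \<in> S" using v(1) by (simp add: has_gradient_def)
    have "v \<in> regular_subdiff S \<eta> x"
      unfolding regular_subdiff_def
    proof (intro CollectI conjI allI impI vS xS)
      show "\<bar>\<eta> x\<bar> \<noteq> \<infinity>" using x by (simp add: \<eta>_def)
      fix e :: real assume "0 < e"
      have "\<forall>\<^sub>F y in at x within S. norm (F y - F x - v \<bullet> (y - x)) \<le> e * norm (y - x)"
        using v(1) \<open>0 < e\<close> unfolding has_gradient_def has_derivative_within_alt2 by blast
      then show "\<forall>\<^sub>F y in at x within S. \<eta> x + ereal (v \<bullet> (y - x) - e * norm (y - x)) \<le> \<eta> y"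
        by eventually_elim (use x in \<open>auto simp: \<eta>_def\<close>)
    qed
    then have "v \<in> limiting_subdiff S \<eta> x"
      using x unfolding limiting_subdiff_def
      by (intro CollectI conjI exI[where x = "\<lambda>n. x"] exI[where x = "\<lambda>n. v"])
         (auto simp: \<eta>_def)
    then have "dist_zero (limiting_subdiff S \<eta> x) \<le> ereal (norm v)"
      unfolding dist_zero_def by (rule INF_lower)
    also have "norm v \<le> C"
    proof (cases "v = 0")
      case False
      have "norm v * norm v \<le> C * norm v"
        using C(1)[OF vS] v(2)[OF vS] by (simp add: dot_square_norm power2_eq_square)
      then show ?thesis using False by simp
    qed (use C in simp)
    finally have d: "dist_zero (limiting_subdiff S \<eta> x) \<le> ereal C" by simp
    have pos: "0 < deriv \<psi> (F x - F x0)" by (rule KL_function_deriv_pos[OF \<psi>]) (use lt in auto)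
    have "1 \<le> ereal (deriv \<psi> (real_of_ereal (\<eta> x - \<eta> x0))) * dist_zero (limiting_subdiff S \<eta> x)"
      by (rule kl) (use x xS x0 lt in \<open>auto simp: \<eta>_def\<close>)
    also have "real_of_ereal (\<eta> x - \<eta> x0) = F x - F x0" using x x0 by (simp add: \<eta>_def)
    also have "ereal (deriv \<psi> (F x - F x0)) * dist_zero (limiting_subdiff S \<eta> x) \<le> ereal (deriv \<psi> (F x - F x0)) * ereal C"
      using pos by (intro ereal_mult_left_mono d) auto
    finally show "1 \<le> deriv \<psi> (F x - F x0) * C" by simp
  qed
qed

section \<open>Majorization-minimization under the Kurdyka-Lojasiewicz property\<close>

text \<open>
  The finitely many exceptional indices are absorbed into the constant.
\<close>

lemma eventually_rate_imp_rate:
  assumes "0 < \<omega>" "\<And>k::nat. K \<le> k \<Longrightarrow> 0 < f k" "\<And>k. N \<le> k \<Longrightarrow> e k \<le> \<omega> * f k"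
  obtains \<omega>' :: real where "0 < \<omega>'" "\<And>k. K \<le> k \<Longrightarrow> e k \<le> \<omega>' * f k"
proof -
  define \<omega>' where "\<omega>' = \<omega> + (\<Sum>k\<in>{K..<N}. \<bar>e k\<bar> / f k)"
  have nn: "0 \<le> \<bar>e k\<bar> / f k" if "K \<le> k" for k using assms(2)[OF that] by simp
  have "0 \<le> (\<Sum>k\<in>{K..<N}. \<bar>e k\<bar> / f k)" by (rule sum_nonneg) (simp add: nn)
  then have ge: "\<omega> \<le> \<omega>'" unfolding \<omega>'_def by simp
  have "e k \<le> \<omega>' * f k" if k: "K \<le> k" for k
  proof (cases "N \<le> k")
    case True
    have "\<omega> * f k \<le> \<omega>' * f k" by (rule mult_right_mono[OF ge less_imp_le[OF assms(2)[OF k]]])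
    then show ?thesis using assms(3)[OF True] by linarith
  next
    case False
    have "\<bar>e k\<bar> / f k \<le> (\<Sum>k\<in>{K..<N}. \<bar>e k\<bar> / f k)"
      by (rule member_le_sum) (use nn k False in auto)
    then have "\<bar>e k\<bar> / f k \<le> \<omega>'" using assms(1) by (simp add: \<omega>'_def)
    then show ?thesis using assms(2)[OF k] by (simp add: pos_divide_le_eq)
  qed
  then show ?thesis using that ge assms(1) by (metis less_le_trans)
qed

locale majorization_minimization =
  fixes S X :: "'a::euclidean_space set" and F :: "'a \<Rightarrow> real" and Sur :: "'a \<Rightarrow> 'a \<Rightarrow> real"
    and \<theta> :: "nat \<Rightarrow> 'a"
  assumes S: "subspace S" "X \<subseteq> S" and X_open: "openin (top_of_set S) X" and X_convex: "convex X"
    and F_diff: "\<And>x. x \<in> X \<Longrightarrow> \<exists>F'. (F has_derivative F') (at x within S)"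
    and major: "\<And>x y. x \<in> X \<Longrightarrow> y \<in> X \<Longrightarrow> F y \<le> F x + Sur x y - Sur x x"
    and start: "\<theta> 0 \<in> X" and iter: "\<theta> (Suc k) \<in> X"
    and minimal: "\<And>y. y \<in> X \<Longrightarrow> Sur (\<theta> k) (\<theta> (Suc k)) \<le> Sur (\<theta> k) y"
    and sublevel: "\<And>c. compact {x \<in> X. F x \<le> c}"
    and strong: "\<And>K. compact K \<Longrightarrow> convex K \<Longrightarrow> K \<subseteq> X \<Longrightarrow>
      \<exists>a>0. \<forall>x\<in>K. \<forall>y\<in>K. \<forall>z\<in>K. a * (norm (y - z))^2 \<le> midgap (Sur x) y z"
    and smooth: "\<And>K. compact K \<Longrightarrow> convex K \<Longrightarrow> K \<subseteq> X \<Longrightarrow>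
      \<exists>L\<ge>0. \<forall>x\<in>K. \<exists>D. lip_deriv S K L (Sur x) D"
begin

text \<open>
  The level \<open>F (\<theta> 0) + 1\<close> instead of \<open>F (\<theta> 0)\<close> makes the set a neighbourhood, relative to \<open>S\<close>, of every
  point with value at most \<open>F (\<theta> 0)\<close>; this is used for the stationarity of the limit.
\<close>

definition level_hull :: "'a set" where "level_hull = convex hull {x \<in> X. F x \<le> F (\<theta> 0) + 1}"

lemma level_hull: "compact level_hull" "convex level_hull" "level_hull \<subseteq> X"
  unfolding level_hull_def
  by (rule compact_convex_hull[OF sublevel], rule convex_convex_hull, rule hull_minimal)
     (auto simp: X_convex)

lemma mem_level_hull: "x \<in> X \<Longrightarrow> F x \<le> F (\<theta> 0) + 1 \<Longrightarrow> x \<in> level_hull"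
  unfolding level_hull_def by (rule hull_inc) simp

lemma iterates: "\<theta> k \<in> X"
  by (cases k) (auto simp: start iter)

lemma F_Suc_le: "F (\<theta> (Suc k)) \<le> F (\<theta> k)"
  using major[OF iterates[of k] iterates[of "Suc k"]] minimal[of "\<theta> k" k, OF iterates] by simp

lemma F_antimono: "m \<le> n \<Longrightarrow> F (\<theta> n) \<le> F (\<theta> m)"
  by (rule lift_Suc_antimono_le[of "\<lambda>k. F (\<theta> k)", OF F_Suc_le])

lemma iterates_level_hull: "\<theta> k \<in> level_hull"
  using F_antimono[of 0 k] by (intro mem_level_hull iterates) simp

lemma F_cont: "continuous_on X F"
  unfolding continuous_on_eq_continuous_within
proof
  fix x assume x: "x \<in> X"
  then obtain F' where "(F has_derivative F') (at x within S)" using F_diff by blast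
  then have "(F has_derivative F') (at x within X)" by (rule has_derivative_subset) (rule S(2))
  then show "continuous (at x within X) F" by (rule has_derivative_continuous)
qed

lemma X_ball:
  assumes "x \<in> X"
  obtains e where "0 < e" "\<And>y. y \<in> S \<Longrightarrow> dist x y < e \<Longrightarrow> y \<in> X"
proof -
  obtain e where "0 < e" "\<forall>y\<in>S. dist y x < e \<longrightarrow> y \<in> X"
    using X_open assms unfolding openin_euclidean_subtopology_iff by blast
  then show ?thesis using that by (metis dist_commute)
qed

text \<open>
  The minimizer does not lose against the midpoint of the two iterates, where the surrogate is
  smaller than the average by the midpoint gap.
\<close>

lemma sufficient_decrease:
  obtains a where "0 < a" "\<And>k. a * (norm (\<theta> (Suc k) - \<theta> k))^2 \<le> F (\<theta> k) - F (\<theta> (Suc k))"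
proof -
  obtain a where a: "0 < a"
    "\<And>x y z. x \<in> level_hull \<Longrightarrow> y \<in> level_hull \<Longrightarrow> z \<in> level_hull \<Longrightarrow> a * (norm (y - z))^2 \<le> midgap (Sur x) y z"
    using strong[OF level_hull] by blast
  show ?thesis
  proof (rule that[of "2 * a"])
    show "0 < 2 * a" using a by simp
    fix k
    let ?x = "\<theta> k" and ?y = "\<theta> (Suc k)"
    have mid: "midpoint ?y ?x \<in> X"
      using convexD[OF X_convex iterates iterates, of "1/2" "1/2" "Suc k" k]
      by (simp add: midpoint_def scaleR_add_right)
    have "a * (norm (?y - ?x))^2 \<le> midgap (Sur ?x) ?y ?x" by (intro a iterates_level_hull)
    also have "\<dots> \<le> (Sur ?x ?y + Sur ?x ?x) / 2 - Sur ?x ?y"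
      unfolding midgap_def using minimal[of _ k, OF mid] by linarith
    finally show "2 * a * (norm (?y - ?x))^2 \<le> F ?x - F ?y"
      using major[OF iterates[of k] iterates[of "Suc k"]] by (simp add: field_simps)
  qed
qed

lemma derivative_touching:
  assumes x: "x \<in> X" and F': "(F has_derivative F') (at x within S)"
    and D: "(Sur x has_derivative D) (at x within S)" and h: "h \<in> S"
  shows "F' h = D h"
proof -
  obtain e where e: "0 < e" "\<And>y. y \<in> S \<Longrightarrow> dist x y < e \<Longrightarrow> y \<in> X" using X_ball[OF x] by blast
  have "((\<lambda>y. Sur x y - F y) has_derivative (\<lambda>h. D h - F' h)) (at x within S)"
    by (intro derivative_intros F' D)
  from derivative_zero_at_local_min_within[OF S(1) _ h this e(1)]
  have "D h - F' h = 0" using major[OF x e(2)] x S(2) by (fastforce simp: algebra_simps)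
  then show ?thesis by simp
qed

text \<open>
  The derivative of the surrogate vanishes at the next iterate and agrees with that of \<open>F\<close> at the
  current one, so the Lipschitz bound controls the derivative of \<open>F\<close> by the step. The second estimate is the
  descent lemma for \<open>F\<close>, inherited from the surrogate by majorization.
\<close>

lemma relative_error:
  shows "\<exists>L\<ge>0.
    (\<forall>k. \<exists>F'. (F has_derivative F') (at (\<theta> k) within S) \<and>
       (\<forall>h\<in>S. \<bar>F' h\<bar> \<le> L * norm (\<theta> (Suc k) - \<theta> k) * norm h)) \<and>
    (\<forall>k. \<forall>y\<in>level_hull. F y \<le> F (\<theta> k) + L * norm (\<theta> (Suc k) - \<theta> k) * norm (y - \<theta> k) + L * (norm (y - \<theta> k))^2)"
proof -
  obtain L where L: "0 \<le> L" "\<And>x. x \<in> level_hull \<Longrightarrow> \<exists>D. lip_deriv S level_hull L (Sur x) D"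
    using smooth[OF level_hull] by blast
  have main: "\<exists>D. lip_deriv S level_hull L (Sur (\<theta> k)) D \<and>
      (\<forall>h\<in>S. \<bar>D (\<theta> k) h\<bar> \<le> L * norm (\<theta> (Suc k) - \<theta> k) * norm h)" for k
  proof -
    let ?x = "\<theta> k" and ?y = "\<theta> (Suc k)"
    obtain D where D: "lip_deriv S level_hull L (Sur ?x) D" using L(2)[OF iterates_level_hull] by blast
    have Dy: "(Sur ?x has_derivative D ?y) (at ?y within S)"
      using D iterates_level_hull unfolding lip_deriv_def by blast
    obtain e where e: "0 < e" "\<And>y. y \<in> S \<Longrightarrow> dist ?y y < e \<Longrightarrow> y \<in> X" using X_ball[OF iterates] by blast
    have "\<bar>D ?x h\<bar> \<le> L * norm (?y - ?x) * norm h" if h: "h \<in> S" for h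
    proof -
      have "D ?y h = 0"
        by (rule derivative_zero_at_local_min_within[OF S(1) _ h Dy e(1)])
           (use iterates S(2) in \<open>auto intro!: minimal e(2)\<close>)
      moreover have "\<bar>D ?y h - D ?x h\<bar> \<le> L * norm (?y - ?x) * norm h"
        using D iterates_level_hull h unfolding lip_deriv_def by blast
      ultimately show ?thesis by simp
    qed
    then show ?thesis using D by blast
  qed
  show ?thesis
  proof (intro exI[where x = L] conjI allI ballI)
    show "0 \<le> L" by (rule L(1))
  next
    fix k
    obtain D where D: "lip_deriv S level_hull L (Sur (\<theta> k)) D"
      "\<And>h. h \<in> S \<Longrightarrow> \<bar>D (\<theta> k) h\<bar> \<le> L * norm (\<theta> (Suc k) - \<theta> k) * norm h"
      using main[of k] by blast
    have Dx: "(Sur (\<theta> k) has_derivative D (\<theta> k)) (at (\<theta> k) within S)"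
      using D(1) iterates_level_hull unfolding lip_deriv_def by blast
    obtain F' where F': "(F has_derivative F') (at (\<theta> k) within S)" using F_diff iterates by blast
    show "\<exists>F'. (F has_derivative F') (at (\<theta> k) within S) \<and>
       (\<forall>h\<in>S. \<bar>F' h\<bar> \<le> L * norm (\<theta> (Suc k) - \<theta> k) * norm h)"
      using F' D(2) derivative_touching[OF iterates F' Dx] by (intro exI[of _ F']) simp
  next
    fix k y assume y: "y \<in> level_hull"
    obtain D where D: "lip_deriv S level_hull L (Sur (\<theta> k)) D"
      "\<And>h. h \<in> S \<Longrightarrow> \<bar>D (\<theta> k) h\<bar> \<le> L * norm (\<theta> (Suc k) - \<theta> k) * norm h"
      using main[of k] by blast
    define x where "x = \<theta> k"
    define u where "u = y - x"
    have x: "x \<in> level_hull" by (simp add: x_def iterates_level_hull)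
    have u: "u \<in> S" using x y level_hull(3) S by (auto simp: u_def intro: subspace_diff)
    have seg: "x + s *\<^sub>R u \<in> level_hull" if "s \<in> {0..1}" for s
      using convexD_alt[OF level_hull(2) x y, of s] that by (simp add: u_def algebra_simps)
    define \<phi> where "\<phi> s = Sur x (x + s *\<^sub>R u)" for s
    have d: "(\<phi> has_real_derivative D (x + s *\<^sub>R u) u) (at s within {0..1})" if "s \<in> {0..1}" for s
    proof -
      have "(Sur x has_derivative D (x + s *\<^sub>R u)) (at (x + s *\<^sub>R u) within S)"
        using D(1) seg[OF that] unfolding lip_deriv_def x_def by blast
      then show ?thesis unfolding \<phi>_def
        by (rule has_real_derivative_along_line) (use seg level_hull(3) S(2) in blast)
    qed
    have "\<exists>s\<in>{0<..<1}. \<phi> 1 - \<phi> 0 = D (x + s *\<^sub>R u) u * (1 - 0)"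
      by (rule mvt_simple) (use d in \<open>auto simp: has_field_derivative_def\<close>)
    then obtain s where s: "0 < s" "s < 1" "\<phi> 1 - \<phi> 0 = D (x + s *\<^sub>R u) u" by auto
    have "x + s *\<^sub>R u \<in> level_hull" using seg s by simp
    then have "\<bar>D (x + s *\<^sub>R u) u - D x u\<bar> \<le> L * norm (x + s *\<^sub>R u - x) * norm u"
      using D(1) x u unfolding lip_deriv_def by blast
    also have "\<dots> = s * (L * (norm u)^2)" using s by (simp add: power2_eq_square)
    also have "\<dots> \<le> 1 * (L * (norm u)^2)" using s L(1) by (intro mult_right_mono) auto
    finally have "\<phi> 1 - \<phi> 0 \<le> D x u + L * (norm u)^2" using s by simp
    also have "D x u \<le> L * norm (\<theta> (Suc k) - \<theta> k) * norm u" using D(2)[OF u] by (simp add: x_def)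
    finally have "Sur x y - Sur x x \<le> L * norm (\<theta> (Suc k) - \<theta> k) * norm u + L * (norm u)^2"
      by (simp add: \<phi>_def u_def)
    moreover have "F y \<le> F x + Sur x y - Sur x x" by (rule major) (use x y level_hull(3) in auto)
    ultimately show "F y \<le> F (\<theta> k) + L * norm (\<theta> (Suc k) - \<theta> k) * norm (y - \<theta> k) + L * (norm (y - \<theta> k))^2"
      by (simp add: x_def u_def)
  qed
qed

lemma cluster_point:
  obtains l s where "l \<in> X" "F l \<le> F (\<theta> 0)" "strict_mono s" "(\<theta> \<circ> s) \<longlonglongrightarrow> l"
    "(\<lambda>k. F (\<theta> k) - F l) \<longlonglongrightarrow> 0" "\<And>k. F l \<le> F (\<theta> k)"
proof -
  have mem: "\<forall>k. \<theta> k \<in> {x \<in> X. F x \<le> F (\<theta> 0)}" using iterates F_antimono[of 0] by auto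
  obtain l s where l: "l \<in> {x \<in> X. F x \<le> F (\<theta> 0)}" "strict_mono s" "(\<theta> \<circ> s) \<longlonglongrightarrow> l"
    using sublevel[of "F (\<theta> 0)", unfolded compact_def] mem by blast
  have Fs: "(\<lambda>k. F ((\<theta> \<circ> s) k)) \<longlonglongrightarrow> F l"
    by (rule continuous_on_tendsto_compose[OF F_cont l(3)]) (use l(1) iterates in auto)
  have ge: "F l \<le> F (\<theta> k)" for k
  proof (rule LIMSEQ_le_const2[OF Fs])
    show "\<exists>N. \<forall>n\<ge>N. F ((\<theta> \<circ> s) n) \<le> F (\<theta> k)"
      using seq_suble[OF l(2)] F_antimono by (metis comp_apply order_trans)
  qed
  have "decseq (\<lambda>k. F (\<theta> k))" by (simp add: decseq_Suc_iff F_Suc_le)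
  then obtain l' where l': "(\<lambda>k. F (\<theta> k)) \<longlonglongrightarrow> l'"
    using decseq_convergent[of "\<lambda>k. F (\<theta> k)" "F l"] ge by blast
  have "(\<lambda>k. F ((\<theta> \<circ> s) k)) \<longlonglongrightarrow> l'"
    using LIMSEQ_subseq_LIMSEQ[OF l' l(2)] by (simp add: comp_def)
  then have "l' = F l" using Fs LIMSEQ_unique by blast
  then have "(\<lambda>k. F (\<theta> k) - F l) \<longlonglongrightarrow> 0" using l' by (simp add: LIM_zero)
  then show ?thesis using that l ge by blast
qed

text \<open>
  Letting \<open>k \<rightarrow> \<infinity>\<close> in the descent lemma, where the linear term disappears, gives
  \<open>F y \<le> F l + L * (norm (y - l))\<^sup>2\<close> near \<open>l\<close>. So \<open>L * (norm (y - l))\<^sup>2 - F y\<close> is minimal at \<open>l\<close> and the derivative of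
  \<open>F\<close> vanishes there.
\<close>

lemma limit_stationary:
  assumes l: "l \<in> X" "F l \<le> F (\<theta> 0)" and lim: "\<theta> \<longlonglongrightarrow> l"
  shows "(F has_derivative (\<lambda>h. 0)) (at l within S)"
proof -
  obtain L where L:
    "\<And>k y. y \<in> level_hull \<Longrightarrow> F y \<le> F (\<theta> k) + L * norm (\<theta> (Suc k) - \<theta> k) * norm (y - \<theta> k) + L * (norm (y - \<theta> k))^2"
    using relative_error by blast
  have up: "F y \<le> F l + L * (norm (y - l))^2" if y: "y \<in> level_hull" for y
  proof -
    have Fl: "(\<lambda>k. F (\<theta> k)) \<longlonglongrightarrow> F l"
      by (rule continuous_on_tendsto_compose[OF F_cont lim l(1)]) (use iterates in auto)
    have "(\<lambda>k. F (\<theta> k) + L * norm (\<theta> (Suc k) - \<theta> k) * norm (y - \<theta> k) + L * (norm (y - \<theta> k))^2)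
        \<longlonglongrightarrow> F l + L * norm (l - l) * norm (y - l) + L * (norm (y - l))^2"
      by (intro tendsto_intros Fl lim LIMSEQ_Suc[OF lim])
    then have "F y \<le> F l + L * norm (l - l) * norm (y - l) + L * (norm (y - l))^2"
      by (rule LIMSEQ_le_const) (use L[OF y] in auto)
    then show ?thesis by simp
  qed
  have lS: "l \<in> S" using l S by blast
  obtain e1 where e1: "0 < e1" "\<And>y. y \<in> S \<Longrightarrow> dist l y < e1 \<Longrightarrow> y \<in> X" using X_ball[OF l(1)] by blast
  obtain e2 where e2: "0 < e2" "\<And>y. y \<in> X \<Longrightarrow> dist y l < e2 \<Longrightarrow> dist (F y) (F l) < 1"
    using F_cont l(1) unfolding continuous_on_iff by (metis zero_less_one)
  have nb: "y \<in> level_hull" if "y \<in> S" "dist l y < min e1 e2" for y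
  proof (rule mem_level_hull)
    show y: "y \<in> X" using e1 that by simp
    have "\<bar>F y - F l\<bar> < 1" using e2(2)[OF y] that by (simp add: dist_commute dist_real_def)
    then show "F y \<le> F (\<theta> 0) + 1" using l(2) by linarith
  qed
  obtain F' where F': "(F has_derivative F') (at l within S)" using F_diff l by blast
  have "F' h = 0" if h: "h \<in> S" for h
  proof -
    have "((\<lambda>y. L * ((y - l) \<bullet> (y - l)) - F y) has_derivative (\<lambda>h. L * ((l - l) \<bullet> h + h \<bullet> (l - l)) - F' h)) (at l within S)"
      by (auto intro!: derivative_eq_intros F')
    then have "((\<lambda>y. L * ((y - l) \<bullet> (y - l)) - F y) has_derivative (\<lambda>h. - F' h)) (at l within S)"
      by simp
    then have "- F' h = 0"
    proof (rule derivative_zero_at_local_min_within[OF S(1) lS h, where e = "min e1 e2"])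
      show "0 < min e1 e2" using e1 e2 by simp
      fix y assume "y \<in> S" "dist l y < min e1 e2"
      then show "L * ((l - l) \<bullet> (l - l)) - F l \<le> L * ((y - l) \<bullet> (y - l)) - F y"
        using up[OF nb[of y]] by (simp add: power2_norm_eq_inner)
    qed
    then show ?thesis by simp
  qed
  then show ?thesis
    by (intro has_derivative_within_cong_on_subspace[OF S(1) lS F']) auto
qed

theorem KL_convergence:
  assumes KL: "\<And>x0. x0 \<in> X \<Longrightarrow> \<exists>\<psi> b. KL_at S (\<lambda>x. if x \<in> X then ereal (F x) else \<infinity>) x0 \<psi> b"
  obtains l where "l \<in> X" "\<theta> \<longlonglongrightarrow> l" "(F has_derivative (\<lambda>h. 0)) (at l within S)"
    "\<And>c \<alpha> b. 0 < c \<Longrightarrow> 0 \<le> \<alpha> \<Longrightarrow> \<alpha> < 1 \<Longrightarrow>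
        KL_at S (\<lambda>x. if x \<in> X then ereal (F x) else \<infinity>) l (\<lambda>s. c * s powr (1 - \<alpha>)) b \<Longrightarrow>
          (\<alpha> = 0 \<longrightarrow> (\<exists>K. \<forall>k\<ge>K. \<theta> k = l)) \<and>
          (0 < \<alpha> \<and> \<alpha> \<le> 1/2 \<longrightarrow>
             (\<exists>\<omega>>0. \<exists>\<tau>. 0 \<le> \<tau> \<and> \<tau> < 1 \<and> (\<forall>k. norm (\<theta> k - l) \<le> \<omega> * \<tau> ^ k))) \<and>
          (1/2 < \<alpha> \<longrightarrow>
             (\<exists>\<omega>>0. \<forall>k\<ge>1. norm (\<theta> k - l) \<le> \<omega> * real k powr (- ((1 - \<alpha>) / (2 * \<alpha> - 1)))))"
proof -
  obtain a where a: "0 < a" "\<And>k. a * (norm (\<theta> (Suc k) - \<theta> k))^2 \<le> F (\<theta> k) - F (\<theta> (Suc k))"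
    using sufficient_decrease by blast
  obtain L where L: "0 \<le> L"
    "\<And>k. \<exists>F'. (F has_derivative F') (at (\<theta> k) within S) \<and>
       (\<forall>h\<in>S. \<bar>F' h\<bar> \<le> L * norm (\<theta> (Suc k) - \<theta> k) * norm h)"
    using relative_error by blast
  obtain l s where l: "l \<in> X" "F l \<le> F (\<theta> 0)" and s: "strict_mono s" "(\<theta> \<circ> s) \<longlonglongrightarrow> l"
    and rlim: "(\<lambda>k. F (\<theta> k) - F l) \<longlonglongrightarrow> 0" and ge: "\<And>k. F l \<le> F (\<theta> k)"
    using cluster_point by blast
  let ?\<eta> = "\<lambda>x. if x \<in> X then ereal (F x) else \<infinity>"
  \<comment> \<open>if the value of the limit is attained, sufficient decrease freezes the sequence\<close>
  have finite_or_descent: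
    "(\<exists>K. \<forall>k\<ge>K. \<theta> k = l) \<or> descent_sequence \<theta> (\<lambda>k. F (\<theta> k) - F l) a L"
  proof (cases "\<exists>K. F (\<theta> K) = F l")
    case True
    then obtain K where K: "F (\<theta> K) = F l" by blast
    have eq: "F (\<theta> k) = F l" if "K \<le> k" for k using F_antimono[OF that] ge[of k] K by simp
    have st: "\<theta> (Suc k) = \<theta> k" if "K \<le> k" for k
    proof -
      have "a * (norm (\<theta> (Suc k) - \<theta> k))^2 \<le> 0" using a(2)[of k] eq[of k] eq[of "Suc k"] that by simp
      then show ?thesis using a(1) by (simp add: mult_le_0_iff)
    qed
    have const: "\<theta> k = \<theta> K" if "K \<le> k" for k
      using that by (induction k rule: dec_induct) (auto simp: st)
    have "\<forall>\<^sub>F n in sequentially. (\<theta> \<circ> s) n = \<theta> K"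
      using eventually_ge_at_top[of K]
    proof eventually_elim
      case (elim n)
      then have "K \<le> s n" using seq_suble[OF s(1), of n] by linarith
      then show ?case unfolding comp_def by (rule const)
    qed
    then have "(\<theta> \<circ> s) \<longlonglongrightarrow> \<theta> K" by (rule tendsto_eventually)
    then have "l = \<theta> K" using s(2) LIMSEQ_unique by blast
    then show ?thesis using const by blast
  next
    case False
    then have "0 < F (\<theta> k) - F l" for k using ge[of k] by (metis diff_gt_0_iff_gt order_le_less)
    then have "descent_sequence \<theta> (\<lambda>k. F (\<theta> k) - F l) a L"
      using a L(1) rlim by unfold_locales auto
    then show ?thesis ..
  qed
  have kl: "\<exists>U. open U \<and> l \<in> U \<and> (\<forall>k. \<theta> k \<in> U \<longrightarrow> 0 < F (\<theta> k) - F l \<longrightarrow> F (\<theta> k) - F l < b \<longrightarrow>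
      1 \<le> deriv \<psi> (F (\<theta> k) - F l) * (L * norm (\<theta> (Suc k) - \<theta> k)))"
    if KL: "KL_at S ?\<eta> l \<psi> b" for \<psi> b
  proof -
    obtain U where U: "open U" "l \<in> U" and
    UK: "\<And>x F' C. x \<in> U \<Longrightarrow> x \<in> X \<Longrightarrow> (F has_derivative F') (at x within S) \<Longrightarrow>
       (\<And>h. h \<in> S \<Longrightarrow> \<bar>F' h\<bar> \<le> C * norm h) \<Longrightarrow> 0 \<le> C \<Longrightarrow> F l < F x \<Longrightarrow> F x - F l < b \<Longrightarrow>
       1 \<le> deriv \<psi> (F x - F l) * C"
      using KL_at_gradient_bound[OF S l(1) KL] by blast
    have "1 \<le> deriv \<psi> (F (\<theta> k) - F l) * (L * norm (\<theta> (Suc k) - \<theta> k))"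
      if k: "\<theta> k \<in> U" "0 < F (\<theta> k) - F l" "F (\<theta> k) - F l < b" for k
    proof -
      obtain F' where F': "(F has_derivative F') (at (\<theta> k) within S)"
        "\<And>h. h \<in> S \<Longrightarrow> \<bar>F' h\<bar> \<le> L * norm (\<theta> (Suc k) - \<theta> k) * norm h" using L(2)[of k] by blast
      show ?thesis by (rule UK[OF k(1) iterates F']) (use L(1) k in auto)
    qed
    then show ?thesis using U by blast
  qed
  have lim: "\<theta> \<longlonglongrightarrow> l"
    using finite_or_descent
  proof
    assume "\<exists>K. \<forall>k\<ge>K. \<theta> k = l"
    then show ?thesis by (intro tendsto_eventually) (simp add: eventually_sequentially)
  next
    assume "descent_sequence \<theta> (\<lambda>k. F (\<theta> k) - F l) a L"
    then interpret descent_sequence \<theta> "\<lambda>k. F (\<theta> k) - F l" a L .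
    obtain \<psi> b where \<psi>b: "KL_at S ?\<eta> l \<psi> b" using KL l(1) by blast
    have \<psi>: "KL_function \<psi> b" using \<psi>b by (simp add: KL_at_def)
    obtain U where U: "open U" "l \<in> U" "\<And>k. \<theta> k \<in> U \<Longrightarrow> 0 < F (\<theta> k) - F l \<Longrightarrow> F (\<theta> k) - F l < b \<Longrightarrow>
      1 \<le> deriv \<psi> (F (\<theta> k) - F l) * (L * norm (\<theta> (Suc k) - \<theta> k))" using kl[OF \<psi>b] by blast
    show ?thesis by (rule KL_converges[OF \<psi> U(1,2) U(3)[OF _ r_pos] s])
  qed
  show ?thesis
  proof (rule that[OF l(1) lim limit_stationary[OF l lim]])
    fix c \<alpha> b :: real
    assume c: "0 < c" and \<alpha>: "0 \<le> \<alpha>" "\<alpha> < 1" and K: "KL_at S ?\<eta> l (\<lambda>s. c * s powr (1 - \<alpha>)) b"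
    let ?fin = "\<exists>K. \<forall>k\<ge>K. \<theta> k = l"
    let ?rate = "- ((1 - \<alpha>) / (2 * \<alpha> - 1))"
    have tail: "(\<alpha> = 0 \<longrightarrow> ?fin) \<and>
      (\<alpha> \<le> 1/2 \<longrightarrow> (\<exists>\<omega> \<tau> N. 0 < \<omega> \<and> 0 < \<tau> \<and> \<tau> < 1 \<and> (\<forall>k\<ge>N. norm (\<theta> k - l) \<le> \<omega> * \<tau> ^ k))) \<and>
      (1/2 < \<alpha> \<longrightarrow> (\<exists>\<omega> N. 0 < \<omega> \<and> (\<forall>k\<ge>N. norm (\<theta> k - l) \<le> \<omega> * real k powr ?rate)))"
      using finite_or_descent
    proof
      assume f: ?fin
      then obtain N where N: "\<And>k. N \<le> k \<Longrightarrow> \<theta> k = l" by blast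
      have "\<forall>k\<ge>N. norm (\<theta> k - l) \<le> 1 * (1/2) ^ k" "\<forall>k\<ge>N. norm (\<theta> k - l) \<le> 1 * real k powr ?rate"
        using N by auto
      moreover have "0 < (1::real)" "0 < (1/2::real)" "1/2 < (1::real)" by auto
      ultimately show ?thesis using f by blast
    next
      assume "descent_sequence \<theta> (\<lambda>k. F (\<theta> k) - F l) a L"
      then interpret descent_sequence \<theta> "\<lambda>k. F (\<theta> k) - F l" a L .
      have \<psi>: "KL_function (\<lambda>s. c * s powr (1 - \<alpha>)) b" using K by (simp add: KL_at_def)
      then have b: "0 < b" by (simp add: KL_function_def)
      obtain U where U: "open U" "l \<in> U" "\<And>k. \<theta> k \<in> U \<Longrightarrow> 0 < F (\<theta> k) - F l \<Longrightarrow> F (\<theta> k) - F l < b \<Longrightarrow>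
        1 \<le> deriv (\<lambda>s. c * s powr (1 - \<alpha>)) (F (\<theta> k) - F l) * (L * norm (\<theta> (Suc k) - \<theta> k))"
        using kl[OF K] by blast
      have ev: "\<forall>\<^sub>F k in sequentially. 1 \<le> deriv (\<lambda>s. c * s powr (1 - \<alpha>)) (F (\<theta> k) - F l) * (L * norm (\<theta> (Suc k) - \<theta> k))"
        using topological_tendstoD[OF lim U(1,2)] order_tendstoD(2)[OF rlim b]
        by eventually_elim (rule U(3)[OF _ r_pos])
      \<comment> \<open>the hypotheses of the context in which the rates are proved\<close>
      note hyps = c \<alpha> \<psi> lim ev
      have "\<alpha> \<noteq> 0" by (rule power_KL_0[OF hyps])
      moreover have "\<exists>\<omega> \<tau> N. 0 < \<omega> \<and> 0 < \<tau> \<and> \<tau> < 1 \<and> (\<forall>k\<ge>N. norm (\<theta> k - l) \<le> \<omega> * \<tau> ^ k)" if "\<alpha> \<le> 1/2"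
        using linear_rate[OF hyps that] by metis
      moreover have "\<exists>\<omega> N. 0 < \<omega> \<and> (\<forall>k\<ge>N. norm (\<theta> k - l) \<le> \<omega> * real k powr ?rate)" if "1/2 < \<alpha>"
        using sublinear_rate[OF hyps that] by metis
      ultimately show ?thesis by blast
    qed
    have "\<exists>\<omega>>0. \<exists>\<tau>. 0 \<le> \<tau> \<and> \<tau> < 1 \<and> (\<forall>k. norm (\<theta> k - l) \<le> \<omega> * \<tau> ^ k)" if h: "\<alpha> \<le> 1/2"
    proof -
      obtain \<omega> \<tau> N where w: "0 < \<omega>" "0 < \<tau>" "\<tau> < 1" "\<And>k. N \<le> k \<Longrightarrow> norm (\<theta> k - l) \<le> \<omega> * \<tau> ^ k"
        using tail h by blast
      obtain \<omega>' where "0 < \<omega>'" "\<And>k. 0 \<le> k \<Longrightarrow> norm (\<theta> k - l) \<le> \<omega>' * \<tau> ^ k"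
        by (rule eventually_rate_imp_rate[OF w(1) _ w(4), of 0]) (use w(2) in auto)
      then show ?thesis using w less_imp_le by blast
    qed
    moreover have "\<exists>\<omega>>0. \<forall>k\<ge>1. norm (\<theta> k - l) \<le> \<omega> * real k powr ?rate" if h: "1/2 < \<alpha>"
    proof -
      obtain \<omega> N where w: "0 < \<omega>" "\<And>k. N \<le> k \<Longrightarrow> norm (\<theta> k - l) \<le> \<omega> * real k powr ?rate"
        using tail h by blast
      obtain \<omega>' where "0 < \<omega>'" "\<And>k. 1 \<le> k \<Longrightarrow> norm (\<theta> k - l) \<le> \<omega>' * real k powr ?rate"
        by (rule eventually_rate_imp_rate[OF w(1) _ w(2), of 1]) auto
      then show ?thesis by blast
    qed
    ultimately show "(\<alpha> = 0 \<longrightarrow> ?fin) \<and>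
      (0 < \<alpha> \<and> \<alpha> \<le> 1/2 \<longrightarrow> (\<exists>\<omega>>0. \<exists>\<tau>. 0 \<le> \<tau> \<and> \<tau> < 1 \<and> (\<forall>k. norm (\<theta> k - l) \<le> \<omega> * \<tau> ^ k))) \<and>
      (1/2 < \<alpha> \<longrightarrow> (\<exists>\<omega>>0. \<forall>k\<ge>1. norm (\<theta> k - l) \<le> \<omega> * real k powr ?rate))"
      using tail by blast
  qed
qed

end

section \<open>The log-sum-exp function\<close>

text \<open>
  Jensen's inequality for \<open>exp\<close>: with \<open>m\<close> the mean of \<open>b - a\<close> under the softmax weights of \<open>a\<close>, sum
  \<open>exp (b i - a i) \<ge> exp m * (1 + (b i - a i - m))\<close> with these weights.
\<close>

lemma neg_ln_sum_exp_tangent: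
  fixes a b :: "'i \<Rightarrow> real"
  assumes P: "finite P" "P \<noteq> {}"
  shows "- ln (\<Sum>i\<in>P. exp (b i)) \<le>
    - ln (\<Sum>i\<in>P. exp (a i)) + (\<Sum>i\<in>P. exp (a i) / (\<Sum>i\<in>P. exp (a i)) * (a i - b i))"
proof -
  define Z where "Z = (\<Sum>i\<in>P. exp (a i))"
  have Z: "0 < Z" unfolding Z_def by (rule sum_pos) (use P in auto)
  define m where "m = (\<Sum>i\<in>P. exp (a i) / Z * (b i - a i))"
  have Zm: "(\<Sum>i\<in>P. exp (a i) * (b i - a i)) = Z * m"
    using Z by (simp add: m_def sum_distrib_left)
  have "Z * exp m = (\<Sum>i\<in>P. exp m * (exp (a i) + exp (a i) * (b i - a i) - m * exp (a i)))"
    by (simp add: Zm sum.distrib sum_subtractf flip: sum_distrib_left Z_def)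
  also have "\<dots> \<le> (\<Sum>i\<in>P. exp (b i))"
  proof (rule sum_mono)
    fix i
    have "exp m * (exp (a i) + exp (a i) * (b i - a i) - m * exp (a i)) = exp m * exp (a i) * (1 + (b i - a i - m))"
      by (simp add: algebra_simps)
    also have "\<dots> \<le> exp m * exp (a i) * exp (b i - a i - m)"
      by (rule mult_left_mono[OF exp_ge_add_one_self]) simp
    also have "\<dots> = exp (b i)" by (simp flip: exp_add)
    finally show "exp m * (exp (a i) + exp (a i) * (b i - a i) - m * exp (a i)) \<le> exp (b i)" .
  qed
  finally have "ln (Z * exp m) \<le> ln (\<Sum>i\<in>P. exp (b i))" using Z by (intro ln_mono) auto
  then have "ln Z + m \<le> ln (\<Sum>i\<in>P. exp (b i))" using Z by (simp add: ln_mult)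
  moreover have "(\<Sum>i\<in>P. exp (a i) / Z * (a i - b i)) = - m"
    unfolding m_def sum_negf[symmetric] by (rule sum.cong) (auto simp: right_diff_distrib)
  ultimately show ?thesis by (simp only: Z_def[symmetric])
qed

lemma sum_exp_pos: "0 < (\<Sum>j\<in>UNIV. exp (x $ j))" for x :: "real ^ 'd::finite"
  by (rule sum_pos) auto

lemma softmax_nonneg: "0 \<le> softmax x j"
  by (simp add: softmax_def sum_nonneg)

lemma sum_softmax: "(\<Sum>j\<in>UNIV. softmax x j) = 1"
  unfolding softmax_def sum_divide_distrib[symmetric] using sum_exp_pos[of x] by simp

lemma softmax_eq_exp: "softmax x j = exp (x $ j - lse x)"
  using sum_exp_pos[of x] by (simp add: softmax_def lse_def exp_diff)

lemma lse_has_derivative: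
  "(lse has_derivative (\<lambda>h. \<Sum>j\<in>UNIV. softmax x j * h $ j)) (at x within S)"
proof -
  have "((\<lambda>x. \<Sum>j\<in>UNIV. exp (x $ j)) has_derivative (\<lambda>h. \<Sum>j\<in>UNIV. exp (x $ j) * h $ j)) (at x within S)"
    by (auto intro!: derivative_eq_intros bounded_linear_imp_has_derivative[OF bounded_linear_vec_nth]
        simp: mult.commute)
  then have "((\<lambda>x. ln (\<Sum>j\<in>UNIV. exp (x $ j))) has_derivative
      (\<lambda>h. inverse (\<Sum>j\<in>UNIV. exp (x $ j)) * (\<Sum>j\<in>UNIV. exp (x $ j) * h $ j))) (at x within S)"
    by (rule has_derivative_compose)
       (rule has_field_derivative_imp_has_derivative[OF DERIV_ln[OF sum_exp_pos]])
  moreover have "inverse (\<Sum>j\<in>UNIV. exp (x $ j)) * (\<Sum>j\<in>UNIV. exp (x $ j) * h $ j) =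
      (\<Sum>j\<in>UNIV. softmax x j * h $ j)" for h
    by (simp add: softmax_def sum_distrib_left field_simps)
  ultimately show ?thesis by (simp add: lse_def[abs_def])
qed

lemma abs_softmax_mean_le: "\<bar>\<Sum>j\<in>UNIV. softmax x j * u $ j\<bar> \<le> norm u"
proof -
  have "\<bar>\<Sum>j\<in>UNIV. softmax x j * u $ j\<bar> \<le> (\<Sum>j\<in>UNIV. \<bar>softmax x j * u $ j\<bar>)" by (rule sum_abs)
  also have "\<dots> \<le> (\<Sum>j\<in>UNIV. softmax x j * norm u)"
    by (rule sum_mono) (simp add: abs_mult softmax_nonneg mult_left_mono component_le_norm_cart)
  also have "\<dots> = norm u" by (simp add: sum_softmax flip: sum_distrib_right)
  finally show ?thesis .
qed

lemma softmax_lipschitz: "\<bar>softmax x j - softmax y j\<bar> \<le> 2 * norm (x - y)"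
proof -
  define u where "u = x - y"
  define \<phi> where "\<phi> s = softmax (y + s *\<^sub>R u) j" for s
  define d where "d s = softmax (y + s *\<^sub>R u) j * (u $ j - (\<Sum>i\<in>UNIV. softmax (y + s *\<^sub>R u) i * u $ i))" for s
  have "(\<phi> has_real_derivative d s) (at s within {0..1})" for s
  proof -
    have "((\<lambda>s. lse (y + s *\<^sub>R u)) has_real_derivative (\<Sum>i\<in>UNIV. softmax (y + s *\<^sub>R u) i * u $ i)) (at s within {0..1})"
      by (rule has_real_derivative_along_line[OF lse_has_derivative[where S = UNIV]]) simp
    then show ?thesis unfolding \<phi>_def d_def softmax_eq_exp
      by (auto intro!: derivative_eq_intros)
  qed
  then have "\<exists>s\<in>{0<..<1}. \<phi> 1 - \<phi> 0 = d s * (1 - 0)"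
    by (intro mvt_simple) (auto simp: has_field_derivative_def)
  then obtain s where s: "\<phi> 1 - \<phi> 0 = d s" by auto
  have le1: "softmax (y + s *\<^sub>R u) j \<le> 1"
    using member_le_sum[of j UNIV "softmax (y + s *\<^sub>R u)"] by (simp add: softmax_nonneg sum_softmax)
  have "\<bar>d s\<bar> \<le> 1 * \<bar>u $ j - (\<Sum>i\<in>UNIV. softmax (y + s *\<^sub>R u) i * u $ i)\<bar>"
    unfolding d_def abs_mult by (rule mult_right_mono) (simp_all add: le1 softmax_nonneg abs_of_nonneg)
  also have "\<dots> \<le> norm u + norm u"
    using abs_triangle_ineq4[of "u $ j" "\<Sum>i\<in>UNIV. softmax (y + s *\<^sub>R u) i * u $ i"]
      add_mono[OF component_le_norm_cart[of u j] abs_softmax_mean_le[of "y + s *\<^sub>R u" u]]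
    by (simp only: mult_1)
  finally show ?thesis using s by (simp add: \<phi>_def u_def)
qed

text \<open>
  One summand of \<open>Psi\<close>. The linear term changes neither the midpoint gap nor the Lipschitz constant
  of the derivative of log-sum-exp.
\<close>

definition cross_entropy :: "'d::finite \<Rightarrow> real ^ 'd \<Rightarrow> real" where
  "cross_entropy j x = lse x - x $ j"

lemma cross_entropy_lip_deriv:
  "lip_deriv UNIV UNIV (2 * real CARD('d)) (cross_entropy j)
    (\<lambda>x h. (\<Sum>i\<in>UNIV. softmax x i * h $ i) - h $ (j::'d::finite))"
  unfolding lip_deriv_def
proof (intro conjI ballI)
  fix x :: "real ^ 'd"
  show "(cross_entropy j has_derivative (\<lambda>h. (\<Sum>i\<in>UNIV. softmax x i * h $ i) - h $ j)) (at x)"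
    unfolding cross_entropy_def[abs_def]
    by (intro has_derivative_diff lse_has_derivative bounded_linear_imp_has_derivative bounded_linear_vec_nth)
  fix y h :: "real ^ 'd"
  have "\<bar>\<Sum>i\<in>UNIV. (softmax x i - softmax y i) * h $ i\<bar> \<le> (\<Sum>i\<in>UNIV. \<bar>(softmax x i - softmax y i) * h $ i\<bar>)"
    by (rule sum_abs)
  also have "\<dots> \<le> (\<Sum>i\<in>(UNIV::'d set). (2 * norm (x - y)) * norm h)"
    by (rule sum_mono) (auto simp: abs_mult intro!: mult_mono softmax_lipschitz component_le_norm_cart)
  finally have "\<bar>\<Sum>i\<in>UNIV. (softmax x i - softmax y i) * h $ i\<bar> \<le> 2 * real CARD('d) * norm (x - y) * norm h"
    by simp
  then show "\<bar>(\<Sum>i\<in>UNIV. softmax x i * h $ i) - h $ j - ((\<Sum>i\<in>UNIV. softmax y i * h $ i) - h $ j)\<bar>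
      \<le> 2 * real CARD('d) * norm (x - y) * norm h"
    by (simp add: left_diff_distrib sum_subtractf)
qed

lemma midgap_cross_entropy: "midgap (cross_entropy j) x y = midgap lse x y"
  by (simp add: midgap_def cross_entropy_def midpoint_def field_simps)

text \<open>
  At the midpoint the exponentials are the products \<open>exp (x $ j / 2) * exp (y $ j / 2)\<close>, so the gap is half the
  logarithm of a Cauchy-Schwarz quotient \<open>A * B / P\<^sup>2\<close>; it is estimated by \<open>ln t \<le> t - 1\<close>.
\<close>

lemma midgap_lse_eq:
  fixes x y :: "real ^ 'd::finite"
  defines "A \<equiv> \<Sum>j\<in>UNIV. exp (x $ j)" and "B \<equiv> \<Sum>j\<in>UNIV. exp (y $ j)"
    and "P \<equiv> \<Sum>j\<in>UNIV. exp (x $ j / 2) * exp (y $ j / 2)"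
  shows "(A * B - P^2) / (2 * (A * B)) \<le> midgap lse x y"
proof -
  have AB: "0 < A" "0 < B" unfolding A_def B_def by (rule sum_exp_pos)+
  have P: "0 < P" unfolding P_def by (rule sum_pos) auto
  have "lse (midpoint x y) = ln P"
    by (simp add: lse_def P_def midpoint_def field_simps flip: exp_add)
  then have m: "midgap lse x y = (ln A + ln B) / 2 - ln P"
    by (simp add: midgap_def lse_def A_def B_def)
  have "ln (P^2 / (A * B)) \<le> P^2 / (A * B) - 1" by (rule ln_le_minus_one) (use AB P in simp)
  also have "ln (P^2 / (A * B)) = 2 * ln P - (ln A + ln B)"
    using AB P by (simp add: ln_div ln_mult ln_realpow)
  finally show ?thesis using AB unfolding m by (simp add: field_simps)
qed

lemma sum_exp_half_products:
  fixes x y :: "real ^ 'd::finite"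
  shows "(\<Sum>j\<in>I. exp (x $ j / 2) * exp (y $ j / 2))^2 \<le> (\<Sum>j\<in>I. exp (x $ j)) * (\<Sum>j\<in>I. exp (y $ j))"
proof -
  have "(exp (u / 2))^2 = exp u" for u :: real
    by (simp add: power2_eq_square flip: exp_add)
  then show ?thesis
    using Cauchy_Schwarz_ineq_sum[of "\<lambda>j. exp (x $ j / 2)" "\<lambda>j. exp (y $ j / 2)" I] by simp
qed

lemma midgap_lse_nonneg: "0 \<le> midgap lse x (y :: real ^ 'd::finite)"
proof -
  define A B P where "A = (\<Sum>j\<in>UNIV. exp (x $ j))" "B = (\<Sum>j\<in>UNIV. exp (y $ j))"
    "P = (\<Sum>j\<in>UNIV. exp (x $ j / 2) * exp (y $ j / 2))"
  have "0 \<le> (A * B - P^2) / (2 * (A * B))"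
    using sum_exp_half_products[of x y UNIV] sum_exp_pos[of x] sum_exp_pos[of y]
    by (simp add: A_B_P_def)
  also have "\<dots> \<le> midgap lse x y" unfolding A_B_P_def by (rule midgap_lse_eq)
  finally show ?thesis .
qed

lemma abs_exp_diff_ge:
  fixes u v b :: real
  assumes "- b \<le> u" "- b \<le> v"
  shows "exp (- b) * \<bar>u - v\<bar> \<le> \<bar>exp u - exp v\<bar>"
proof -
  have *: "exp (- b) * (s - t) \<le> exp s - exp t" if "- b \<le> t" "t \<le> s" for s t :: real
  proof -
    have "exp (- b) * (s - t) \<le> exp t * (exp (s - t) - 1)"
    proof (rule mult_mono)
      show "s - t \<le> exp (s - t) - 1" using exp_ge_add_one_self[of "s - t"] by linarith
    qed (use that in auto)
    then show ?thesis by (simp add: right_diff_distrib flip: exp_add)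
  qed
  show ?thesis using *[of v u] *[of u v] assms by (cases "v \<le> u") auto
qed

text \<open>
  Log-sum-exp is constant in the direction \<open>(1, \<dots>, 1)\<close>; fixing one coordinate to \<open>0\<close> removes this
  degeneracy. That coordinate contributes \<open>1\<close> to each of the three sums \<open>A1\<close>, \<open>B1\<close>, \<open>P1\<close>. Multiplying
  out and applying Cauchy-Schwarz to the other coordinates leaves the surplus
  \<open>A1 + B1 - 2 * P1 = \<delta>\<close>, which dominates \<open>(norm (x - y))\<^sup>2\<close> on bounded sets.
\<close>

lemma midgap_lse_strong:
  fixes x y :: "real ^ 'd::finite"
  assumes B: "\<And>j. \<bar>x $ j\<bar> \<le> b" "\<And>j. \<bar>y $ j\<bar> \<le> b" and l: "x $ l = 0" "y $ l = 0"
  shows "exp (- b) / 4 / (2 * (real CARD('d) * exp b)^2) * (norm (x - y))^2 \<le> midgap lse x y"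
proof -
  define I where "I = UNIV - {l}"
  define A0 B0 P0 where "A0 = (\<Sum>j\<in>I. exp (x $ j))" "B0 = (\<Sum>j\<in>I. exp (y $ j))"
    "P0 = (\<Sum>j\<in>I. exp (x $ j / 2) * exp (y $ j / 2))"
  define A1 B1 P1 where "A1 = (\<Sum>j\<in>UNIV. exp (x $ j))" "B1 = (\<Sum>j\<in>UNIV. exp (y $ j))"
    "P1 = (\<Sum>j\<in>UNIV. exp (x $ j / 2) * exp (y $ j / 2))"
  have split: "A1 = 1 + A0" "B1 = 1 + B0" "P1 = 1 + P0"
    unfolding A0_B0_P0_def A1_B1_P1_def I_def
    by (subst sum.remove[of UNIV l]; simp add: l)+
  define \<delta> where "\<delta> = (\<Sum>j\<in>UNIV. (exp (x $ j / 2) - exp (y $ j / 2))^2)"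
  have ee: "(exp (u / 2))^2 = exp u" for u :: real
    by (simp add: power2_eq_square flip: exp_add)
  have "\<delta> = A1 + B1 - 2 * P1"
    unfolding \<delta>_def A1_B1_P1_def
    by (simp add: power2_diff ee sum.distrib sum_subtractf sum_distrib_left mult.assoc)
  also have "\<dots> \<le> A1 * B1 - P1^2"
    using sum_exp_half_products[of x y I] unfolding split A0_B0_P0_def[symmetric]
    by (simp add: algebra_simps power2_eq_square)
  finally have 1: "\<delta> \<le> A1 * B1 - P1^2" .
  have "exp (- b) / 4 * (norm (x - y))^2 = (\<Sum>j\<in>UNIV. exp (- b) / 4 * (x $ j - y $ j)^2)"
  proof -
    have "(norm (x - y))^2 = (\<Sum>j\<in>UNIV. (x $ j - y $ j)^2)"
      unfolding power2_norm_eq_inner inner_vec_def by (simp add: power2_eq_square)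
    then show ?thesis by (simp only: sum_distrib_left)
  qed
  also have "\<dots> \<le> \<delta>"
    unfolding \<delta>_def
  proof (rule sum_mono)
    fix j
    have "exp (- (b / 2)) * \<bar>x $ j / 2 - y $ j / 2\<bar> \<le> \<bar>exp (x $ j / 2) - exp (y $ j / 2)\<bar>"
      by (rule abs_exp_diff_ge) (use B[of j] in auto)
    then have "(exp (- (b / 2)) * \<bar>x $ j / 2 - y $ j / 2\<bar>)^2 \<le> \<bar>exp (x $ j / 2) - exp (y $ j / 2)\<bar>^2"
      by (rule power_mono) simp
    moreover have "(exp (- (b / 2)))^2 = exp (- b)" using ee[of "- b"] by simp
    moreover have "(x $ j / 2 - y $ j / 2)^2 = (x $ j - y $ j)^2 / 4"
      by (simp add: power2_eq_square field_simps)
    ultimately have "exp (- b) * ((x $ j - y $ j)^2 / 4) \<le> (exp (x $ j / 2) - exp (y $ j / 2))^2"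
      by (simp only: power_mult_distrib power2_abs)
    then show "exp (- b) / 4 * (x $ j - y $ j)^2 \<le> (exp (x $ j / 2) - exp (y $ j / 2))^2"
      by (simp only: times_divide_eq_left times_divide_eq_right)
  qed
  finally have 2: "exp (- b) / 4 * (norm (x - y))^2 \<le> \<delta>" .
  have pos: "0 < A1" "0 < B1" unfolding A1_B1_P1_def by (rule sum_exp_pos)+
  have "exp (u $ j) \<le> exp b" if "\<And>j. \<bar>u $ j\<bar> \<le> b" for u :: "real ^ 'd" and j
    using that[of j] by auto
  then have le: "A1 \<le> real CARD('d) * exp b" "B1 \<le> real CARD('d) * exp b"
    unfolding A1_B1_P1_def using B by (auto intro!: sum_bounded_above[of UNIV, simplified])
  have "A1 * B1 \<le> (real CARD('d) * exp b) * (real CARD('d) * exp b)"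
    by (rule mult_mono) (use le pos in auto)
  then have 3: "2 * (A1 * B1) \<le> 2 * (real CARD('d) * exp b)^2" by (simp add: power2_eq_square)
  have "exp (- b) / 4 / (2 * (real CARD('d) * exp b)^2) * (norm (x - y))^2
      = exp (- b) / 4 * (norm (x - y))^2 / (2 * (real CARD('d) * exp b)^2)" by simp
  also have "\<dots> \<le> (A1 * B1 - P1^2) / (2 * (A1 * B1))"
  proof (rule frac_le)
    have "0 \<le> exp (- b) / 4 * (norm (x - y))^2" by simp
    then show "0 \<le> A1 * B1 - P1^2" using 1 2 by linarith
    show "exp (- b) / 4 * (norm (x - y))^2 \<le> A1 * B1 - P1^2" using 1 2 by linarith
    show "0 < 2 * (A1 * B1)" using pos by simp
  qed (rule 3)
  also have "\<dots> \<le> midgap lse x y" unfolding A1_B1_P1_def by (rule midgap_lse_eq)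
  finally show ?thesis .
qed

section \<open>The likelihood of the switching model\<close>

lemma subspace_Theta_space: "subspace (Theta_space :: ('nz::finite, 'd::{finite,linorder}) trans_param set)"
  by (auto simp: subspace_def Theta_space_def column_def vec_eq_iff)

lemma subspace_param_space:
  "subspace (param_space :: ('nz::finite, 'd::{finite,linorder}, 'b::euclidean_space) param set)"
  unfolding param_space_def by (intro subspace_Times subspace_Theta_space subspace_UNIV)

text \<open>
  Lower semicontinuity is the part of the KL property that makes the sublevel sets compact; the KL
  inequality itself enters through the abstract convergence theorem.
\<close>

locale em_model =
  fixes M :: "('d::{finite,linorder}, 'ny::finite, 'nz::finite, 'ng::finite,
               'b::euclidean_space) switching_model"
    and V D :: "'ng \<Rightarrow> 'm::euclidean_space set"
    and g :: "'ng \<Rightarrow> 'm \<Rightarrow> real"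
    and A :: "'ng \<Rightarrow> real ^ 'ny \<Rightarrow> real ^ 'nz \<Rightarrow> 'b \<Rightarrow> 'm"
    and R :: "('nz, 'd, 'b) param \<Rightarrow> real"
    and R1 :: "('nz, 'd) trans_param \<Rightarrow> real"
    and R2 :: "('b, 'd) obs_param \<Rightarrow> real"
  assumes valid: "valid_model M"
    and obs: "assumption_obs M V D g A"
    and reg: "assumption_reg M R R1 R2"
    and smooth: "assumption_smooth M V D g A R"
    and lsc: "lsc_on param_space (reg_nll_ext M R)"
begin

abbreviation S :: "('nz, 'd, 'b) param set" where "S \<equiv> param_space"
abbreviation X :: "('nz, 'd, 'b) param set" where "X \<equiv> params M"

lemma X_subset_S: "X \<subseteq> S"
  by (auto simp: params_def param_space_def)

lemma X_iff: "\<theta> \<in> X \<longleftrightarrow> fst \<theta> \<in> Theta_space \<and> snd \<theta> \<in> betas M"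
  by (auto simp: params_def mem_Times_iff)

lemma convex_betas: "convex (betas M)"
  using reg by (auto simp: assumption_reg_def intro: convex_on_imp_convex)

lemma convex_X: "convex X"
  unfolding params_def by (intro convex_Times convex_betas subspace_imp_convex subspace_Theta_space)

lemma open_betas: "open (betas M)"
proof -
  have "open (\<Inter>i. (\<lambda>\<beta>. \<beta> $ i) -` beta_dom M)"
    using valid by (intro open_INT ballI open_vimage continuous_intros) (auto simp: valid_model_def)
  moreover have "betas M = (\<Inter>i. (\<lambda>\<beta>. \<beta> $ i) -` beta_dom M)" by (auto simp: betas_def)
  ultimately show ?thesis by simp
qed

lemma openin_X: "openin (top_of_set S) X"
proof -
  have "X = S \<inter> (UNIV \<times> betas M)" by (auto simp: params_def param_space_def)
  then show ?thesis by (metis open_Times open_UNIV open_betas openin_open_Int)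
qed

lemma beta_dom: "open (beta_dom M)" "convex (beta_dom M)"
  using valid by (auto simp: valid_model_def)

lemma X_beta_dom: "\<theta> \<in> X \<Longrightarrow> snd \<theta> $ j \<in> beta_dom M"
  by (simp add: X_iff betas_def)

lemma finite_paths: "finite (paths M)" "paths M \<noteq> {}"
  unfolding paths_def by (auto intro!: finite_PiE simp: PiE_eq_empty_iff)

definition "score i t (\<theta> :: ('nz, 'd, 'b) param) = transpose (fst \<theta> $ i) *v zt M t"

lemma score_nth: "score i t \<theta> $ j = column j (fst \<theta> $ i) \<bullet> zt M t"
  by (simp add: score_def matrix_vector_mult_def transpose_def column_def inner_vec_def)

lemma score_last: "\<theta> \<in> S \<Longrightarrow> score i t \<theta> $ Max UNIV = 0"
  by (auto simp: score_nth param_space_def Theta_space_def)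

lemma linear_score: "linear (score i t)"
  by (rule linearI)
     (auto simp: vec_eq_iff score_nth column_def inner_vec_def sum.distrib sum_distrib_left algebra_simps)

lemma bounded_linear_score: "bounded_linear (score i t)"
  using linear_score linear_conv_bounded_linear by blast

lemma Psi_eq: "Psi M \<xi> (fst \<theta>) = (\<Sum>t<horizon M. cross_entropy (\<xi> (t + 1)) (score (\<xi> t) t \<theta>))"
  by (simp add: Psi_def cross_entropy_def score_nth) (simp add: score_def)

definition log_const :: "(nat \<Rightarrow> 'd) \<Rightarrow> real" where
  "log_const \<xi> = ln (init_prob M (\<xi> 0) (z_init M)) + real (horizon M) * ln (obs_const M)"

lemma joint_eq: "joint M \<theta> \<xi> = exp (log_const \<xi> - (Psi M \<xi> (fst \<theta>) + Phi M \<xi> (snd \<theta>)))"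
proof -
  have C: "0 < obs_const M" and i: "0 < init_prob M (\<xi> 0) (z_init M)" using valid by (auto simp: valid_model_def)
  have "obs_density M (obs M (int t + 1)) (zt M t) (snd \<theta> $ \<xi> (t + 1)) * trans_prob (fst \<theta>) (zt M t) (\<xi> t) (\<xi> (t + 1))
      = exp (ln (obs_const M) - (cross_entropy (\<xi> (t + 1)) (score (\<xi> t) t \<theta>) + obs_fun M (Gt M t (snd \<theta> $ \<xi> (t + 1)))))" for t
    using C by (simp add: obs_density_def trans_prob_def softmax_eq_exp cross_entropy_def score_def Gt_def exp_diff exp_add exp_minus field_simps)
  then have "joint M \<theta> \<xi> = init_prob M (\<xi> 0) (z_init M) *
     exp (\<Sum>t<horizon M. ln (obs_const M) - (cross_entropy (\<xi> (t + 1)) (score (\<xi> t) t \<theta>) + obs_fun M (Gt M t (snd \<theta> $ \<xi> (t + 1)))))"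
    by (simp add: joint_def exp_sum)
  also have "\<dots> = exp (ln (init_prob M (\<xi> 0) (z_init M)) + (\<Sum>t<horizon M. ln (obs_const M) - (cross_entropy (\<xi> (t + 1)) (score (\<xi> t) t \<theta>) + obs_fun M (Gt M t (snd \<theta> $ \<xi> (t + 1))))))"
    using i by (simp add: exp_add)
  finally show ?thesis
    by (simp add: log_const_def Psi_eq Phi_def sum.distrib sum_subtractf algebra_simps)
qed

lemma joint_pos: "0 < joint M \<theta> \<xi>"
  by (simp add: joint_eq)

lemma sum_joint_pos: "0 < (\<Sum>\<xi>\<in>paths M. joint M \<theta> \<xi>)"
  by (rule sum_pos) (use finite_paths joint_pos in auto)

lemma posterior_pos: "0 < posterior M \<theta> \<xi>"
  by (simp add: posterior_def joint_pos sum_joint_pos)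

lemma sum_posterior: "(\<Sum>\<xi>\<in>paths M. posterior M \<theta> \<xi>) = 1"
  using sum_joint_pos[of \<theta>] by (simp add: posterior_def flip: sum_divide_distrib)

lemma posterior_le_1: "\<xi> \<in> paths M \<Longrightarrow> posterior M \<theta> \<xi> \<le> 1"
  using member_le_sum[of \<xi> "paths M" "posterior M \<theta>"] finite_paths
  by (simp add: less_imp_le[OF posterior_pos] sum_posterior)

lemma Gt_obs_dom: "b \<in> beta_dom M \<Longrightarrow> Gt M t b \<in> obs_dom M"
  using valid by (simp add: valid_model_def Gt_def)

lemma Gt_has_derivative:
  assumes "t < horizon M" "b \<in> beta_dom M"
  shows "((\<lambda>b. Gt M t b $ i) has_derivative (\<lambda>h. gradient UNIV (\<lambda>b. Gt M t b $ i) b \<bullet> h)) (at b)"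
  by (rule C1_on_has_gradient(2)[where X = "beta_dom M"])
     (use smooth assms in \<open>auto simp: assumption_smooth_def smooth_on_compacts_def\<close>)

lemma Gt_differentiable:
  assumes "t < horizon M" "b \<in> beta_dom M"
  shows "Gt M t differentiable (at b)"
proof -
  have "(\<lambda>b. Gt M t b \<bullet> i) differentiable (at b)" if i: "i \<in> Basis" for i
  proof -
    obtain k where "i = axis k (1::real)" using i by (auto simp: Basis_vec_def)
    then have "(\<lambda>b. Gt M t b \<bullet> i) = (\<lambda>b. Gt M t b $ k)" by (simp add: inner_axis)
    then show ?thesis using Gt_has_derivative[OF assms] unfolding differentiable_def by metis
  qed
  then show ?thesis
    using differentiable_componentwise_within[of "Gt M t" b UNIV] by blast
qed

lemma obs_fun_has_derivative:
  assumes "v \<in> obs_dom M"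
  shows "(obs_fun M has_derivative (\<lambda>h. gradient UNIV (obs_fun M) v \<bullet> h)) (at v)"
  by (rule C1_on_has_gradient(2)[where X = "obs_dom M"])
     (use obs assms in \<open>auto simp: assumption_obs_def\<close>)

lemma Phi_differentiable:
  assumes x: "\<theta> \<in> X"
  shows "(\<lambda>\<theta>. Phi M \<xi> (snd \<theta>)) differentiable (at \<theta> within S)"
  unfolding Phi_def
proof (rule differentiable_sum)
  show "\<forall>t\<in>{..<horizon M}. (\<lambda>\<theta>. obs_fun M (Gt M t (snd \<theta> $ \<xi> (t + 1)))) differentiable at \<theta> within S"
  proof
    fix t assume "t \<in> {..<horizon M}"
    then have t: "t < horizon M" by simp
    let ?j = "\<xi> (t + 1)"
    have "bounded_linear (\<lambda>\<theta>::('nz, 'd, 'b) param. snd \<theta> $ ?j)"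
      by (rule bounded_linear_compose[OF bounded_linear_vec_nth bounded_linear_snd])
    then have p: "(\<lambda>\<theta>::('nz, 'd, 'b) param. snd \<theta> $ ?j) differentiable (at \<theta> within S)"
      by (rule bounded_linear_imp_differentiable)
    have q: "(\<lambda>\<theta>. Gt M t (snd \<theta> $ ?j)) differentiable (at \<theta> within S)"
      by (rule differentiable_compose[OF Gt_differentiable[OF t X_beta_dom[OF x]] p])
    show "(\<lambda>\<theta>. obs_fun M (Gt M t (snd \<theta> $ ?j))) differentiable at \<theta> within S"
      by (rule differentiable_compose[OF _ q])
         (use obs_fun_has_derivative[OF Gt_obs_dom[OF X_beta_dom[OF x]]] in \<open>auto simp: differentiable_def\<close>)
  qed
qed simp

lemma score_cross_entropy_lip_deriv:
  obtains L F' where "0 \<le> L" "lip_deriv S K L (\<lambda>\<theta>. cross_entropy j (score i t \<theta>)) F'"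
proof -
  obtain B where B: "0 < B" "\<And>h. norm (score i t h) \<le> norm h * B"
    using bounded_linear.pos_bounded[OF bounded_linear_score] by blast
  have "lip_deriv S K (2 * real CARD('d) * B * B) (\<lambda>\<theta>. cross_entropy j (score i t \<theta>))
      (\<lambda>x h. (\<Sum>k\<in>UNIV. softmax (score i t x) k * score i t h $ k) - score i t h $ j)"
    by (rule lip_deriv_compose_linear[OF cross_entropy_lip_deriv bounded_linear_score])
       (use B in \<open>auto simp: mult.commute\<close>)
  then show ?thesis using B that[of "2 * real CARD('d) * B * B"] by simp
qed

lemma Psi_lip_deriv:
  obtains L F' where "0 \<le> L" "lip_deriv S K L (\<lambda>\<theta>. Psi M \<xi> (fst \<theta>)) F'"
proof -
  have "\<exists>L D. 0 \<le> L \<and> lip_deriv S K L (\<lambda>\<theta>. cross_entropy (\<xi> (t + 1)) (score (\<xi> t) t \<theta>)) D" for t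
    using score_cross_entropy_lip_deriv[of K "\<xi> (t + 1)" "\<xi> t" t] by blast
  then obtain L D where LD: "\<And>t. 0 \<le> L t \<and> lip_deriv S K (L t) (\<lambda>\<theta>. cross_entropy (\<xi> (t + 1)) (score (\<xi> t) t \<theta>)) (D t)"
    by metis
  have "lip_deriv S K (\<Sum>t<horizon M. L t) (\<lambda>\<theta>. \<Sum>t<horizon M. cross_entropy (\<xi> (t + 1)) (score (\<xi> t) t \<theta>))
      (\<lambda>x h. \<Sum>t<horizon M. D t x h)"
    by (rule lip_deriv_sum) (use LD in auto)
  then have "lip_deriv S K (\<Sum>t<horizon M. L t) (\<lambda>\<theta>. Psi M \<xi> (fst \<theta>)) (\<lambda>x h. \<Sum>t<horizon M. D t x h)"
    by (simp only: Psi_eq)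
  moreover have "0 \<le> (\<Sum>t<horizon M. L t)" by (rule sum_nonneg) (simp add: LD)
  ultimately show ?thesis by (rule that[rotated])
qed

lemma Psi_differentiable: "(\<lambda>\<theta>. Psi M \<xi> (fst \<theta>)) differentiable (at \<theta> within S)"
proof -
  obtain L D where "lip_deriv S UNIV L (\<lambda>\<theta>. Psi M \<xi> (fst \<theta>)) D" by (rule Psi_lip_deriv)
  then show ?thesis unfolding lip_deriv_def differentiable_def by blast
qed

lemma R_C1: "C1_on S X R"
  using smooth by (auto simp: assumption_smooth_def C2_on_def smooth_on_compacts_def)

lemma joint_differentiable:
  assumes x: "\<theta> \<in> X"
  shows "(\<lambda>\<theta>. joint M \<theta> \<xi>) differentiable (at \<theta> within S)"
proof -
  have e: "(exp :: real \<Rightarrow> real) differentiable (at u)" for u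
    using DERIV_exp[of u] has_field_derivative_imp_has_derivative unfolding differentiable_def by blast
  show ?thesis
    unfolding joint_eq
    by (rule differentiable_compose[OF e])
       (intro differentiable_diff differentiable_add differentiable_const Psi_differentiable Phi_differentiable x)
qed

lemma reg_nll_differentiable:
  assumes x: "\<theta> \<in> X"
  shows "reg_nll M R differentiable (at \<theta> within S)"
proof -
  have l: "(ln :: real \<Rightarrow> real) differentiable (at u)" if "0 < u" for u
    using DERIV_ln[OF that] has_field_derivative_imp_has_derivative unfolding differentiable_def by blast
  have "(\<lambda>\<theta>. \<Sum>\<xi>\<in>paths M. joint M \<theta> \<xi>) differentiable (at \<theta> within S)"
    by (intro differentiable_sum finite_paths ballI joint_differentiable x)
  then have "(\<lambda>\<theta>. ln (\<Sum>\<xi>\<in>paths M. joint M \<theta> \<xi>)) differentiable (at \<theta> within S)"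
    by (rule differentiable_compose[where f = ln, rotated]) (rule l[OF sum_joint_pos])
  moreover have "R differentiable (at \<theta> within S)"
    using C1_on_has_gradient(2)[OF R_C1 subspace_param_space X_subset_S x] unfolding differentiable_def by blast
  ultimately show ?thesis
    unfolding reg_nll_def[abs_def] nll_def[abs_def] by (intro differentiable_add differentiable_minus)
qed

section \<open>The EM surrogate as a majorizer\<close>

definition Sur :: "('nz, 'd, 'b) param \<Rightarrow> ('nz, 'd, 'b) param \<Rightarrow> real" where
  "Sur x y = Q1 M x (fst y) + Q2 M x (snd y) + R y"

text \<open>
  The softmax weights of the tangent to minus log-sum-exp are the posterior probabilities.
\<close>

lemma nll_major:
  "nll M y \<le> nll M x + (\<Sum>\<xi>\<in>paths M. posterior M x \<xi> * (Psi M \<xi> (fst y) + Phi M \<xi> (snd y) - (Psi M \<xi> (fst x) + Phi M \<xi> (snd x))))"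
proof -
  have e: "(c - p) - (c - q) = q - p" for c p q :: real by simp
  show ?thesis
    using neg_ln_sum_exp_tangent[OF finite_paths, where
      b = "\<lambda>\<xi>. log_const \<xi> - (Psi M \<xi> (fst y) + Phi M \<xi> (snd y))" and
      a = "\<lambda>\<xi>. log_const \<xi> - (Psi M \<xi> (fst x) + Phi M \<xi> (snd x))"]
    unfolding nll_def posterior_def joint_eq e .
qed

lemma Phi_le_Phi_hat:
  assumes "x \<in> X" "y \<in> X"
  shows "Phi M \<xi> (snd y) \<le> Phi_hat M (snd x) \<xi> (snd y)"
  unfolding Phi_def Phi_hat_def
proof (rule sum_mono)
  fix t
  show "obs_fun M (Gt M t (snd y $ \<xi> (t + 1))) \<le> obs_fun M (Gt M t (snd x $ \<xi> (t + 1))) +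
         gradient UNIV (obs_fun M) (Gt M t (snd x $ \<xi> (t + 1))) \<bullet>
          (Gt M t (snd y $ \<xi> (t + 1)) - Gt M t (snd x $ \<xi> (t + 1)))"
    by (rule concave_tangent[where X = "obs_dom M"])
       (use obs assms in \<open>auto simp: assumption_obs_def intro!: obs_fun_has_derivative Gt_obs_dom X_beta_dom\<close>)
qed

lemma major:
  assumes xy: "x \<in> X" "y \<in> X"
  shows "reg_nll M R y \<le> reg_nll M R x + Sur x y - Sur x x"
proof -
  have "(\<Sum>\<xi>\<in>paths M. posterior M x \<xi> * (Psi M \<xi> (fst y) + Phi M \<xi> (snd y) - (Psi M \<xi> (fst x) + Phi M \<xi> (snd x))))
    \<le> (\<Sum>\<xi>\<in>paths M. posterior M x \<xi> * (Psi M \<xi> (fst y) + Phi_hat M (snd x) \<xi> (snd y) - (Psi M \<xi> (fst x) + Phi M \<xi> (snd x))))"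
    by (intro sum_mono mult_left_mono diff_right_mono add_left_mono Phi_le_Phi_hat xy less_imp_le[OF posterior_pos])
  also have "\<dots> = Q1 M x (fst y) + Q2 M x (snd y) - (Q1 M x (fst x) + Q2 M x (snd x))"
  proof -
    have "Phi_hat M (snd x) \<xi> (snd x) = Phi M \<xi> (snd x)" for \<xi> by (simp add: Phi_hat_def Phi_def)
    then show ?thesis
      by (simp add: Q1_def Q2_def distrib_left right_diff_distrib sum.distrib sum_subtractf)
  qed
  finally show ?thesis using nll_major[of y x] by (simp add: reg_nll_def Sur_def)
qed

section \<open>Compactness of sublevel sets\<close>

text \<open>
  Every summand of the likelihood is at most \<open>exp (log_const \<xi> + R \<theta> - N)\<close>, where \<open>N\<close> is the lower
  bound for \<open>Psi M \<xi> (fst \<theta>) + Phi M \<xi> (snd \<theta>) + R \<theta>\<close> that is the same for all mode sequences.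
\<close>

lemma reg_nll_coercive:
  obtains \<kappa> c where "0 < \<kappa>" "\<And>\<theta>. \<theta> \<in> X \<Longrightarrow> \<kappa> * norm \<theta> + c \<le> reg_nll M R \<theta>"
proof -
  obtain k1 k2 c1 c2 where k: "0 < k1" "0 < k2" and
    lb: "\<And>\<xi> \<Theta>. \<xi> \<in> paths M \<Longrightarrow> \<Theta> \<in> Theta_space \<Longrightarrow> k1 * norm \<Theta> + c1 \<le> Psi M \<xi> \<Theta> + R1 \<Theta>"
    "\<And>\<xi> \<beta>. \<xi> \<in> paths M \<Longrightarrow> \<beta> \<in> betas M \<Longrightarrow> k2 * norm \<beta> + c2 \<le> Phi M \<xi> \<beta> + R2 \<beta>"
    using reg unfolding assumption_reg_def by metis
  define Z where "Z = (\<Sum>\<xi>\<in>paths M. exp (log_const \<xi>))"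
  have Z: "0 < Z" unfolding Z_def by (rule sum_pos) (use finite_paths in auto)
  show ?thesis
  proof (rule that[of "min k1 k2" "c1 + c2 - ln Z"])
    show "0 < min k1 k2" using k by simp
    fix \<theta> assume \<theta>: "\<theta> \<in> X"
    define N where "N = k1 * norm (fst \<theta>) + c1 + (k2 * norm (snd \<theta>) + c2)"
    have RR: "R \<theta> = R1 (fst \<theta>) + R2 (snd \<theta>)" using reg \<theta> by (simp add: assumption_reg_def)
    have "joint M \<theta> \<xi> \<le> exp (log_const \<xi>) * exp (R \<theta> - N)" if "\<xi> \<in> paths M" for \<xi>
    proof -
      have "log_const \<xi> - (Psi M \<xi> (fst \<theta>) + Phi M \<xi> (snd \<theta>)) \<le> log_const \<xi> + (R \<theta> - N)"
        using lb(1)[OF that, of "fst \<theta>"] lb(2)[OF that, of "snd \<theta>"] \<theta> unfolding X_iff RR N_def by linarith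
      then show ?thesis by (simp add: joint_eq flip: exp_add)
    qed
    then have "(\<Sum>\<xi>\<in>paths M. joint M \<theta> \<xi>) \<le> Z * exp (R \<theta> - N)"
      unfolding Z_def sum_distrib_right by (rule sum_mono)
    then have "ln (\<Sum>\<xi>\<in>paths M. joint M \<theta> \<xi>) \<le> ln (Z * exp (R \<theta> - N))"
      using sum_joint_pos[of \<theta>] by (intro ln_mono) auto
    also have "\<dots> = ln Z + (R \<theta> - N)" using Z by (simp add: ln_mult)
    finally have "N - ln Z \<le> reg_nll M R \<theta>" by (simp add: reg_nll_def nll_def)
    moreover have "min k1 k2 * norm \<theta> \<le> k1 * norm (fst \<theta>) + k2 * norm (snd \<theta>)"
    proof -
      have "norm \<theta> \<le> norm (fst \<theta>) + norm (snd \<theta>)" using norm_Pair_le[of "fst \<theta>" "snd \<theta>"] by simp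
      then have "min k1 k2 * norm \<theta> \<le> min k1 k2 * (norm (fst \<theta>) + norm (snd \<theta>))"
        using k by (intro mult_left_mono) auto
      also have "\<dots> = min k1 k2 * norm (fst \<theta>) + min k1 k2 * norm (snd \<theta>)" by (rule distrib_left)
      also have "\<dots> \<le> k1 * norm (fst \<theta>) + k2 * norm (snd \<theta>)"
        by (intro add_mono mult_right_mono) auto
      finally show ?thesis .
    qed
    ultimately show "min k1 k2 * norm \<theta> + (c1 + c2 - ln Z) \<le> reg_nll M R \<theta>" by (simp add: N_def)
  qed
qed

text \<open>
  Closedness is where the value \<open>\<infinity>\<close> outside \<open>X\<close> matters: by lower semicontinuity a boundary point of
  \<open>X\<close> is not a limit of points with values at most \<open>c\<close>.
\<close>

lemma compact_sublevel: "compact {\<theta> \<in> X. reg_nll M R \<theta> \<le> c}" (is "compact ?A")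
proof -
  obtain \<kappa> c0 where \<kappa>: "0 < \<kappa>" "\<And>\<theta>. \<theta> \<in> X \<Longrightarrow> \<kappa> * norm \<theta> + c0 \<le> reg_nll M R \<theta>"
    using reg_nll_coercive by blast
  have "norm \<theta> \<le> (c - c0) / \<kappa>" if "\<theta> \<in> ?A" for \<theta>
  proof -
    have "\<kappa> * norm \<theta> \<le> c - c0" using \<kappa>(2)[of \<theta>] that by auto
    then show ?thesis using \<kappa>(1) by (simp add: pos_le_divide_eq mult.commute)
  qed
  then have "bounded ?A" unfolding bounded_iff by blast
  moreover have "closed ?A"
    unfolding closed_limpt
  proof (intro allI impI)
    fix l assume lim: "l islimpt ?A"
    have "l islimpt S" by (rule islimpt_subset[OF lim]) (use X_subset_S in auto)
    then have lS: "l \<in> S" using closed_subspace[OF subspace_param_space] closed_limpt by blast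
    show "l \<in> ?A"
    proof (rule ccontr)
      assume "l \<notin> ?A"
      then have "ereal c < reg_nll_ext M R l" by (auto simp: reg_nll_ext_def)
      also have "\<dots> \<le> Liminf (at l within S) (reg_nll_ext M R)" using lsc lS by (simp add: lsc_on_def)
      finally have "\<forall>\<^sub>F y in at l within S. ereal c < reg_nll_ext M R y" by (rule less_LiminfD)
      then obtain e where e: "0 < e" "\<And>y. y \<in> S \<Longrightarrow> y \<noteq> l \<Longrightarrow> dist y l < e \<Longrightarrow> ereal c < reg_nll_ext M R y"
        unfolding eventually_at by blast
      obtain y where y: "y \<in> ?A" "y \<noteq> l" "dist y l < e" using lim e(1) unfolding islimpt_approachable by blast
      then show False using e(2)[of y] X_subset_S by (auto simp: reg_nll_ext_def)
    qed
  qed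
  ultimately show ?thesis by (simp add: compact_eq_bounded_closed)
qed

end

section \<open>Smoothness and strong midpoint convexity of the surrogate\<close>

lemma finite_common_pos:
  assumes "finite I" and ex: "\<And>i. i \<in> I \<Longrightarrow> \<exists>c>0::real. P i c"
    and mono: "\<And>i c c'. P i c \<Longrightarrow> 0 < c' \<Longrightarrow> c' \<le> c \<Longrightarrow> P i c'"
  obtains c where "0 < c" "\<And>i. i \<in> I \<Longrightarrow> P i c"
proof -
  have "\<exists>c>0. \<forall>i\<in>I. P i c"
    using assms(1) ex
  proof (induction I rule: finite_induct)
    case empty
    show ?case by (intro exI[of _ 1]) auto
  next
    case (insert i I)
    obtain c where c: "0 < c" "\<forall>i\<in>I. P i c" using insert by blast
    obtain c' where c': "0 < c'" "P i c'" using insert by blast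
    have "0 < min c c'" using c c' by simp
    moreover have "\<forall>j\<in>insert i I. P j (min c c')"
      using c c' mono \<open>0 < min c c'\<close> by (auto intro: mono[of _ c] mono[of _ c'])
    ultimately show ?case by blast
  qed
  then show ?thesis using that by blast
qed

lemma norm_vec_power2: "(norm v)^2 = (\<Sum>i\<in>UNIV. (norm (v $ i))^2)" for v :: "'a::real_normed_vector ^ 'n::finite"
  by (simp add: norm_vec_def L2_set_def sum_nonneg)

lemma norm_matrix_columns: "(norm m)^2 = (\<Sum>j\<in>UNIV. (norm (column j m))^2)" for m :: "real ^ 'n::finite ^ 'm::finite"
  unfolding norm_vec_power2[of m] norm_vec_power2[of "_ $ _"] norm_vec_power2[of "column _ _"]
  by (subst sum.swap) (simp add: column_def)

lemma norm_prod_power2: "(norm p)^2 = (norm (fst p))^2 + (norm (snd p))^2" for p :: "'a::real_normed_vector \<times> 'b::real_normed_vector"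
  by (simp add: norm_prod_def)

context em_model
begin

definition "weight x t j = gradient UNIV (obs_fun M) (Gt M t (snd (x :: ('nz, 'd, 'b) param) $ j))"

text \<open>
  As a function of \<open>y\<close> this is a constant plus a positive combination of the components of the \<open>G\<^sub>t\<close>.
\<close>

lemma Phi_hat_eq:
  "Phi_hat M (snd x) \<xi> (snd y) = (\<Sum>t<horizon M.
     (obs_fun M (Gt M t (snd x $ \<xi> (t + 1))) - weight x t (\<xi> (t + 1)) \<bullet> Gt M t (snd x $ \<xi> (t + 1))) +
     (\<Sum>i\<in>UNIV. weight x t (\<xi> (t + 1)) $ i * Gt M t (snd y $ \<xi> (t + 1)) $ i))"
  unfolding Phi_hat_def weight_def inner_diff_right
  by (rule sum.cong) (simp_all add: inner_vec_def)

lemma weight_bound: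
  obtains u where "0 < u" "\<And>x t j i. x \<in> X \<Longrightarrow> \<bar>weight x t j $ i\<bar> \<le> u"
proof -
  obtain u where u: "0 < u" "\<And>v. v \<in> obs_dom M \<Longrightarrow> infnorm (gradient UNIV (obs_fun M) v) \<le> u"
    using obs unfolding assumption_obs_def by blast
  have "\<bar>weight x t j $ i\<bar> \<le> u" if "x \<in> X" for x t j i
    using component_le_infnorm_cart[of "weight x t j" i] u(2)[OF Gt_obs_dom[OF X_beta_dom[OF that]], of t j]
    unfolding weight_def by linarith
  then show ?thesis using that u by blast
qed

lemma weight_pos: "x \<in> X \<Longrightarrow> 0 < weight x t j $ i"
  using obs Gt_obs_dom[OF X_beta_dom] unfolding assumption_obs_def weight_def by blast

lemma bounded_linear_beta: "bounded_linear (\<lambda>\<theta>::('nz, 'd, 'b) param. snd \<theta> $ j)"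
  by (rule bounded_linear_compose[OF bounded_linear_vec_nth bounded_linear_snd])

lemma Gt_lip_deriv:
  assumes K: "compact K" "K \<subseteq> X" and t: "t < horizon M"
  shows "\<exists>L F'. 0 \<le> L \<and> lip_deriv S K L (\<lambda>\<theta>. Gt M t (snd \<theta> $ j) $ i) F'"
proof -
  have Kj: "compact ((\<lambda>\<theta>. snd \<theta> $ j) ` K)"
    by (intro compact_continuous_image K bounded_linear.continuous_on[OF bounded_linear_beta] continuous_on_id)
  have "(\<lambda>\<theta>. snd \<theta> $ j) ` K \<subseteq> beta_dom M" using X_beta_dom K(2) by blast
  moreover have "smooth_on_compacts UNIV (beta_dom M) (\<lambda>b. Gt M t b $ i)"
    using smooth t by (auto simp: assumption_smooth_def)
  ultimately obtain L where L: "0 \<le> L" "lip_deriv UNIV ((\<lambda>\<theta>. snd \<theta> $ j) ` K) L (\<lambda>b. Gt M t b $ i)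
      (\<lambda>x h. gradient UNIV (\<lambda>b. Gt M t b $ i) x \<bullet> h)"
    using smooth_on_compacts_lip_deriv[OF _ subspace_UNIV _ Kj] by (metis subset_UNIV)
  have "norm (snd h $ j) \<le> 1 * norm h" for h :: "('nz, 'd, 'b) param"
    using order_trans[OF Finite_Cartesian_Product.norm_nth_le norm_snd_le[of "snd h" "fst h"]] by simp
  then have "lip_deriv S K (L * 1 * 1) (\<lambda>\<theta>. Gt M t (snd \<theta> $ j) $ i)
      (\<lambda>x h. gradient UNIV (\<lambda>b. Gt M t b $ i) (snd x $ j) \<bullet> (snd h $ j))"
    by (intro lip_deriv_compose_linear[OF L(2) bounded_linear_beta] L(1)) auto
  then show ?thesis using L(1) by (metis mult.right_neutral)
qed

lemma R_lip_deriv: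
  assumes K: "compact K" "convex K" "K \<subseteq> X"
  shows "\<exists>L\<ge>0. lip_deriv S K L R (\<lambda>x h. gradient S R x \<bullet> h)"
proof -
  consider H where "C2_on S X R H" | "smooth_on_compacts S X R"
    using smooth unfolding assumption_smooth_def by blast
  then show ?thesis
  proof cases
    case 1
    show ?thesis using C2_on_lip_deriv[OF 1 subspace_param_space X_subset_S K] by blast
  next
    case 2
    show ?thesis using smooth_on_compacts_lip_deriv[OF 2 subspace_param_space X_subset_S K(1,3)] by blast
  qed
qed

text \<open>
  Posterior probabilities are at most \<open>1\<close> and weights at most \<open>u\<close>, so the constant does not depend on
  the base point \<open>x\<close>.
\<close>

lemma Sur_lip_deriv:
  assumes K: "compact K" "convex K" "K \<subseteq> X"
  shows "\<exists>L\<ge>0. \<forall>x\<in>K. \<exists>F'. lip_deriv S K L (Sur x) F'"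
proof -
  obtain u where u: "0 < u" "\<And>x t j i. x \<in> X \<Longrightarrow> \<bar>weight x t j $ i\<bar> \<le> u" using weight_bound by blast
  obtain LR where LR: "0 \<le> LR" "lip_deriv S K LR R (\<lambda>x h. gradient S R x \<bullet> h)" using R_lip_deriv[OF K] by blast
  have "\<exists>L F'. 0 \<le> L \<and> lip_deriv S K L (\<lambda>\<theta>. Psi M \<xi> (fst \<theta>)) F'" for \<xi>
    using Psi_lip_deriv[of K \<xi>] by blast
  then obtain LP FP where LP: "\<And>\<xi>. 0 \<le> LP \<xi>" "\<And>\<xi>. lip_deriv S K (LP \<xi>) (\<lambda>\<theta>. Psi M \<xi> (fst \<theta>)) (FP \<xi>)"
    by metis
  have "\<exists>L F'. t < horizon M \<longrightarrow> 0 \<le> L \<and> lip_deriv S K L (\<lambda>\<theta>. Gt M t (snd \<theta> $ j) $ i) F'" for t j i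
    using Gt_lip_deriv[OF K(1,3)] by blast
  then obtain LG FG where LG: "\<And>t j i. t < horizon M \<Longrightarrow> 0 \<le> LG t j i"
    "\<And>t j i. t < horizon M \<Longrightarrow> lip_deriv S K (LG t j i) (\<lambda>\<theta>. Gt M t (snd \<theta> $ j) $ i) (FG t j i)"
    by metis
  define LH where "LH \<xi> = (\<Sum>t<horizon M. 0 + (\<Sum>i\<in>UNIV. u * LG t (\<xi> (t + 1)) i))" for \<xi> :: "nat \<Rightarrow> 'd"
  have LH: "0 \<le> LH \<xi>" for \<xi> unfolding LH_def using u(1) LG(1) by (auto intro!: sum_nonneg)
  define L where "L = (\<Sum>\<xi>\<in>paths M. 1 * LP \<xi>) + (\<Sum>\<xi>\<in>paths M. 1 * LH \<xi>) + LR"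
  have "0 \<le> L" unfolding L_def using LP LH LR by (auto intro!: add_nonneg_nonneg sum_nonneg)
  moreover have "\<exists>F'. lip_deriv S K L (Sur x) F'" if x: "x \<in> K" for x
  proof -
    have xX: "x \<in> X" using x K by blast
    have post: "\<bar>posterior M x \<xi>\<bar> \<le> 1" if "\<xi> \<in> paths M" for \<xi>
      using posterior_le_1[OF that, of x] posterior_pos[of x \<xi>] by simp
    have "lip_deriv S K (LH \<xi>) (\<lambda>\<theta>. Phi_hat M (snd x) \<xi> (snd \<theta>))
      (\<lambda>y h. \<Sum>t<horizon M. 0 + (\<Sum>i\<in>UNIV. weight x t (\<xi> (t + 1)) $ i * FG t (\<xi> (t + 1)) i y h))" for \<xi>
      unfolding LH_def Phi_hat_eq
      by (intro lip_deriv_sum lip_deriv_add lip_deriv_const lip_deriv_scale LG u(2) xX finite_lessThan finite) auto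
    then have "lip_deriv S K L
        (\<lambda>\<theta>. (\<Sum>\<xi>\<in>paths M. posterior M x \<xi> * Psi M \<xi> (fst \<theta>)) +
             (\<Sum>\<xi>\<in>paths M. posterior M x \<xi> * Phi_hat M (snd x) \<xi> (snd \<theta>)) + R \<theta>)
        (\<lambda>y h. (\<Sum>\<xi>\<in>paths M. posterior M x \<xi> * FP \<xi> y h) +
             (\<Sum>\<xi>\<in>paths M. posterior M x \<xi> * (\<Sum>t<horizon M. 0 + (\<Sum>i\<in>UNIV. weight x t (\<xi> (t + 1)) $ i * FG t (\<xi> (t + 1)) i y h))) + gradient S R y \<bullet> h)"
      unfolding L_def
      by (intro lip_deriv_add lip_deriv_sum lip_deriv_scale LP LH LR(2) post finite_paths)
    then show ?thesis unfolding Sur_def[abs_def] Q1_def Q2_def by blast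
  qed
  ultimately show ?thesis by blast
qed

text \<open>
  \<open>Gt M t b $ i = g i (affine_part i t b)\<close>, and \<open>Jac M A i t\<close> is the linear part.
\<close>

definition "affine_part i t = A i (obs M (int t + 1)) (zt M t)"

lemma midpoint_mem: "convex C \<Longrightarrow> a \<in> C \<Longrightarrow> b \<in> C \<Longrightarrow> midpoint a b \<in> C"
  using convexD[of C a b "1/2" "1/2"] by (simp add: midpoint_def scaleR_add_right)

lemma affine_part:
  obtains l c where "linear l" "affine_part i t = (\<lambda>b. l b + c)" "Jac M A i t = l"
proof -
  have "affine_map (affine_part i t)" using obs by (auto simp: assumption_obs_def affine_part_def)
  then obtain l c where l: "linear l" "\<And>b. affine_part i t b = l b + c" by (auto simp: affine_map_def)
  have "bounded_linear l" using l(1) linear_conv_bounded_linear by blast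
  then have d: "((\<lambda>b. l b + c) has_derivative l) (at 0)"
    by (auto intro!: derivative_eq_intros bounded_linear_imp_has_derivative)
  have eq: "affine_part i t = (\<lambda>b. l b + c)" using l(2) by (rule ext)
  have "Jac M A i t = l"
    unfolding Jac_def affine_part_def[symmetric] eq by (rule frechet_derivative_at[OF d, symmetric])
  with l(1) eq show ?thesis by (rule that)
qed

lemma Gt_midgap_eq:
  assumes b: "b \<in> beta_dom M" "b' \<in> beta_dom M"
  shows "midgap (\<lambda>b. Gt M t b $ i) b b' = midgap (g i) (affine_part i t b) (affine_part i t b')"
proof -
  obtain l c where l: "linear l" "affine_part i t = (\<lambda>b. l b + c)" using affine_part by blast
  have Gt: "Gt M t b $ i = g i (affine_part i t b)" if "b \<in> beta_dom M" for b
    using obs that by (auto simp: assumption_obs_def affine_part_def Gt_def)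
  have "midpoint b b' \<in> beta_dom M" by (rule midpoint_mem[OF beta_dom(2) b])
  then show ?thesis
    unfolding midgap_def using Gt b l(2) by (simp add: midpoint_affine[OF l(1)])
qed

lemma affine_part_mem: "b \<in> beta_dom M \<Longrightarrow> affine_part i t b \<in> D i"
  using obs unfolding assumption_obs_def affine_part_def by blast

lemma Gt_midgap_nonneg:
  assumes "b \<in> beta_dom M" "b' \<in> beta_dom M"
  shows "0 \<le> midgap (\<lambda>b. Gt M t b $ i) b b'"
  unfolding Gt_midgap_eq[OF assms]
  by (rule midgap_nonneg[where X = "D i"])
     (use obs assms in \<open>auto simp: assumption_obs_def intro: affine_part_mem\<close>)

lemma R_midgap_nonneg:
  assumes "y \<in> X" "z \<in> X"
  shows "0 \<le> midgap R y z"
proof -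
  have R: "R \<theta> = R1 (fst \<theta>) + R2 (snd \<theta>)" if "\<theta> \<in> X" for \<theta> using reg that by (simp add: assumption_reg_def)
  have "midpoint y z \<in> X" by (rule midpoint_mem[OF convex_X assms])
  moreover have "fst (midpoint y z) = midpoint (fst y) (fst z)" "snd (midpoint y z) = midpoint (snd y) (snd z)"
    by (simp_all add: midpoint_def)
  ultimately have "midgap R y z = midgap R1 (fst y) (fst z) + midgap R2 (snd y) (snd z)"
    using assms by (simp add: midgap_def R field_simps)
  moreover have "0 \<le> midgap R1 (fst y) (fst z)"
    by (rule midgap_nonneg[where X = Theta_space]) (use reg assms in \<open>auto simp: assumption_reg_def X_iff\<close>)
  moreover have "0 \<le> midgap R2 (snd y) (snd z)"
    by (rule midgap_nonneg[where X = "betas M"]) (use reg assms in \<open>auto simp: assumption_reg_def X_iff\<close>)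
  ultimately show ?thesis by simp
qed

definition "gap_trans \<xi> y z = (\<Sum>t<horizon M. midgap lse (score (\<xi> t) t y) (score (\<xi> t) t z))"

definition "gap_obs x \<xi> y z = (\<Sum>t<horizon M. \<Sum>i\<in>UNIV. weight x t (\<xi> (t + 1)) $ i *
    midgap (\<lambda>b. Gt M t b $ i) (snd y $ \<xi> (t + 1)) (snd z $ \<xi> (t + 1)))"

lemma Sur_midgap:
  "midgap (Sur x) y z = (\<Sum>\<xi>\<in>paths M. posterior M x \<xi> * gap_trans \<xi> y z) +
     (\<Sum>\<xi>\<in>paths M. posterior M x \<xi> * gap_obs x \<xi> y z) + midgap R y z"
proof -
  have 1: "midgap (\<lambda>\<theta>. cross_entropy j (score i t \<theta>)) y z = midgap lse (score i t y) (score i t z)" for i j t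
    using midgap_linear[OF linear_score, of "cross_entropy j"] by (simp add: midgap_cross_entropy)
  have 2: "midgap (\<lambda>\<theta>. Gt M t (snd \<theta> $ j) $ i) y z = midgap (\<lambda>b. Gt M t b $ i) (snd y $ j) (snd z $ j)" for i j t
    using midgap_linear[OF bounded_linear.linear[OF bounded_linear_beta], of "\<lambda>b. Gt M t b $ i"] by simp
  show ?thesis
    unfolding Sur_def[abs_def] Q1_def Q2_def Psi_eq Phi_hat_eq gap_trans_def gap_obs_def
    by (simp only: midgap_add midgap_sum midgap_scale midgap_const 1 2 add_0)
qed

lemma gap_trans_nonneg: "0 \<le> gap_trans \<xi> y z"
  unfolding gap_trans_def by (intro sum_nonneg midgap_lse_nonneg)

lemma gap_obs_nonneg: "x \<in> X \<Longrightarrow> y \<in> X \<Longrightarrow> z \<in> X \<Longrightarrow> 0 \<le> gap_obs x \<xi> y z"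
  unfolding gap_obs_def
  by (intro sum_nonneg mult_nonneg_nonneg Gt_midgap_nonneg X_beta_dom less_imp_le[OF weight_pos])

text \<open>
  These sequences are distinct for distinct modes, so a sum of nonnegative terms over all mode
  sequences dominates the sum over the modes. Restricted to them, the surrogate decouples over the modes.
\<close>

definition constant_path :: "'d \<Rightarrow> nat \<Rightarrow> 'd" where
  "constant_path i = (\<lambda>t\<in>{0..horizon M}. i)"

lemma sum_constant_paths_le:
  assumes "\<And>\<xi>. 0 \<le> q \<xi>"
  shows "(\<Sum>i\<in>UNIV. q (constant_path i)) \<le> (\<Sum>\<xi>\<in>paths M. q \<xi> :: real)"
proof -
  have "inj constant_path"
    by (rule injI) (metis atLeastAtMost_iff constant_path_def le0 restrict_apply')
  then have "(\<Sum>i\<in>UNIV. q (constant_path i)) = sum q (range constant_path)"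
    by (simp add: sum.reindex)
  also have "\<dots> \<le> (\<Sum>\<xi>\<in>paths M. q \<xi>)"
    by (rule sum_mono2) (use finite_paths assms in \<open>auto simp: constant_path_def paths_def\<close>)
  finally show ?thesis .
qed

text \<open>
  For the mode \<open>i\<close>, strong convexity of log-sum-exp bounds the gap by the sum over \<open>t\<close> of the squared
  norms of the score differences. Column by column these are the values of the quadratic form of
  the Gram operator of the \<open>z\<^sub>t\<close>.
\<close>

lemma gap_trans_strong:
  assumes K: "compact K" "K \<subseteq> X"
    and pos: "pos_def UNIV (\<lambda>h. \<Sum>t<horizon M. (zt M t \<bullet> h) *\<^sub>R zt M t)"
  obtains c where "0 < c" "\<And>y z. y \<in> K \<Longrightarrow> z \<in> K \<Longrightarrow>
    c * (norm (fst y - fst z))^2 \<le> (\<Sum>i\<in>UNIV. gap_trans (constant_path i) y z)"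
proof -
  have "compact (\<Union>i. \<Union>t\<in>{..<horizon M}. score i t ` K)"
    by (intro compact_UN finite finite_lessThan compact_continuous_image K
        bounded_linear.continuous_on[OF bounded_linear_score] continuous_on_id)
  then obtain b where "\<forall>v\<in>(\<Union>i. \<Union>t\<in>{..<horizon M}. score i t ` K). norm v \<le> b"
    using compact_imp_bounded bounded_iff by metis
  then have b: "\<bar>score i t y $ j\<bar> \<le> b" if "t < horizon M" "y \<in> K" for i t j y
    using that component_le_norm_cart[of "score i t y" j] by (force intro: order_trans)
  define c where "c = exp (- b) / 4 / (2 * (real CARD('d) * exp b)^2)"
  have c: "0 < c" by (simp add: c_def)
  have "linear (\<lambda>h. \<Sum>t<horizon M. (zt M t \<bullet> h) *\<^sub>R zt M t)"
    by (intro linear_compose_sum ballI linearI) (auto simp: inner_add_right scaleR_add_left)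
  then obtain l where l: "0 < l" "\<And>h. l * (norm h)^2 \<le> h \<bullet> (\<Sum>t<horizon M. (zt M t \<bullet> h) *\<^sub>R zt M t)"
    using pos_def_coercive[OF _ pos] by blast
  have l': "l * (norm h)^2 \<le> (\<Sum>t<horizon M. (h \<bullet> zt M t)^2)" for h
    using l(2)[of h] by (simp add: inner_sum_right power2_eq_square inner_commute)
  show ?thesis
  proof (rule that[of "c * l"])
    show "0 < c * l" using c l by simp
    fix y z assume yz: "y \<in> K" "z \<in> K"
    have last: "score i t y $ Max UNIV = 0" "score i t z $ Max UNIV = 0" for i t
      using yz K(2) X_subset_S by (blast intro: score_last)+
    have row: "l * (norm (fst y $ i - fst z $ i))^2 \<le> (\<Sum>t<horizon M. (norm (score i t y - score i t z))^2)" for i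
    proof -
      have "l * (norm (fst y $ i - fst z $ i))^2 = (\<Sum>j\<in>UNIV. l * (norm (column j (fst y $ i - fst z $ i)))^2)"
        by (simp add: norm_matrix_columns sum_distrib_left)
      also have "\<dots> \<le> (\<Sum>j\<in>UNIV. \<Sum>t<horizon M. (column j (fst y $ i - fst z $ i) \<bullet> zt M t)^2)"
        by (intro sum_mono l')
      also have "\<dots> = (\<Sum>t<horizon M. \<Sum>j\<in>UNIV. (column j (fst y $ i - fst z $ i) \<bullet> zt M t)^2)"
        by (rule sum.swap)
      also have "\<dots> = (\<Sum>t<horizon M. (norm (score i t y - score i t z))^2)"
      proof -
        have "column j (fst y $ i - fst z $ i) \<bullet> zt M t = (score i t y - score i t z) $ j" for j t
          by (simp add: score_nth inner_vec_def column_def left_diff_distrib sum_subtractf)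
        then show ?thesis by (simp add: norm_vec_power2)
      qed
      finally show ?thesis .
    qed
    have "c * l * (norm (fst y - fst z))^2 = (\<Sum>i\<in>UNIV. c * (l * (norm (fst y $ i - fst z $ i))^2))"
      by (simp add: norm_vec_power2[of "fst y - fst z"] sum_distrib_left mult.assoc)
    also have "\<dots> \<le> (\<Sum>i\<in>UNIV. c * (\<Sum>t<horizon M. (norm (score i t y - score i t z))^2))"
      using c by (intro sum_mono mult_left_mono row) auto
    also have "\<dots> \<le> (\<Sum>i\<in>UNIV. gap_trans (constant_path i) y z)"
      unfolding gap_trans_def sum_distrib_left
    proof (intro sum_mono)
      fix i t assume t: "t \<in> {..<horizon M}"
      then have "constant_path i t = i" by (simp add: constant_path_def)
      then show "c * (norm (score i t y - score i t z))^2 \<le>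
          midgap lse (score (constant_path i t) t y) (score (constant_path i t) t z)"
        unfolding c_def using t b yz last by (simp only:) (rule midgap_lse_strong[OF _ _ last], auto)
    qed
    finally show "c * l * (norm (fst y - fst z))^2 \<le> (\<Sum>i\<in>UNIV. gap_trans (constant_path i) y z)" .
  qed
qed

text \<open>
  One compact convex subset of the domain of \<open>\<beta>\<close> that contains all components of all parameters in \<open>K\<close>.
\<close>

definition beta_hull :: "('nz, 'd, 'b) param set \<Rightarrow> 'b set" where
  "beta_hull K = convex hull (\<Union>j. (\<lambda>\<theta>. snd \<theta> $ j) ` K)"

lemma beta_hull:
  assumes K: "compact K" "K \<subseteq> X"
  shows "compact (beta_hull K)" "convex (beta_hull K)" "beta_hull K \<subseteq> beta_dom M"
    and "\<theta> \<in> K \<Longrightarrow> snd \<theta> $ j \<in> beta_hull K"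
proof -
  show "compact (beta_hull K)" unfolding beta_hull_def
    by (intro compact_convex_hull compact_UN finite compact_continuous_image K
        bounded_linear.continuous_on[OF bounded_linear_beta] continuous_on_id)
  show "convex (beta_hull K)" by (simp add: beta_hull_def)
  show "beta_hull K \<subseteq> beta_dom M" unfolding beta_hull_def
    by (rule hull_minimal) (use K(2) X_beta_dom beta_dom(2) in blast)+
  show "\<theta> \<in> K \<Longrightarrow> snd \<theta> $ j \<in> beta_hull K" unfolding beta_hull_def by (rule hull_inc) blast
qed

lemma weight_lower:
  assumes K: "compact K" "K \<subseteq> X"
  obtains w where "0 < w" "\<And>x t j i. x \<in> K \<Longrightarrow> t < horizon M \<Longrightarrow> w \<le> weight x t j $ i"
proof -
  let ?q = "\<lambda>t i b. gradient UNIV (obs_fun M) (Gt M t b) $ i"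
  have ex: "\<exists>w>0. \<forall>b\<in>beta_hull K. w \<le> ?q t i b" if t: "t < horizon M" for t i
  proof (cases "beta_hull K = {}")
    case True
    then show ?thesis by (intro exI[of _ 1]) simp
  next
    case False
    have "continuous_on (beta_dom M) (Gt M t)"
      using Gt_differentiable[OF t] differentiable_imp_continuous_within
      by (metis continuous_at_imp_continuous_on)
    moreover have "continuous_on (obs_dom M) (gradient UNIV (obs_fun M))"
      using obs by (auto simp: assumption_obs_def C1_on_def)
    ultimately have "continuous_on (beta_dom M) (\<lambda>b. gradient UNIV (obs_fun M) (Gt M t b))"
      using Gt_obs_dom by (blast intro: continuous_on_compose2)
    then have "continuous_on (beta_hull K) (?q t i)"
      by (intro bounded_linear.continuous_on[OF bounded_linear_vec_nth]) (rule continuous_on_subset[OF _ beta_hull(3)[OF K]])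
    from continuous_attains_inf[OF beta_hull(1)[OF K] False this]
    obtain b where b: "b \<in> beta_hull K" "\<forall>b'\<in>beta_hull K. ?q t i b \<le> ?q t i b'" by blast
    have "0 < ?q t i b" using obs Gt_obs_dom b(1) beta_hull(3)[OF K] unfolding assumption_obs_def by blast
    then show ?thesis using b(2) by blast
  qed
  obtain w where w: "0 < w" "\<And>p. p \<in> {..<horizon M} \<times> UNIV \<Longrightarrow> \<forall>b\<in>beta_hull K. w \<le> ?q (fst p) (snd p) b"
  proof (rule finite_common_pos[of "{..<horizon M} \<times> (UNIV :: 'ng set)" "\<lambda>p w. \<forall>b\<in>beta_hull K. w \<le> ?q (fst p) (snd p) b"])
    show "\<exists>c>0. \<forall>b\<in>beta_hull K. c \<le> ?q (fst p) (snd p) b" if "p \<in> {..<horizon M} \<times> UNIV" for p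
      using ex[of "fst p" "snd p"] that by auto
  qed (auto intro: order_trans)
  have "w \<le> weight x t j $ i" if "x \<in> K" "t < horizon M" for x t j i
    using w(2)[of "(t, i)"] that beta_hull(4)[OF K that(1)] by (simp add: weight_def)
  then show ?thesis using that w(1) by blast
qed

text \<open>
  For \<open>i \<in> I\<close> the gap of \<open>g i\<close> at the images under the affine part is at least a multiple of
  \<open>(norm (Jac M A i t h))\<^sup>2\<close> with \<open>h\<close> the difference of the components; summed over \<open>t\<close> and \<open>i\<close> these are
  the values of the quadratic form of the Gram operator of the Jacobians. The other summands are nonnegative.
\<close>

lemma gap_obs_strong:
  assumes K: "compact K" "K \<subseteq> X"
    and C2: "\<And>i. i \<in> I \<Longrightarrow> \<exists>H. C2_on (V i) (D i) (g i) H \<and> (\<forall>u\<in>D i. pos_def (V i) (H u))"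
    and pos: "pos_def UNIV (\<lambda>h. \<Sum>t<horizon M. \<Sum>i\<in>I. adjoint (Jac M A i t) (Jac M A i t h))"
  obtains c where "0 < c" "\<And>x y z. x \<in> K \<Longrightarrow> y \<in> K \<Longrightarrow> z \<in> K \<Longrightarrow>
    c * (norm (snd y - snd z))^2 \<le> (\<Sum>j\<in>UNIV. gap_obs x (constant_path j) y z)"
proof -
  have linJ: "linear (Jac M A i t)" for i t by (metis affine_part)
  have ex: "\<exists>a>0. \<forall>b\<in>beta_hull K. \<forall>b'\<in>beta_hull K. a * (norm (Jac M A i t (b - b')))^2 \<le> midgap (\<lambda>b. Gt M t b $ i) b b'"
    if i: "i \<in> I" for i t
  proof -
    obtain l c where l: "linear l" "affine_part i t = (\<lambda>b. l b + c)" "Jac M A i t = l" using affine_part by blast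
    have bl: "bounded_linear l" using l(1) linear_conv_bounded_linear by blast
    obtain H where H: "C2_on (V i) (D i) (g i) H" "\<And>u. u \<in> D i \<Longrightarrow> pos_def (V i) (H u)" using C2[OF i] by blast
    have VD: "subspace (V i)" "D i \<subseteq> V i" using obs by (auto simp: assumption_obs_def)
    let ?C = "affine_part i t ` beta_hull K"
    have "compact ?C" unfolding l(2)
      by (intro compact_continuous_image beta_hull(1)[OF K] continuous_intros bounded_linear.continuous_on[OF bl])
    moreover have "convex ?C"
    proof -
      have "?C = (\<lambda>v. c + v) ` (l ` beta_hull K)" unfolding l(2) by (auto simp: image_image add.commute)
      then show ?thesis by (simp add: convex_translation convex_linear_image l(1) beta_hull(2)[OF K])
    qed
    moreover have "?C \<subseteq> D i" using affine_part_mem beta_hull(3)[OF K] by blast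
    ultimately obtain a where a: "0 < a" "\<And>u v. u \<in> ?C \<Longrightarrow> v \<in> ?C \<Longrightarrow> a * (norm (u - v))^2 \<le> midgap (g i) u v"
      using C2_on_pos_def_midgap[OF H(1) VD] H(2) by metis
    have "a * (norm (Jac M A i t (b - b')))^2 \<le> midgap (\<lambda>b. Gt M t b $ i) b b'"
      if b: "b \<in> beta_hull K" "b' \<in> beta_hull K" for b b'
    proof -
      have "a * (norm (affine_part i t b - affine_part i t b'))^2 \<le> midgap (g i) (affine_part i t b) (affine_part i t b')"
        by (rule a(2)) (use b in auto)
      moreover have "affine_part i t b - affine_part i t b' = Jac M A i t (b - b')"
        unfolding l(2,3) by (simp add: linear_diff[OF l(1)])
      ultimately show ?thesis using Gt_midgap_eq b beta_hull(3)[OF K] by (metis subsetD)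
    qed
    then show ?thesis using a(1) by blast
  qed
  obtain a where a: "0 < a" "\<And>p. p \<in> {..<horizon M} \<times> I \<Longrightarrow> \<forall>b\<in>beta_hull K. \<forall>b'\<in>beta_hull K.
      a * (norm (Jac M A (snd p) (fst p) (b - b')))^2 \<le> midgap (\<lambda>b. Gt M (fst p) b $ (snd p)) b b'"
  proof (rule finite_common_pos[of "{..<horizon M} \<times> I" "\<lambda>p a. \<forall>b\<in>beta_hull K. \<forall>b'\<in>beta_hull K.
      a * (norm (Jac M A (snd p) (fst p) (b - b')))^2 \<le> midgap (\<lambda>b. Gt M (fst p) b $ (snd p)) b b'"])
    show "finite ({..<horizon M} \<times> I)" by simp
  next
    fix p assume "p \<in> {..<horizon M} \<times> I"
    then show "\<exists>a>0. \<forall>b\<in>beta_hull K. \<forall>b'\<in>beta_hull K.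
      a * (norm (Jac M A (snd p) (fst p) (b - b')))^2 \<le> midgap (\<lambda>b. Gt M (fst p) b $ (snd p)) b b'"
      by (intro ex) auto
  next
    fix p and a a' :: real
    assume "\<forall>b\<in>beta_hull K. \<forall>b'\<in>beta_hull K.
      a * (norm (Jac M A (snd p) (fst p) (b - b')))^2 \<le> midgap (\<lambda>b. Gt M (fst p) b $ (snd p)) b b'" "a' \<le> a"
    then show "\<forall>b\<in>beta_hull K. \<forall>b'\<in>beta_hull K.
      a' * (norm (Jac M A (snd p) (fst p) (b - b')))^2 \<le> midgap (\<lambda>b. Gt M (fst p) b $ (snd p)) b b'"
      by (meson mult_right_mono order_trans zero_le_power2)
  qed blast
  obtain w where w: "0 < w" "\<And>x t j i. x \<in> K \<Longrightarrow> t < horizon M \<Longrightarrow> w \<le> weight x t j $ i"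
    using weight_lower[OF K] by blast
  have "linear (\<lambda>h. \<Sum>t<horizon M. \<Sum>i\<in>I. adjoint (Jac M A i t) (Jac M A i t h))"
    by (intro linear_compose_sum ballI linear_compose[OF linJ adjoint_linear[OF linJ], unfolded comp_def])
  then obtain l where l: "0 < l" "\<And>h. l * (norm h)^2 \<le> h \<bullet> (\<Sum>t<horizon M. \<Sum>i\<in>I. adjoint (Jac M A i t) (Jac M A i t h))"
    using pos_def_coercive[OF _ pos] by blast
  have l': "l * (norm h)^2 \<le> (\<Sum>t<horizon M. \<Sum>i\<in>I. (norm (Jac M A i t h))^2)" for h
    using l(2)[of h] by (simp add: inner_sum_right adjoint_works[OF linJ] power2_norm_eq_inner)
  show ?thesis
  proof (rule that[of "w * a * l"])
    show "0 < w * a * l" using w a l by simp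
    fix x y z assume x: "x \<in> K" and yz: "y \<in> K" "z \<in> K"
    have "w * a * l * (norm (snd y - snd z))^2 = (\<Sum>j\<in>UNIV. w * a * (l * (norm (snd y $ j - snd z $ j))^2))"
      by (simp add: norm_vec_power2[of "snd y - snd z"] sum_distrib_left mult.assoc)
    also have "\<dots> \<le> (\<Sum>j\<in>UNIV. w * a * (\<Sum>t<horizon M. \<Sum>i\<in>I. (norm (Jac M A i t (snd y $ j - snd z $ j)))^2))"
      using w a by (intro sum_mono mult_left_mono l') auto
    also have "\<dots> \<le> (\<Sum>j\<in>UNIV. gap_obs x (constant_path j) y z)"
      unfolding gap_obs_def sum_distrib_left
    proof (intro sum_mono)
      fix j t assume t: "t \<in> {..<horizon M}"
      then have cp: "constant_path j (t + 1) = j" by (simp add: constant_path_def)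
      let ?gap = "\<lambda>i. midgap (\<lambda>b. Gt M t b $ i) (snd y $ j) (snd z $ j)"
      have dom: "snd y $ j \<in> beta_dom M" "snd z $ j \<in> beta_dom M" using yz K(2) by (auto intro: X_beta_dom)
      have "(\<Sum>i\<in>I. w * a * (norm (Jac M A i t (snd y $ j - snd z $ j)))^2) \<le> (\<Sum>i\<in>I. weight x t j $ i * ?gap i)"
      proof (rule sum_mono)
        fix i assume i: "i \<in> I"
        have "w * (a * (norm (Jac M A i t (snd y $ j - snd z $ j)))^2) \<le> weight x t j $ i * ?gap i"
        proof (rule mult_mono)
          show "w \<le> weight x t j $ i" using w(2)[OF x] t by simp
          then show "0 \<le> weight x t j $ i" using w(1) by linarith
          show "a * (norm (Jac M A i t (snd y $ j - snd z $ j)))^2 \<le> ?gap i"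
            using a(2)[of "(t, i)"] i t beta_hull(4)[OF K yz(1)] beta_hull(4)[OF K yz(2)] by simp
          show "0 \<le> a * (norm (Jac M A i t (snd y $ j - snd z $ j)))^2" using a(1) by simp
        qed
        then show "w * a * (norm (Jac M A i t (snd y $ j - snd z $ j)))^2 \<le> weight x t j $ i * ?gap i"
          by (simp add: mult.assoc)
      qed
      also have "\<dots> \<le> (\<Sum>i\<in>UNIV. weight x t j $ i * ?gap i)"
        using x K(2) by (intro sum_mono2) (auto intro!: mult_nonneg_nonneg Gt_midgap_nonneg[OF dom] less_imp_le[OF weight_pos])
      finally show "(\<Sum>i\<in>I. w * a * (norm (Jac M A i t (snd y $ j - snd z $ j)))^2) \<le>
          (\<Sum>i\<in>UNIV. weight x t (constant_path j (t + 1)) $ i *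
            midgap (\<lambda>b. Gt M t b $ i) (snd y $ constant_path j (t + 1)) (snd z $ constant_path j (t + 1)))"
        unfolding cp .
    qed
    finally show "w * a * l * (norm (snd y - snd z))^2 \<le> (\<Sum>j\<in>UNIV. gap_obs x (constant_path j) y z)" .
  qed
qed

lemma posterior_lower:
  assumes K: "compact K" "K \<subseteq> X"
  obtains p where "0 < p" "\<And>x \<xi>. x \<in> K \<Longrightarrow> \<xi> \<in> paths M \<Longrightarrow> p \<le> posterior M x \<xi>"
proof -
  have cont: "continuous_on K (\<lambda>x. joint M x \<xi>)" for \<xi>
    unfolding continuous_on_eq_continuous_within
  proof
    fix x assume "x \<in> K"
    then have "x \<in> X" using K by blast
    then have "continuous (at x within S) (\<lambda>x. joint M x \<xi>)"
      by (intro differentiable_imp_continuous_within joint_differentiable)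
    then show "continuous (at x within K) (\<lambda>x. joint M x \<xi>)"
      by (rule continuous_within_subset) (use K X_subset_S in blast)
  qed
  have post: "continuous_on K (\<lambda>x. posterior M x \<xi>)" for \<xi>
    unfolding posterior_def by (intro continuous_intros cont) (use sum_joint_pos in \<open>auto simp: less_le\<close>)
  have ex: "\<exists>p>0. \<forall>x\<in>K. p \<le> posterior M x \<xi>" for \<xi>
  proof (cases "K = {}")
    case True
    then show ?thesis by (intro exI[of _ 1]) simp
  next
    case False
    then show ?thesis using continuous_attains_inf[OF K(1) False post] posterior_pos by blast
  qed
  show ?thesis
    by (rule finite_common_pos[OF finite_paths(1), of "\<lambda>\<xi> p. \<forall>x\<in>K. p \<le> posterior M x \<xi>"])
       (use ex that in \<open>auto intro: order_trans\<close>)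
qed

lemma Sur_strong:
  assumes K: "compact K" "convex K" "K \<subseteq> X"
  shows "\<exists>a>0. \<forall>x\<in>K. \<forall>y\<in>K. \<forall>z\<in>K. a * (norm (y - z))^2 \<le> midgap (Sur x) y z"
proof -
  have Q1: "0 \<le> (\<Sum>\<xi>\<in>paths M. posterior M x \<xi> * gap_trans \<xi> y z)" for x y z
    by (intro sum_nonneg mult_nonneg_nonneg gap_trans_nonneg less_imp_le[OF posterior_pos])
  have Q2: "0 \<le> (\<Sum>\<xi>\<in>paths M. posterior M x \<xi> * gap_obs x \<xi> y z)" if "x \<in> K" "y \<in> K" "z \<in> K" for x y z
    using that K(3) by (intro sum_nonneg mult_nonneg_nonneg gap_obs_nonneg less_imp_le[OF posterior_pos]) auto
  consider H where "C2_on S X R H" "\<And>\<theta>. \<theta> \<in> X \<Longrightarrow> pos_def S (H \<theta>)"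
    | I where "\<And>i. i \<in> I \<Longrightarrow> \<exists>H. C2_on (V i) (D i) (g i) H \<and> (\<forall>u\<in>D i. pos_def (V i) (H u))"
      "pos_def UNIV (\<lambda>h. \<Sum>t<horizon M. (zt M t \<bullet> h) *\<^sub>R zt M t)"
      "pos_def UNIV (\<lambda>h. \<Sum>t<horizon M. \<Sum>i\<in>I. adjoint (Jac M A i t) (Jac M A i t h))"
    using smooth unfolding assumption_smooth_def by blast
  then show ?thesis
  proof cases
    case (1 H)
    obtain a where a: "0 < a" "\<And>y z. y \<in> K \<Longrightarrow> z \<in> K \<Longrightarrow> a * (norm (y - z))^2 \<le> midgap R y z"
      using C2_on_pos_def_midgap[OF 1(1) subspace_param_space X_subset_S K 1(2)] by blast
    have "a * (norm (y - z))^2 \<le> midgap (Sur x) y z" if "x \<in> K" "y \<in> K" "z \<in> K" for x y z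
      using a(2)[OF that(2,3)] Q1[of x y z] Q2[OF that] unfolding Sur_midgap by linarith
    then show ?thesis using a(1) by blast
  next
    case (2 I)
    obtain c1 where c1: "0 < c1" "\<And>y z. y \<in> K \<Longrightarrow> z \<in> K \<Longrightarrow>
      c1 * (norm (fst y - fst z))^2 \<le> (\<Sum>i\<in>UNIV. gap_trans (constant_path i) y z)"
      using gap_trans_strong[OF K(1,3) 2(2)] by blast
    obtain c2 where c2: "0 < c2" "\<And>x y z. x \<in> K \<Longrightarrow> y \<in> K \<Longrightarrow> z \<in> K \<Longrightarrow>
      c2 * (norm (snd y - snd z))^2 \<le> (\<Sum>j\<in>UNIV. gap_obs x (constant_path j) y z)"
      using gap_obs_strong[OF K(1,3) 2(1) 2(3)] by blast
    obtain p where p: "0 < p" "\<And>x \<xi>. x \<in> K \<Longrightarrow> \<xi> \<in> paths M \<Longrightarrow> p \<le> posterior M x \<xi>"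
      using posterior_lower[OF K(1,3)] by blast
    have weighted: "p * (\<Sum>i\<in>UNIV. q (constant_path i)) \<le> (\<Sum>\<xi>\<in>paths M. posterior M x \<xi> * q \<xi>)"
      if "x \<in> K" "\<And>\<xi>. 0 \<le> q \<xi>" for x q
    proof -
      have "p * (\<Sum>i\<in>UNIV. q (constant_path i)) \<le> p * (\<Sum>\<xi>\<in>paths M. q \<xi>)"
        using p(1) by (intro mult_left_mono sum_constant_paths_le that(2)) auto
      also have "\<dots> \<le> (\<Sum>\<xi>\<in>paths M. posterior M x \<xi> * q \<xi>)"
        unfolding sum_distrib_left by (intro sum_mono mult_right_mono p(2) that)
      finally show ?thesis .
    qed
    have "p * min c1 c2 * (norm (y - z))^2 \<le> midgap (Sur x) y z" if xyz: "x \<in> K" "y \<in> K" "z \<in> K" for x y z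
    proof -
      have "min c1 c2 * (norm (y - z))^2 = min c1 c2 * (norm (fst y - fst z))^2 + min c1 c2 * (norm (snd y - snd z))^2"
        by (simp add: norm_prod_power2[of "y - z"] distrib_left)
      also have "\<dots> \<le> c1 * (norm (fst y - fst z))^2 + c2 * (norm (snd y - snd z))^2"
        by (intro add_mono mult_right_mono) auto
      also have "\<dots> \<le> (\<Sum>i\<in>UNIV. gap_trans (constant_path i) y z) + (\<Sum>j\<in>UNIV. gap_obs x (constant_path j) y z)"
        by (intro add_mono c1(2) c2(2) xyz)
      finally have "p * (min c1 c2 * (norm (y - z))^2) \<le>
          p * ((\<Sum>i\<in>UNIV. gap_trans (constant_path i) y z) + (\<Sum>j\<in>UNIV. gap_obs x (constant_path j) y z))"
        using p(1) by (intro mult_left_mono) auto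
      also have "\<dots> \<le> (\<Sum>\<xi>\<in>paths M. posterior M x \<xi> * gap_trans \<xi> y z) +
          (\<Sum>\<xi>\<in>paths M. posterior M x \<xi> * gap_obs x \<xi> y z)"
        unfolding distrib_left using xyz K(3)
        by (intro add_mono weighted gap_trans_nonneg gap_obs_nonneg) auto
      finally show ?thesis
        using R_midgap_nonneg[OF subsetD[OF K(3) xyz(2)] subsetD[OF K(3) xyz(3)]]
        unfolding Sur_midgap mult.assoc by linarith
    qed
    then show ?thesis using p(1) c1(1) c2(1) by (intro exI[of _ "p * min c1 c2"]) auto
  qed
qed

end

section \<open>Convergence of the EM++ iterates\<close>

theorem mainTheorem2:
  fixes M :: "('d::{finite,linorder}, 'ny::finite, 'nz::finite, 'ng::finite,
               'b::euclidean_space) switching_model"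
    and V D :: "'ng \<Rightarrow> 'm::euclidean_space set"
    and g :: "'ng \<Rightarrow> 'm \<Rightarrow> real"
    and A :: "'ng \<Rightarrow> real ^ 'ny \<Rightarrow> real ^ 'nz \<Rightarrow> 'b \<Rightarrow> 'm"
    and R :: "('nz, 'd, 'b) param \<Rightarrow> real"
    and R1 :: "('nz, 'd) trans_param \<Rightarrow> real"
    and R2 :: "('b, 'd) obs_param \<Rightarrow> real"
    and \<theta> :: "nat \<Rightarrow> ('nz, 'd, 'b) param"
  assumes "valid_model M"
    and "assumption_obs M V D g A"
    and "assumption_reg M R R1 R2"
    and "assumption_smooth M V D g A R"
    and "KL_property param_space (params M) (reg_nll_ext M R)"
    and "EMpp_iterates M R1 R2 \<theta>"
  shows "\<exists>\<theta>s \<in> params M.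
     \<theta> \<longlonglongrightarrow> \<theta>s \<and>
     has_gradient param_space (reg_nll M R) 0 \<theta>s \<and>
     (\<forall>c \<alpha> b. 0 < c \<and> 0 \<le> \<alpha> \<and> \<alpha> < 1 \<and>
        KL_at param_space (reg_nll_ext M R) \<theta>s (\<lambda>s. c * s powr (1 - \<alpha>)) b \<longrightarrow>
          (\<alpha> = 0 \<longrightarrow> (\<exists>K. \<forall>k\<ge>K. \<theta> k = \<theta>s)) \<and>
          (0 < \<alpha> \<and> \<alpha> \<le> 1/2 \<longrightarrow>
             (\<exists>\<omega>>0. \<exists>\<tau>. 0 \<le> \<tau> \<and> \<tau> < 1 \<and> (\<forall>k. norm (\<theta> k - \<theta>s) \<le> \<omega> * \<tau> ^ k))) \<and>
          (1/2 < \<alpha> \<longrightarrow>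
             (\<exists>\<omega>>0. \<forall>k\<ge>1. norm (\<theta> k - \<theta>s) \<le> \<omega> * real k powr (- ((1 - \<alpha>) / (2 * \<alpha> - 1))))))"
proof -
  interpret em_model M V D g A R R1 R2
    by unfold_locales (use assms in \<open>auto simp: KL_property_def\<close>)
  have min1: "Q1 M (\<theta> k) (fst (\<theta> (Suc k))) + R1 (fst (\<theta> (Suc k))) \<le> Q1 M (\<theta> k) \<Theta> + R1 \<Theta>"
    if "\<Theta> \<in> Theta_space" for k \<Theta>
    using assms(6) that unfolding EMpp_iterates_def is_arg_min_linorder by blast
  have min2: "Q2 M (\<theta> k) (snd (\<theta> (Suc k))) + R2 (snd (\<theta> (Suc k))) \<le> Q2 M (\<theta> k) \<beta> + R2 \<beta>"
    if "\<beta> \<in> betas M" for k \<beta>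
    using assms(6) that unfolding EMpp_iterates_def is_arg_min_linorder by blast
  have start: "\<theta> 0 \<in> X" using assms(6) by (simp add: EMpp_iterates_def)
  have iter: "\<theta> (Suc k) \<in> X" for k
    using assms(6) unfolding EMpp_iterates_def is_arg_min_linorder X_iff by blast
  have R: "R p = R1 (fst p) + R2 (snd p)" if "p \<in> X" for p
    using assms(3) that by (simp add: assumption_reg_def)
  interpret majorization_minimization S X "reg_nll M R" Sur \<theta>
  proof unfold_locales
    show "\<exists>F'. (reg_nll M R has_derivative F') (at x within S)" if "x \<in> X" for x
      using reg_nll_differentiable[OF that] unfolding differentiable_def .
    show "Sur (\<theta> k) (\<theta> (Suc k)) \<le> Sur (\<theta> k) y" if "y \<in> X" for k y
      using min1[of "fst y" k] min2[of "snd y" k] that iter[of k] R[OF that] R[OF iter[of k]]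
      unfolding Sur_def X_iff by linarith
    show "\<exists>a>0. \<forall>x\<in>K. \<forall>y\<in>K. \<forall>z\<in>K. a * (norm (y - z))^2 \<le> midgap (Sur x) y z"
      if "compact K" "convex K" "K \<subseteq> X" for K using Sur_strong[OF that] .
    show "\<exists>L\<ge>0. \<forall>x\<in>K. \<exists>F'. lip_deriv S K L (Sur x) F'"
      if "compact K" "convex K" "K \<subseteq> X" for K using Sur_lip_deriv[OF that] .
  qed (fact subspace_param_space X_subset_S openin_X convex_X major start iter compact_sublevel)+
  have ext: "reg_nll_ext M R = (\<lambda>x. if x \<in> X then ereal (reg_nll M R x) else \<infinity>)"
    by (simp add: reg_nll_ext_def fun_eq_iff)
  have KL: "\<exists>\<psi> b. KL_at S (\<lambda>x. if x \<in> X then ereal (reg_nll M R x) else \<infinity>) x0 \<psi> b" if "x0 \<in> X" for x0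
    using assms(5) that unfolding KL_property_def ext by blast
  from KL_convergence[OF KL] obtain l where l: "l \<in> X" "\<theta> \<longlonglongrightarrow> l"
      "(reg_nll M R has_derivative (\<lambda>h. 0)) (at l within S)"
    and rates: "\<And>c \<alpha> b. 0 < c \<Longrightarrow> 0 \<le> \<alpha> \<Longrightarrow> \<alpha> < 1 \<Longrightarrow>
        KL_at S (\<lambda>x. if x \<in> X then ereal (reg_nll M R x) else \<infinity>) l (\<lambda>s. c * s powr (1 - \<alpha>)) b \<Longrightarrow>
          (\<alpha> = 0 \<longrightarrow> (\<exists>K. \<forall>k\<ge>K. \<theta> k = l)) \<and>
          (0 < \<alpha> \<and> \<alpha> \<le> 1/2 \<longrightarrow>
             (\<exists>\<omega>>0. \<exists>\<tau>. 0 \<le> \<tau> \<and> \<tau> < 1 \<and> (\<forall>k. norm (\<theta> k - l) \<le> \<omega> * \<tau> ^ k))) \<and>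
          (1/2 < \<alpha> \<longrightarrow>
             (\<exists>\<omega>>0. \<forall>k\<ge>1. norm (\<theta> k - l) \<le> \<omega> * real k powr (- ((1 - \<alpha>) / (2 * \<alpha> - 1)))))"
    by blast
  show ?thesis
  proof (intro bexI[OF _ l(1)] conjI allI)
    show "\<theta> \<longlonglongrightarrow> l" by (rule l(2))
    show "has_gradient S (reg_nll M R) 0 l"
      using l(3) subspace_0[OF subspace_param_space] by (simp add: has_gradient_def)
  qed (unfold ext, intro impI, elim conjE, rule rates; assumption)
qed

end
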